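(* Let $(\mathcal{B},\mathbb{E},\mathfrak{s})$ be an extriangulated category with enough projectives and enough injectives, and let $((\mathcal{S},\mathcal{T}),(\mathcal{U},\mathcal{V}))$ be a twin cotorsion pair on $\mathcal{B}$ with heart $\overline{\mathcal{H}}=\mathcal{H}/[\mathcal{W}]$, where $\mathcal{W}=\mathcal{T}\cap\mathcal{U}$. If $\mathcal{U}\subseteq\mathcal{S}*\mathcal{T}$ and $\operatorname{\mathsf{Proj}}\mathcal{B}\subseteq\mathcal{W}$, then $\overline{\mathcal{H}}$ is left integral, and hence integral. Respectively, if $\mathcal{T}\subseteq\mathcal{U}*\mathcal{V}$ and $\operatorname{\mathsf{Inj}}\mathcal{B}\subseteq\mathcal{W}$, then $\overline{\mathcal{H}}$ is right integral, and hence integral.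
   Context: **Extriangulated categories (Nakaoka--Palu).** Let $\mathcal{B}$ be an additive category and $\mathbb{E}\colon\mathcal{B}^{\mathrm{op}}\times\mathcal{B}\to\mathsf{Ab}$ a biadditive functor. An element $\delta\in\mathbb{E}(C,A)$ is an extension. For $f\colon A\to X$ and $g\colon Y\to C$ put $f_*\delta=\mathbb{E}(C,f)(\delta)\in\mathbb{E}(C,X)$ and $g^*\delta=\mathbb{E}(g,A)(\delta)\in\mathbb{E}(Y,A)$. A morphism of extensions from $\delta\in\mathbb{E}(C,A)$ to $\delta'\in\mathbb{E}(D,B)$ is a pair $(f\colon A\to B,\,h\colon C\to D)$ with $f_*\delta=h^*\delta'$. Two sequences $A\xrightarrow{a}B\xrightarrow{b}C$ and $A\xrightarrow{a'}B'\xrightarrow{b'}C$ are equivalent if there is an isomorphism $g\colon B\to B'$ with $ga=a'$ and $b'g=b$; $[A\xrightarrow{a}B\xrightarrow{b}C]$ denotes the equivalence class. Let $\mathfrak{s}$ assign to each extension $\delta\in\mathbb{E}(C,A)$ an equivalence class $\mathfrak{s}(\delta)=[A\xrightarrow{a}B\xrightarrow{b}C]$; one says that $\delta$ is realised by $A\xrightarrow{a}B\xrightarrow{b}C$. $\mathfrak{s}$ is a realisation of $\mathbb{E}$ if, whenever $\mathfrak{s}(\delta)=[A\xrightarrow{a}B\xrightarrow{b}C]$, $\mathfrak{s}(\delta')=[A'\xrightarrow{a'}B'\xrightarrow{b'}C']$ and $(f,h)\colon\delta\to\delta'$ is a morphism of extensions, there is $g\colon B\to B'$ with $ga=a'f$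 and $b'g=hb$ (then $(f,g,h)$ realises $(f,h)$). It is additive if (i) $0\in\mathbb{E}(C,A)$ is realised by the split sequence $A\to A\oplus C\to C$ for all $A,C$, and (ii) if $\delta\in\mathbb{E}(C,A)$ and $\delta'\in\mathbb{E}(C',A')$ are realised by $A\xrightarrow{a}B\xrightarrow{b}C$ and $A'\xrightarrow{a'}B'\xrightarrow{b'}C'$ respectively, then $\delta\oplus\delta'=(i_A)_*(p_C)^*\delta+(i_{A'})_*(p_{C'})^*\delta'\in\mathbb{E}(C\oplus C',A\oplus A')$ is realised by $A\oplus A'\xrightarrow{a\oplus a'}B\oplus B'\xrightarrow{b\oplus b'}C\oplus C'$, where $i$ and $p$ denote the canonical inclusions and projections. $(\mathcal{B},\mathbb{E},\mathfrak{s})$ is an extriangulated category if: (ET1) $\mathbb{E}$ is biadditive; (ET2) $\mathfrak{s}$ is an additive realisation of $\mathbb{E}$; (ET3) if $\mathfrak{s}(\delta)=[A\xrightarrow{a}B\xrightarrow{b}C]$, $\mathfrak{s}(\delta')=[A'\xrightarrow{a'}B'\xrightarrow{b'}C']$ and $f\colon A\to A'$, $g\colon B\to B'$ satisfy $ga=a'f$, then there is $h\colon C\to C'$ with $f_*\delta=h^*\delta'$ and $hb=b'g$; (ET3$^{\mathrm{op}}$) dually, if $g\colon B\to B'$, $h\colon C\to C'$ satisfy $hb=b'g$, then there is $f\colon A\to A'$ with $f_*\delta=h^*\delta'$ and $ga=a'f$; (ET4) if $\delta\in\mathbb{E}(D,A)$ and $\delta'\in\mathbb{E}(F,B)$ are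 realised by $A\xrightarrow{a}B\xrightarrow{a'}D$ and $B\xrightarrow{b}C\xrightarrow{b'}F$, then there are an object $E$, an extension $\delta''\in\mathbb{E}(E,A)$ realised by $A\xrightarrow{c}C\xrightarrow{c'}E$, and morphisms $d\colon D\to E$, $e\colon E\to F$ with $c=ba$, $c'b=da'$, $ec'=b'$, $\mathfrak{s}((a')_*\delta')=[D\xrightarrow{d}E\xrightarrow{e}F]$, $d^*\delta''=\delta$ and $a_*\delta''=e^*\delta'$; (ET4$^{\mathrm{op}}$) the dual of (ET4). A conflation is a sequence $A\to B\to C$ that realises some extension in $\mathbb{E}(C,A)$. **Projectives and injectives.** An object $P\in\mathcal{B}$ is projective if for every conflation $A\to B\xrightarrow{b}C$ and every $c\colon P\to C$ there is $d\colon P\to B$ with $bd=c$. $\operatorname{\mathsf{Proj}}\mathcal{B}$ is the full subcategory of projective objects. $\mathcal{B}$ has enough projectives if for every $C\in\mathcal{B}$ there is a conflation $A\to P\to C$ with $P$ projective. Injective objects, $\operatorname{\mathsf{Inj}}\mathcal{B}$ and having enough injectives are defined dually. **Twin cotorsion pairs.** For full subcategories $\mathcal{X},\mathcal{Y}$ of $\mathcal{B}$ closed under isomorphisms: $\operatorname{Cone}(\mathcal{Y},\mathcal{X})$ is the full subcategory of objects $Z$ admitting a conflation $Y\to X\to Z$ with $X\in\mathcal{X}$, $Y\in\mathcal{Y}$; $\operatorname{CoCone}(\mathcal{Y},\mathcal{X})$ is the full subcategory of objects $Z$ admitting a conflation $Z\to Y\to X$ with $X\in\mathcal{X}$, $Y\in\mathcal{Y}$;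 $\mathcal{X}*\mathcal{Y}$ is the full subcategory of objects $Z$ admitting a conflation $X\to Z\to Y$ with $X\in\mathcal{X}$, $Y\in\mathcal{Y}$. A pair $(\mathcal{U},\mathcal{V})$ of full additive subcategories closed under direct summands is a cotorsion pair on $\mathcal{B}$ if $\mathbb{E}(\mathcal{U},\mathcal{V})=0$ (i.e. $\mathbb{E}(U,V)=0$ for all $U\in\mathcal{U}$, $V\in\mathcal{V}$) and $\mathcal{B}=\operatorname{Cone}(\mathcal{V},\mathcal{U})=\operatorname{CoCone}(\mathcal{V},\mathcal{U})$. If $(\mathcal{S},\mathcal{T})$ and $(\mathcal{U},\mathcal{V})$ are cotorsion pairs on $\mathcal{B}$, then $((\mathcal{S},\mathcal{T}),(\mathcal{U},\mathcal{V}))$ is a twin cotorsion pair on $\mathcal{B}$ if $\mathbb{E}(\mathcal{S},\mathcal{V})=0$ (equivalently $\mathcal{S}\subseteq\mathcal{U}$, equivalently $\mathcal{V}\subseteq\mathcal{T}$). **Heart.** For a twin cotorsion pair $((\mathcal{S},\mathcal{T}),(\mathcal{U},\mathcal{V}))$ define full subcategories $\mathcal{W}=\mathcal{T}\cap\mathcal{U}$, $\mathcal{B}^-=\operatorname{CoCone}(\mathcal{W},\mathcal{S})$, $\mathcal{B}^+=\operatorname{Cone}(\mathcal{V},\mathcal{W})$, $\mathcal{H}=\mathcal{B}^-\cap\mathcal{B}^+$. $[\mathcal{W}]$ is the ideal of morphisms factoring through an object of $\mathcal{W}$. The heart is the additive quotient $\overline{\mathcal{H}}=\mathcal{H}/[\mathcal{W}]$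 (objects of $\mathcal{H}$, morphism groups $\mathcal{B}(X,Y)/[\mathcal{W}](X,Y)$). It is known (Liu--Nakaoka) that $\overline{\mathcal{H}}$ is semi-abelian, in particular preabelian (additive, with all kernels and cokernels); here a preabelian category is semi-abelian if every morphism $f$ can be written as $f=ip$ with $i$ a monomorphism and $p$ a cokernel, and also as $f=i'p'$ with $i'$ a kernel and $p'$ an epimorphism. **Integral.** A preabelian category is left integral if epimorphisms are stable under pullback (for every pullback of an epimorphism along any morphism, the pulled-back morphism is an epimorphism), right integral if monomorphisms are stable under pushout, and integral if it is both left and right integral. *)

theory Defs
  imports "HOL-Algebra.Coset"
begin

text \<open>
  A category is a record over a type of objects and a type of arrows. The operations
  \<open>Add\<close> and \<open>Zero\<close> carry the group structure on the morphism sets; they are constrained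
  from \<open>preadditive_category\<close> onwards only. All operations are meaningful on the carriers
  only. Abelian groups are the (multiplicatively written) \<open>comm_group\<close>s of HOL-Algebra.
\<close>

record ('o, 'm) category =
  Obj :: "'o set"
  Arr :: "'m set"
  Dom :: "'m \<Rightarrow> 'o"
  Cod :: "'m \<Rightarrow> 'o"
  Id :: "'o \<Rightarrow> 'm"
  Comp :: "'m \<Rightarrow> 'm \<Rightarrow> 'm"  (infixl "\<cdot>\<index>" 70)
  Add :: "'m \<Rightarrow> 'm \<Rightarrow> 'm"
  Zero :: "'o \<Rightarrow> 'o \<Rightarrow> 'm"

definition Hom :: "('o, 'm, 'z) category_scheme \<Rightarrow> 'o \<Rightarrow> 'o \<Rightarrow> 'm set"
  where "Hom K X Y = {f \<in> Arr K. Dom K f = X \<and> Cod K f = Y}"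

definition HomGrp :: "('o, 'm, 'z) category_scheme \<Rightarrow> 'o \<Rightarrow> 'o \<Rightarrow> 'm monoid"
  where "HomGrp K X Y = \<lparr>carrier = Hom K X Y, monoid.mult = Add K, one = Zero K X Y\<rparr>"

locale category =
  fixes K :: "('o, 'm, 'z) category_scheme" (structure)
  assumes Dom_Obj: "f \<in> Arr K \<Longrightarrow> Dom K f \<in> Obj K"
    and Cod_Obj: "f \<in> Arr K \<Longrightarrow> Cod K f \<in> Obj K"
    and Id_Hom: "X \<in> Obj K \<Longrightarrow> Id K X \<in> Hom K X X"
    and Comp_Hom: "f \<in> Hom K X Y \<Longrightarrow> g \<in> Hom K Y Z \<Longrightarrow> g \<cdot> f \<in> Hom K X Z"
    and Comp_assoc: "f \<in> Hom K W X \<Longrightarrow> g \<in> Hom K X Y \<Longrightarrow> h \<in> Hom K Y Z \<Longrightarrow>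
      h \<cdot> (g \<cdot> f) = (h \<cdot> g) \<cdot> f"
    and Comp_Id: "f \<in> Hom K X Y \<Longrightarrow> f \<cdot> Id K X = f"
    and Id_Comp: "f \<in> Hom K X Y \<Longrightarrow> Id K Y \<cdot> f = f"

locale preadditive_category = category +
  assumes HomGrp_comm_group: "X \<in> Obj K \<Longrightarrow> Y \<in> Obj K \<Longrightarrow> comm_group (HomGrp K X Y)"
    and Comp_Add: "f \<in> Hom K X Y \<Longrightarrow> f' \<in> Hom K X Y \<Longrightarrow> g \<in> Hom K Y Z \<Longrightarrow>
      g \<cdot> Add K f f' = Add K (g \<cdot> f) (g \<cdot> f')"
    and Add_Comp: "f \<in> Hom K X Y \<Longrightarrow> g \<in> Hom K Y Z \<Longrightarrow> g' \<in> Hom K Y Z \<Longrightarrow>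
      Add K g g' \<cdot> f = Add K (g \<cdot> f) (g' \<cdot> f)"

definition isomorphism :: "('o, 'm, 'z) category_scheme \<Rightarrow> 'o \<Rightarrow> 'o \<Rightarrow> 'm \<Rightarrow> bool"
  where "isomorphism K X Y f \<longleftrightarrow> f \<in> Hom K X Y \<and>
    (\<exists>g \<in> Hom K Y X. g \<cdot>\<^bsub>K\<^esub> f = Id K X \<and> f \<cdot>\<^bsub>K\<^esub> g = Id K Y)"

definition monic :: "('o, 'm, 'z) category_scheme \<Rightarrow> 'm \<Rightarrow> bool"
  where "monic K f \<longleftrightarrow> f \<in> Arr K \<and>
    (\<forall>X \<in> Obj K. \<forall>u \<in> Hom K X (Dom K f). \<forall>v \<in> Hom K X (Dom K f).
      f \<cdot>\<^bsub>K\<^esub> u = f \<cdot>\<^bsub>K\<^esub> v \<longrightarrow> u = v)"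

definition epic :: "('o, 'm, 'z) category_scheme \<Rightarrow> 'm \<Rightarrow> bool"
  where "epic K f \<longleftrightarrow> f \<in> Arr K \<and>
    (\<forall>X \<in> Obj K. \<forall>u \<in> Hom K (Cod K f) X. \<forall>v \<in> Hom K (Cod K f) X.
      u \<cdot>\<^bsub>K\<^esub> f = v \<cdot>\<^bsub>K\<^esub> f \<longrightarrow> u = v)"

definition zero_object :: "('o, 'm, 'z) category_scheme \<Rightarrow> 'o \<Rightarrow> bool"
  where "zero_object K Z \<longleftrightarrow> Z \<in> Obj K \<and>
    (\<forall>X \<in> Obj K. (\<exists>!f. f \<in> Hom K X Z) \<and> (\<exists>!f. f \<in> Hom K Z X))"

text \<open>\<open>biproduct K A B S i j p q\<close>: \<open>S = A \<oplus> B\<close> with inclusions \<open>i, j\<close> and projections \<open>p, q\<close>.\<close>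

definition biproduct ::
    "('o, 'm, 'z) category_scheme \<Rightarrow> 'o \<Rightarrow> 'o \<Rightarrow> 'o \<Rightarrow> 'm \<Rightarrow> 'm \<Rightarrow> 'm \<Rightarrow> 'm \<Rightarrow> bool"
  where "biproduct K A B S i j p q \<longleftrightarrow>
    i \<in> Hom K A S \<and> j \<in> Hom K B S \<and> p \<in> Hom K S A \<and> q \<in> Hom K S B \<and>
    p \<cdot>\<^bsub>K\<^esub> i = Id K A \<and> q \<cdot>\<^bsub>K\<^esub> j = Id K B \<and>
    q \<cdot>\<^bsub>K\<^esub> i = Zero K A B \<and> p \<cdot>\<^bsub>K\<^esub> j = Zero K B A \<and>
    Add K (i \<cdot>\<^bsub>K\<^esub> p) (j \<cdot>\<^bsub>K\<^esub> q) = Id K S"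

locale additive_category = preadditive_category +
  assumes ex_zero_object: "\<exists>Z. zero_object K Z"
    and ex_biproduct: "A \<in> Obj K \<Longrightarrow> B \<in> Obj K \<Longrightarrow> \<exists>S i j p q. biproduct K A B S i j p q"

definition is_kernel :: "('o, 'm, 'z) category_scheme \<Rightarrow> 'm \<Rightarrow> 'm \<Rightarrow> bool"
  where "is_kernel K k f \<longleftrightarrow> k \<in> Arr K \<and> f \<in> Arr K \<and> Cod K k = Dom K f \<and>
    f \<cdot>\<^bsub>K\<^esub> k = Zero K (Dom K k) (Cod K f) \<and>
    (\<forall>X \<in> Obj K. \<forall>u \<in> Hom K X (Dom K f). f \<cdot>\<^bsub>K\<^esub> u = Zero K X (Cod K f) \<longrightarrow>
      (\<exists>!v. v \<in> Hom K X (Dom K k) \<and> k \<cdot>\<^bsub>K\<^esub> v = u))"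

definition is_cokernel :: "('o, 'm, 'z) category_scheme \<Rightarrow> 'm \<Rightarrow> 'm \<Rightarrow> bool"
  where "is_cokernel K c f \<longleftrightarrow> c \<in> Arr K \<and> f \<in> Arr K \<and> Dom K c = Cod K f \<and>
    c \<cdot>\<^bsub>K\<^esub> f = Zero K (Dom K f) (Cod K c) \<and>
    (\<forall>X \<in> Obj K. \<forall>u \<in> Hom K (Cod K f) X. u \<cdot>\<^bsub>K\<^esub> f = Zero K (Dom K f) X \<longrightarrow>
      (\<exists>!v. v \<in> Hom K (Cod K c) X \<and> v \<cdot>\<^bsub>K\<^esub> c = u))"

locale preabelian_category = additive_category +
  assumes ex_kernel: "f \<in> Arr K \<Longrightarrow> \<exists>k. is_kernel K k f"
    and ex_cokernel: "f \<in> Arr K \<Longrightarrow> \<exists>c. is_cokernel K c f"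

text \<open>
  \<open>pullback K f g p q\<close>: the square \<open>f p = g q\<close> is a pullback, so \<open>q\<close> is \<open>f\<close> pulled back along
  \<open>g\<close>. \<open>pushout K f g p q\<close>: the square \<open>p f = q g\<close> is a pushout, so \<open>q\<close> is \<open>f\<close> pushed out
  along \<open>g\<close>.
\<close>

definition pullback :: "('o, 'm, 'z) category_scheme \<Rightarrow> 'm \<Rightarrow> 'm \<Rightarrow> 'm \<Rightarrow> 'm \<Rightarrow> bool"
  where "pullback K f g p q \<longleftrightarrow>
    f \<in> Arr K \<and> g \<in> Arr K \<and> p \<in> Arr K \<and> q \<in> Arr K \<and>
    Cod K f = Cod K g \<and> Dom K p = Dom K q \<and> Cod K p = Dom K f \<and> Cod K q = Dom K g \<and>
    f \<cdot>\<^bsub>K\<^esub> p = g \<cdot>\<^bsub>K\<^esub> q \<and>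
    (\<forall>X \<in> Obj K. \<forall>u \<in> Hom K X (Dom K f). \<forall>v \<in> Hom K X (Dom K g).
      f \<cdot>\<^bsub>K\<^esub> u = g \<cdot>\<^bsub>K\<^esub> v \<longrightarrow>
      (\<exists>!w. w \<in> Hom K X (Dom K p) \<and> p \<cdot>\<^bsub>K\<^esub> w = u \<and> q \<cdot>\<^bsub>K\<^esub> w = v))"

definition pushout :: "('o, 'm, 'z) category_scheme \<Rightarrow> 'm \<Rightarrow> 'm \<Rightarrow> 'm \<Rightarrow> 'm \<Rightarrow> bool"
  where "pushout K f g p q \<longleftrightarrow>
    f \<in> Arr K \<and> g \<in> Arr K \<and> p \<in> Arr K \<and> q \<in> Arr K \<and>
    Dom K f = Dom K g \<and> Cod K p = Cod K q \<and> Dom K p = Cod K f \<and> Dom K q = Cod K g \<and>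
    p \<cdot>\<^bsub>K\<^esub> f = q \<cdot>\<^bsub>K\<^esub> g \<and>
    (\<forall>X \<in> Obj K. \<forall>u \<in> Hom K (Cod K f) X. \<forall>v \<in> Hom K (Cod K g) X.
      u \<cdot>\<^bsub>K\<^esub> f = v \<cdot>\<^bsub>K\<^esub> g \<longrightarrow>
      (\<exists>!w. w \<in> Hom K (Cod K p) X \<and> w \<cdot>\<^bsub>K\<^esub> p = u \<and> w \<cdot>\<^bsub>K\<^esub> q = v))"

definition left_integral :: "('o, 'm, 'z) category_scheme \<Rightarrow> bool"
  where "left_integral K \<longleftrightarrow> preabelian_category K \<and>
    (\<forall>f g p q. pullback K f g p q \<longrightarrow> epic K f \<longrightarrow> epic K q)"

definition right_integral :: "('o, 'm, 'z) category_scheme \<Rightarrow> bool"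
  where "right_integral K \<longleftrightarrow> preabelian_category K \<and>
    (\<forall>f g p q. pushout K f g p q \<longrightarrow> monic K f \<longrightarrow> monic K q)"

definition integral_category :: "('o, 'm, 'z) category_scheme \<Rightarrow> bool"
  where "integral_category K \<longleftrightarrow> left_integral K \<and> right_integral K"


section \<open>Extriangulated categories\<close>

text \<open>
  \<open>Ext C A\<close> is the group \<open>\<bbbE>(C, A)\<close>. For \<open>g: Y \<rightarrow> C\<close> and \<open>f: A \<rightarrow> X\<close>, \<open>ExtMap g f\<close> is the map
  \<open>\<bbbE>(g, f): \<bbbE>(C, A) \<rightarrow> \<bbbE>(Y, X)\<close>. Elements of different \<open>Ext C A\<close> may coincide as elements of
  the type \<open>'e\<close>, so \<open>Realn C A \<delta>\<close>, the class \<open>\<s>(\<delta>)\<close>, takes the two end objects as arguments.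
  The sequence with arrows \<open>a: A \<rightarrow> B\<close> and \<open>b: B \<rightarrow> C\<close> is the pair \<open>(a, b)\<close>.
\<close>

record ('o, 'm, 'e) ext_category = "('o, 'm) category" +
  Ext :: "'o \<Rightarrow> 'o \<Rightarrow> 'e monoid"
  ExtMap :: "'m \<Rightarrow> 'm \<Rightarrow> 'e \<Rightarrow> 'e"
  Realn :: "'o \<Rightarrow> 'o \<Rightarrow> 'e \<Rightarrow> ('m \<times> 'm) set"

text \<open>\<open>push B C f \<delta>\<close> is \<open>f\<^sub>* \<delta>\<close> for \<open>\<delta> \<in> \<bbbE>(C, A)\<close>; \<open>pull B A g \<delta>\<close> is \<open>g\<^sup>* \<delta>\<close> for \<open>\<delta> \<in> \<bbbE>(C, A)\<close>.\<close>

definition push :: "('o, 'm, 'e, 'z) ext_category_scheme \<Rightarrow> 'o \<Rightarrow> 'm \<Rightarrow> 'e \<Rightarrow> 'e"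
  where "push B C f = ExtMap B (Id B C) f"

definition pull :: "('o, 'm, 'e, 'z) ext_category_scheme \<Rightarrow> 'o \<Rightarrow> 'm \<Rightarrow> 'e \<Rightarrow> 'e"
  where "pull B A g = ExtMap B g (Id B A)"

definition seq_class :: "('o, 'm, 'z) category_scheme \<Rightarrow> 'm \<Rightarrow> 'm \<Rightarrow> ('m \<times> 'm) set"
  where "seq_class K a b = {(a', b'). \<exists>Y g.
    a' \<in> Hom K (Dom K a) Y \<and> b' \<in> Hom K Y (Cod K b) \<and> isomorphism K (Cod K a) Y g \<and>
    g \<cdot>\<^bsub>K\<^esub> a = a' \<and> b' \<cdot>\<^bsub>K\<^esub> g = b}"

text \<open>\<open>realised \<B> \<delta> A a B b C\<close>: \<open>\<delta> \<in> \<bbbE>(C, A)\<close> and \<open>\<s>(\<delta>) = [A \<rightarrow> B \<rightarrow> C]\<close> with arrows \<open>a\<close> and \<open>b\<close>.\<close>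

definition realised ::
    "('o, 'm, 'e, 'z) ext_category_scheme \<Rightarrow> 'e \<Rightarrow> 'o \<Rightarrow> 'm \<Rightarrow> 'o \<Rightarrow> 'm \<Rightarrow> 'o \<Rightarrow> bool"
  where "realised \<B> \<delta> A a B b C \<longleftrightarrow>
    \<delta> \<in> carrier (Ext \<B> C A) \<and> a \<in> Hom \<B> A B \<and> b \<in> Hom \<B> B C \<and>
    Realn \<B> C A \<delta> = seq_class \<B> a b"

definition conflation ::
    "('o, 'm, 'e, 'z) ext_category_scheme \<Rightarrow> 'o \<Rightarrow> 'm \<Rightarrow> 'o \<Rightarrow> 'm \<Rightarrow> 'o \<Rightarrow> bool"
  where "conflation \<B> A a B b C \<longleftrightarrow> (\<exists>\<delta>. realised \<B> \<delta> A a B b C)"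

locale ET1 = additive_category \<B>
  for \<B> :: "('o, 'm, 'e, 'z) ext_category_scheme" (structure) +
  assumes Ext_comm_group: "C \<in> Obj \<B> \<Longrightarrow> A \<in> Obj \<B> \<Longrightarrow> comm_group (Ext \<B> C A)"
    and ExtMap_hom: "g \<in> Hom \<B> Y C \<Longrightarrow> f \<in> Hom \<B> A X \<Longrightarrow>
      ExtMap \<B> g f \<in> hom (Ext \<B> C A) (Ext \<B> Y X)"
    and ExtMap_Id: "C \<in> Obj \<B> \<Longrightarrow> A \<in> Obj \<B> \<Longrightarrow> \<delta> \<in> carrier (Ext \<B> C A) \<Longrightarrow>
      ExtMap \<B> (Id \<B> C) (Id \<B> A) \<delta> = \<delta>"
    and ExtMap_Comp: "g \<in> Hom \<B> Y C \<Longrightarrow> g' \<in> Hom \<B> Y' Y \<Longrightarrow>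
      f \<in> Hom \<B> A X \<Longrightarrow> f' \<in> Hom \<B> X X' \<Longrightarrow> \<delta> \<in> carrier (Ext \<B> C A) \<Longrightarrow>
      ExtMap \<B> (g \<cdot> g') (f' \<cdot> f) \<delta> = ExtMap \<B> g' f' (ExtMap \<B> g f \<delta>)"
    and push_Add: "C \<in> Obj \<B> \<Longrightarrow> f \<in> Hom \<B> A X \<Longrightarrow> f' \<in> Hom \<B> A X \<Longrightarrow>
      \<delta> \<in> carrier (Ext \<B> C A) \<Longrightarrow>
      push \<B> C (Add \<B> f f') \<delta> = push \<B> C f \<delta> \<otimes>\<^bsub>Ext \<B> C X\<^esub> push \<B> C f' \<delta>"
    and pull_Add: "A \<in> Obj \<B> \<Longrightarrow> g \<in> Hom \<B> Y C \<Longrightarrow> g' \<in> Hom \<B> Y C \<Longrightarrow>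
      \<delta> \<in> carrier (Ext \<B> C A) \<Longrightarrow>
      pull \<B> A (Add \<B> g g') \<delta> = pull \<B> A g \<delta> \<otimes>\<^bsub>Ext \<B> Y A\<^esub> pull \<B> A g' \<delta>"

text \<open>
  Direct sums are only determined up to isomorphism, so additivity of the realisation is
  required for all choices of biproducts. In \<open>Realn_sum\<close>, the arrow \<open>a \<oplus> a'\<close> is written
  \<open>i\<^sub>B a p\<^sub>A + i\<^sub>B' a' p\<^sub>A'\<close>, and likewise \<open>b \<oplus> b'\<close>.
\<close>

locale ET2 = ET1 +
  assumes Realn_class: "C \<in> Obj \<B> \<Longrightarrow> A \<in> Obj \<B> \<Longrightarrow> \<delta> \<in> carrier (Ext \<B> C A) \<Longrightarrow>
      \<exists>a B b. realised \<B> \<delta> A a B b C"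
    and Realn_morphism: "realised \<B> \<delta> A a B b C \<Longrightarrow> realised \<B> \<delta>' A' a' B' b' C' \<Longrightarrow>
      f \<in> Hom \<B> A A' \<Longrightarrow> h \<in> Hom \<B> C C' \<Longrightarrow> push \<B> C f \<delta> = pull \<B> A' h \<delta>' \<Longrightarrow>
      \<exists>g \<in> Hom \<B> B B'. g \<cdot> a = a' \<cdot> f \<and> b' \<cdot> g = h \<cdot> b"
    and Realn_zero: "biproduct \<B> A C S i j p q \<Longrightarrow> realised \<B> \<one>\<^bsub>Ext \<B> C A\<^esub> A i S q C"
    and Realn_sum: "realised \<B> \<delta> A a B b C \<Longrightarrow> realised \<B> \<delta>' A' a' B' b' C' \<Longrightarrow>
      biproduct \<B> A A' SA iA iA' pA pA' \<Longrightarrow>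
      biproduct \<B> B B' SB iB iB' pB pB' \<Longrightarrow>
      biproduct \<B> C C' SC iC iC' pC pC' \<Longrightarrow>
      realised \<B>
        (push \<B> SC iA (pull \<B> A pC \<delta>) \<otimes>\<^bsub>Ext \<B> SC SA\<^esub> push \<B> SC iA' (pull \<B> A' pC' \<delta>'))
        SA (Add \<B> (iB \<cdot> a \<cdot> pA) (iB' \<cdot> a' \<cdot> pA'))
        SB (Add \<B> (iC \<cdot> b \<cdot> pB) (iC' \<cdot> b' \<cdot> pB')) SC"

locale extriangulated_category = ET2 +
  assumes ET3: "realised \<B> \<delta> A a B b C \<Longrightarrow> realised \<B> \<delta>' A' a' B' b' C' \<Longrightarrow>
      f \<in> Hom \<B> A A' \<Longrightarrow> g \<in> Hom \<B> B B' \<Longrightarrow> g \<cdot> a = a' \<cdot> f \<Longrightarrow>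
      \<exists>h \<in> Hom \<B> C C'. push \<B> C f \<delta> = pull \<B> A' h \<delta>' \<and> h \<cdot> b = b' \<cdot> g"
    and ET3_op: "realised \<B> \<delta> A a B b C \<Longrightarrow> realised \<B> \<delta>' A' a' B' b' C' \<Longrightarrow>
      g \<in> Hom \<B> B B' \<Longrightarrow> h \<in> Hom \<B> C C' \<Longrightarrow> h \<cdot> b = b' \<cdot> g \<Longrightarrow>
      \<exists>f \<in> Hom \<B> A A'. push \<B> C f \<delta> = pull \<B> A' h \<delta>' \<and> g \<cdot> a = a' \<cdot> f"
    and ET4: "realised \<B> \<delta> A a B a' D \<Longrightarrow> realised \<B> \<delta>' B b C b' F \<Longrightarrow>
      \<exists>E \<delta>'' c c'. realised \<B> \<delta>'' A c C c' E \<and>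
        (\<exists>d \<in> Hom \<B> D E. \<exists>e \<in> Hom \<B> E F.
          c = b \<cdot> a \<and> c' \<cdot> b = d \<cdot> a' \<and> e \<cdot> c' = b' \<and>
          realised \<B> (push \<B> F a' \<delta>') D d E e F \<and>
          pull \<B> A d \<delta>'' = \<delta> \<and> push \<B> E a \<delta>'' = pull \<B> B e \<delta>')"
    and ET4_op: "realised \<B> \<delta> D a' B a A \<Longrightarrow> realised \<B> \<delta>' F b' C b B \<Longrightarrow>
      \<exists>E \<delta>'' c c'. realised \<B> \<delta>'' E c' C c A \<and>
        (\<exists>d \<in> Hom \<B> E D. \<exists>e \<in> Hom \<B> F E.
          c = a \<cdot> b \<and> b \<cdot> c' = a' \<cdot> d \<and> c' \<cdot> e = b' \<and>
          realised \<B> (pull \<B> F a' \<delta>') F e E d D \<and>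
          push \<B> A d \<delta>'' = \<delta> \<and> pull \<B> E a \<delta>'' = push \<B> B e \<delta>')"


section \<open>Projective and injective objects\<close>

definition Proj :: "('o, 'm, 'e, 'z) ext_category_scheme \<Rightarrow> 'o set"
  where "Proj \<B> = {P \<in> Obj \<B>. \<forall>A a B b C. conflation \<B> A a B b C \<longrightarrow>
    (\<forall>c \<in> Hom \<B> P C. \<exists>d \<in> Hom \<B> P B. b \<cdot>\<^bsub>\<B>\<^esub> d = c)}"

definition Inj :: "('o, 'm, 'e, 'z) ext_category_scheme \<Rightarrow> 'o set"
  where "Inj \<B> = {I \<in> Obj \<B>. \<forall>A a B b C. conflation \<B> A a B b C \<longrightarrow>
    (\<forall>c \<in> Hom \<B> A I. \<exists>d \<in> Hom \<B> B I. d \<cdot>\<^bsub>\<B>\<^esub> a = c)}"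

definition enough_projectives :: "('o, 'm, 'e, 'z) ext_category_scheme \<Rightarrow> bool"
  where "enough_projectives \<B> \<longleftrightarrow>
    (\<forall>C \<in> Obj \<B>. \<exists>A a P b. P \<in> Proj \<B> \<and> conflation \<B> A a P b C)"

definition enough_injectives :: "('o, 'm, 'e, 'z) ext_category_scheme \<Rightarrow> bool"
  where "enough_injectives \<B> \<longleftrightarrow>
    (\<forall>A \<in> Obj \<B>. \<exists>a I b C. I \<in> Inj \<B> \<and> conflation \<B> A a I b C)"


section \<open>Twin cotorsion pairs\<close>

text \<open>Full subcategories are given by their sets of objects.\<close>

definition Cone :: "('o, 'm, 'e, 'z) ext_category_scheme \<Rightarrow> 'o set \<Rightarrow> 'o set \<Rightarrow> 'o set"
  where "Cone \<B> \<Y> \<X> =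
    {Z \<in> Obj \<B>. \<exists>Y \<in> \<Y>. \<exists>X \<in> \<X>. \<exists>a b. conflation \<B> Y a X b Z}"

definition CoCone :: "('o, 'm, 'e, 'z) ext_category_scheme \<Rightarrow> 'o set \<Rightarrow> 'o set \<Rightarrow> 'o set"
  where "CoCone \<B> \<Y> \<X> =
    {Z \<in> Obj \<B>. \<exists>Y \<in> \<Y>. \<exists>X \<in> \<X>. \<exists>a b. conflation \<B> Z a Y b X}"

definition Star :: "('o, 'm, 'e, 'z) ext_category_scheme \<Rightarrow> 'o set \<Rightarrow> 'o set \<Rightarrow> 'o set"
  where "Star \<B> \<X> \<Y> =
    {Z \<in> Obj \<B>. \<exists>X \<in> \<X>. \<exists>Y \<in> \<Y>. \<exists>a b. conflation \<B> X a Z b Y}"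

definition additive_subcategory :: "('o, 'm, 'z) category_scheme \<Rightarrow> 'o set \<Rightarrow> bool"
  where "additive_subcategory K \<X> \<longleftrightarrow> \<X> \<subseteq> Obj K \<and> (\<exists>Z \<in> \<X>. zero_object K Z) \<and>
    (\<forall>A \<in> \<X>. \<forall>B \<in> \<X>. \<forall>S i j p q. biproduct K A B S i j p q \<longrightarrow> S \<in> \<X>)"

definition summand_closed :: "('o, 'm, 'z) category_scheme \<Rightarrow> 'o set \<Rightarrow> bool"
  where "summand_closed K \<X> \<longleftrightarrow>
    (\<forall>S \<in> \<X>. \<forall>A B i j p q. biproduct K A B S i j p q \<longrightarrow> A \<in> \<X>)"

definition Ext_vanish :: "('o, 'm, 'e, 'z) ext_category_scheme \<Rightarrow> 'o set \<Rightarrow> 'o set \<Rightarrow> bool"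
  where "Ext_vanish \<B> \<X> \<Y> \<longleftrightarrow>
    (\<forall>X \<in> \<X>. \<forall>Y \<in> \<Y>. carrier (Ext \<B> X Y) = {\<one>\<^bsub>Ext \<B> X Y\<^esub>})"

definition cotorsion_pair :: "('o, 'm, 'e, 'z) ext_category_scheme \<Rightarrow> 'o set \<Rightarrow> 'o set \<Rightarrow> bool"
  where "cotorsion_pair \<B> \<U> \<V> \<longleftrightarrow>
    additive_subcategory \<B> \<U> \<and> summand_closed \<B> \<U> \<and>
    additive_subcategory \<B> \<V> \<and> summand_closed \<B> \<V> \<and>
    Ext_vanish \<B> \<U> \<V> \<and> Obj \<B> = Cone \<B> \<V> \<U> \<and> Obj \<B> = CoCone \<B> \<V> \<U>"

definition twin_cotorsion_pair ::
    "('o, 'm, 'e, 'z) ext_category_scheme \<Rightarrow> 'o set \<Rightarrow> 'o set \<Rightarrow> 'o set \<Rightarrow> 'o set \<Rightarrow> bool"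
  where "twin_cotorsion_pair \<B> \<S> \<T> \<U> \<V> \<longleftrightarrow>
    cotorsion_pair \<B> \<S> \<T> \<and> cotorsion_pair \<B> \<U> \<V> \<and> Ext_vanish \<B> \<S> \<V>"


section \<open>The heart\<close>

definition factor_ideal :: "('o, 'm, 'z) category_scheme \<Rightarrow> 'o set \<Rightarrow> 'o \<Rightarrow> 'o \<Rightarrow> 'm set"
  where "factor_ideal K \<W> X Y =
    {g \<cdot>\<^bsub>K\<^esub> f | f g. \<exists>W \<in> \<W>. f \<in> Hom K X W \<and> g \<in> Hom K W Y}"

definition residue_class ::
    "('o, 'm, 'z) category_scheme \<Rightarrow> ('o \<Rightarrow> 'o \<Rightarrow> 'm set) \<Rightarrow> 'm \<Rightarrow> 'm set"
  where "residue_class K I f =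
    I (Dom K f) (Cod K f) #>\<^bsub>HomGrp K (Dom K f) (Cod K f)\<^esub> f"

text \<open>
  The quotient, by an ideal \<open>I\<close>, of the full subcategory on a set \<open>\<X>\<close> of objects. Its
  morphisms \<open>X \<rightarrow> Y\<close> are the elements of the factor group \<open>HomGrp K X Y Mod I X Y\<close>, i.e. the
  cosets of \<open>I X Y\<close>; the operations are those of (arbitrarily chosen) representatives.
\<close>

definition quotient_category ::
    "('o, 'm, 'z) category_scheme \<Rightarrow> 'o set \<Rightarrow> ('o \<Rightarrow> 'o \<Rightarrow> 'm set) \<Rightarrow> ('o, 'm set) category"
  where "quotient_category K \<X> I =
    \<lparr>Obj = \<X>,
     Arr = (\<Union>X \<in> \<X>. \<Union>Y \<in> \<X>. carrier (HomGrp K X Y Mod I X Y)),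
     Dom = (\<lambda>F. Dom K (SOME f. f \<in> F)),
     Cod = (\<lambda>F. Cod K (SOME f. f \<in> F)),
     Id = (\<lambda>X. residue_class K I (Id K X)),
     Comp = (\<lambda>G F. residue_class K I ((SOME g. g \<in> G) \<cdot>\<^bsub>K\<^esub> (SOME f. f \<in> F))),
     Add = (\<lambda>F G. residue_class K I (Add K (SOME f. f \<in> F) (SOME g. g \<in> G))),
     Zero = (\<lambda>X Y. residue_class K I (Zero K X Y))\<rparr>"

definition heart_objects ::
    "('o, 'm, 'e, 'z) ext_category_scheme \<Rightarrow> 'o set \<Rightarrow> 'o set \<Rightarrow> 'o set \<Rightarrow> 'o set \<Rightarrow> 'o set"
  where "heart_objects \<B> \<S> \<T> \<U> \<V> =
    CoCone \<B> (\<T> \<inter> \<U>) \<S> \<inter> Cone \<B> \<V> (\<T> \<inter> \<U>)"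

definition heart ::
    "('o, 'm, 'e, 'z) ext_category_scheme \<Rightarrow> 'o set \<Rightarrow> 'o set \<Rightarrow> 'o set \<Rightarrow> 'o set \<Rightarrow>
      ('o, 'm set) category"
  where "heart \<B> \<S> \<T> \<U> \<V> =
    quotient_category \<B> (heart_objects \<B> \<S> \<T> \<U> \<V>) (factor_ideal \<B> (\<T> \<inter> \<U>))"

end

theory Submission
  imports Defs
begin

text \<open>
  Let \<open>f: A \<rightarrow> B\<close> be a morphism of \<open>\<H>\<close>. Pushing out a conflation \<open>A \<rightarrow> W \<rightarrow> S\<close> along \<open>f\<close> gives an
  object \<open>M\<close> with \<open>B \<rightarrow> M \<rightarrow> S\<close>, and the reflection of \<open>M\<close> into \<open>\<H>\<close> is the cokernel of \<open>f\<close> in the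
  heart; kernels are dual.

  Assume \<open>\<U> \<subseteq> \<S> * \<T>\<close> and that projectives lie in \<open>\<W>\<close>. If \<open>z: Y \<rightarrow> B\<close> is killed by the cokernel
  of \<open>f\<close>, then \<open>Y \<rightarrow> M\<close> factors as \<open>Y \<rightarrow> U \<rightarrow> M\<close> with \<open>U \<in> \<U>\<close>. Let \<open>Y \<rightarrow> W' \<rightarrow> S'\<close> and
  \<open>S\<^sub>0 \<rightarrow> U \<rightarrow> T\<^sub>0\<close> be conflations. The pushout to \<open>U\<close> of the extension of \<open>S'\<close> by \<open>Y\<close> comes from an
  extension \<open>S\<^sub>0 \<rightarrow> F \<rightarrow> S'\<close> because \<open>\<bbbE>(S', T\<^sub>0) = 0\<close>. The syzygy \<open>X\<close> of \<open>F\<close> comes with a map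
  \<open>e: X \<rightarrow> Y\<close> which is epic in the heart, and \<open>z e\<close> factors through \<open>f\<close> modulo \<open>\<W>\<close>.

  This lifting property yields both halves of integrality. For an epimorphism \<open>f\<close> every \<open>z\<close> is killed
  by the cokernel, so pullbacks of \<open>f\<close> are epic. Applied to \<open>(f, -g)\<close>, it shows that pushouts of
  monomorphisms are monic, without the theorem that left and right integrality are equivalent for
  semi-abelian categories.
\<close>

section \<open>Preadditive and additive categories\<close>

text \<open>The record carries no negation. An arrow determines its own morphism group through
  domain and codomain, so the inverse in that group depends on the arrow alone.\<close>

definition Neg :: "('o, 'm, 'z) category_scheme \<Rightarrow> 'm \<Rightarrow> 'm"
  where "Neg K f = inv\<^bsub>HomGrp K (Dom K f) (Cod K f)\<^esub> f"

abbreviation Sub :: "('o, 'm, 'z) category_scheme \<Rightarrow> 'm \<Rightarrow> 'm \<Rightarrow> 'm"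
  where "Sub K f g \<equiv> Add K f (Neg K g)"

context category
begin

text \<open>The axioms quantify over objects that a rewriter cannot guess. In terms of
  \<open>Arr\<close>, \<open>Dom\<close> and \<open>Cod\<close> they become conditional rewrite
  rules, and most equations below follow by unfolding \<open>Hom\<close> and rewriting.\<close>

lemma Comp_Arr [simp]:
  assumes "f \<in> Arr K" "g \<in> Arr K" "Cod K f = Dom K g"
  shows "g \<cdot> f \<in> Arr K" "Dom K (g \<cdot> f) = Dom K f" "Cod K (g \<cdot> f) = Cod K g"
  using Comp_Hom[of f "Dom K f" "Dom K g" g "Cod K g"] assms by (auto simp: Hom_def)

lemma Comp_assoc_Arr [simp]:
  assumes "f \<in> Arr K" "g \<in> Arr K" "h \<in> Arr K" "Cod K f = Dom K g" "Cod K g = Dom K h"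
  shows "(h \<cdot> g) \<cdot> f = h \<cdot> (g \<cdot> f)"
  using Comp_assoc[of f "Dom K f" "Dom K g" g "Dom K h" h "Cod K h"] assms by (auto simp: Hom_def)

lemma Id_Arr [simp]:
  assumes "X \<in> Obj K"
  shows "Id K X \<in> Arr K" "Dom K (Id K X) = X" "Cod K (Id K X) = X"
  using Id_Hom[OF assms] by (auto simp: Hom_def)

lemma Comp_Id_Arr [simp]: "f \<in> Arr K \<Longrightarrow> Dom K f = X \<Longrightarrow> f \<cdot> Id K X = f"
  using Comp_Id[of f "Dom K f" "Cod K f"] by (auto simp: Hom_def)

lemma Id_Comp_Arr [simp]: "f \<in> Arr K \<Longrightarrow> Cod K f = X \<Longrightarrow> Id K X \<cdot> f = f"
  using Id_Comp[of f "Dom K f" "Cod K f"] by (auto simp: Hom_def)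

declare Dom_Obj [simp] Cod_Obj [simp]

lemma Hom_Obj: "f \<in> Hom K X Y \<Longrightarrow> X \<in> Obj K" "f \<in> Hom K X Y \<Longrightarrow> Y \<in> Obj K"
  by (auto simp: Hom_def)

text \<open>Composites are normalised to right-nested form, where the left side of
  \<open>b \<cdot> a = d\<close> no longer occurs as a subterm of
  \<open>b \<cdot> (a \<cdot> x)\<close>. This is the form of the equation that still
  applies.\<close>

lemma Comp_eq_extend:
  assumes "b \<cdot> a = d" "x \<in> Hom K X Y" "a \<in> Hom K Y Z" "b \<in> Hom K Z W"
  shows "b \<cdot> (a \<cdot> x) = d \<cdot> x"
  using assms Comp_assoc by metis

end

context preadditive_category
begin

lemma Zero_Arr [simp]:
  assumes "X \<in> Obj K" "Y \<in> Obj K"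
  shows "Zero K X Y \<in> Arr K" "Dom K (Zero K X Y) = X" "Cod K (Zero K X Y) = Y"
proof -
  interpret G: comm_group "HomGrp K X Y" by (rule HomGrp_comm_group[OF assms])
  show "Zero K X Y \<in> Arr K" "Dom K (Zero K X Y) = X" "Cod K (Zero K X Y) = Y"
    using G.one_closed by (auto simp: HomGrp_def Hom_def)
qed

lemma Add_Arr [simp]:
  assumes "f \<in> Arr K" "g \<in> Arr K" "Dom K f = Dom K g" "Cod K f = Cod K g"
  shows "Add K f g \<in> Arr K" "Dom K (Add K f g) = Dom K g" "Cod K (Add K f g) = Cod K g"
proof -
  interpret G: comm_group "HomGrp K (Dom K g) (Cod K g)" using assms by (intro HomGrp_comm_group) auto
  show "Add K f g \<in> Arr K" "Dom K (Add K f g) = Dom K g" "Cod K (Add K f g) = Cod K g"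
    using G.m_closed[of f g] assms by (auto simp: HomGrp_def Hom_def)
qed

lemma Neg_Arr [simp]:
  assumes "f \<in> Arr K"
  shows "Neg K f \<in> Arr K" "Dom K (Neg K f) = Dom K f" "Cod K (Neg K f) = Cod K f"
proof -
  interpret G: comm_group "HomGrp K (Dom K f) (Cod K f)" using assms by (intro HomGrp_comm_group) auto
  show "Neg K f \<in> Arr K" "Dom K (Neg K f) = Dom K f" "Cod K (Neg K f) = Cod K f"
    using G.inv_closed[of f] assms by (auto simp: HomGrp_def Hom_def Neg_def)
qed

lemma Zero_Hom: "X \<in> Obj K \<Longrightarrow> Y \<in> Obj K \<Longrightarrow> Zero K X Y \<in> Hom K X Y"
  by (simp add: Hom_def)

lemma Add_Hom: "f \<in> Hom K X Y \<Longrightarrow> g \<in> Hom K X Y \<Longrightarrow> Add K f g \<in> Hom K X Y"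
  by (simp add: Hom_def)

lemma Neg_Hom: "f \<in> Hom K X Y \<Longrightarrow> Neg K f \<in> Hom K X Y"
  by (simp add: Hom_def)

lemma Sub_Hom: "f \<in> Hom K X Y \<Longrightarrow> g \<in> Hom K X Y \<Longrightarrow> Sub K f g \<in> Hom K X Y"
  by (simp add: Hom_def)

lemma Add_assoc [simp]:
  assumes "f \<in> Arr K" "g \<in> Arr K" "h \<in> Arr K" "Dom K f = Dom K g" "Cod K f = Cod K g"
    "Dom K g = Dom K h" "Cod K g = Cod K h"
  shows "Add K (Add K f g) h = Add K f (Add K g h)"
proof -
  interpret G: comm_group "HomGrp K (Dom K g) (Cod K g)" using assms by (intro HomGrp_comm_group) auto
  show ?thesis using G.m_assoc[of f g h] assms by (auto simp: HomGrp_def Hom_def)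
qed

lemma Add_commute:
  assumes "f \<in> Arr K" "g \<in> Arr K" "Dom K f = Dom K g" "Cod K f = Cod K g"
  shows "Add K f g = Add K g f"
proof -
  interpret G: comm_group "HomGrp K (Dom K g) (Cod K g)" using assms by (intro HomGrp_comm_group) auto
  show ?thesis using G.m_comm[of f g] assms by (auto simp: HomGrp_def Hom_def)
qed

lemma Add_left_commute:
  assumes "f \<in> Arr K" "g \<in> Arr K" "h \<in> Arr K" "Dom K f = Dom K g" "Cod K f = Cod K g"
    "Dom K g = Dom K h" "Cod K g = Cod K h"
  shows "Add K f (Add K g h) = Add K g (Add K f h)"
  using Add_assoc[of f g h] Add_assoc[of g f h] Add_commute[of f g] assms by simp

lemma Add_Zero [simp]:
  assumes "f \<in> Arr K" "Dom K f = X" "Cod K f = Y"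
  shows "Add K f (Zero K X Y) = f" "Add K (Zero K X Y) f = f"
proof -
  interpret G: comm_group "HomGrp K X Y" using assms by (intro HomGrp_comm_group) auto
  show "Add K f (Zero K X Y) = f" "Add K (Zero K X Y) f = f"
    using G.r_one[of f] G.l_one[of f] assms by (auto simp: HomGrp_def Hom_def)
qed

lemma Add_Neg [simp]:
  assumes "f \<in> Arr K"
  shows "Add K f (Neg K f) = Zero K (Dom K f) (Cod K f)"
    "Add K (Neg K f) f = Zero K (Dom K f) (Cod K f)"
proof -
  interpret G: comm_group "HomGrp K (Dom K f) (Cod K f)" using assms by (intro HomGrp_comm_group) auto
  show "Add K f (Neg K f) = Zero K (Dom K f) (Cod K f)"
    "Add K (Neg K f) f = Zero K (Dom K f) (Cod K f)"
    using G.r_inv[of f] G.l_inv[of f] assms by (auto simp: HomGrp_def Hom_def Neg_def)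
qed

lemma Add_Neg_cancel [simp]:
  assumes "f \<in> Arr K" "g \<in> Arr K" "Dom K f = Dom K g" "Cod K f = Cod K g"
  shows "Add K f (Add K (Neg K f) g) = g" "Add K (Neg K f) (Add K f g) = g"
proof -
  have "Add K (Add K f (Neg K f)) g = g" "Add K (Add K (Neg K f) f) g = g"
    using assms by (simp_all del: Add_assoc)
  then show "Add K f (Add K (Neg K f) g) = g" "Add K (Neg K f) (Add K f g) = g"
    using assms Add_assoc[of f "Neg K f" g] Add_assoc[of "Neg K f" f g] by simp_all
qed

lemma Add_left_cancel:
  assumes "f \<in> Arr K" "g \<in> Arr K" "h \<in> Arr K" "Dom K f = Dom K g" "Cod K f = Cod K g"
    "Dom K f = Dom K h" "Cod K f = Cod K h" "Add K f g = Add K f h"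
  shows "g = h"
proof -
  have "Add K (Neg K f) (Add K f g) = Add K (Neg K f) (Add K f h)" unfolding assms(8) ..
  then show ?thesis using assms(1-7) Add_Neg_cancel(2)[of f g] Add_Neg_cancel(2)[of f h] by metis
qed

lemma Neg_unique:
  assumes "f \<in> Arr K" "g \<in> Arr K" "Dom K f = Dom K g" "Cod K f = Cod K g"
    "Add K f g = Zero K (Dom K g) (Cod K g)"
  shows "g = Neg K f"
  by (rule Add_left_cancel[of f]) (use assms in simp_all)

lemma Sub_eq_Zero:
  assumes "f \<in> Hom K X Y" "g \<in> Hom K X Y"
  shows "Sub K f g = Zero K X Y \<longleftrightarrow> f = g"
proof
  assume *: "Sub K f g = Zero K X Y"
  have "f = Add K (Sub K f g) g" using assms by (simp add: Hom_def)
  also have "\<dots> = g" unfolding * using assms by (simp add: Hom_def)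
  finally show "f = g" .
qed (use assms in \<open>auto simp: Hom_def\<close>)

lemma Neg_Neg [simp]: "f \<in> Arr K \<Longrightarrow> Neg K (Neg K f) = f"
  by (rule Neg_unique[symmetric]) auto

lemma Neg_Add [simp]:
  assumes "f \<in> Arr K" "g \<in> Arr K" "Dom K f = Dom K g" "Cod K f = Cod K g"
  shows "Neg K (Add K f g) = Add K (Neg K f) (Neg K g)"
  by (rule Neg_unique[symmetric]) (use assms in \<open>simp_all add: Add_left_commute\<close>)

lemma Comp_Add_Arr [simp]:
  assumes "f \<in> Arr K" "f' \<in> Arr K" "g \<in> Arr K" "Dom K f = Dom K f'" "Cod K f = Cod K f'" "Cod K f' = Dom K g"
  shows "g \<cdot> Add K f f' = Add K (g \<cdot> f) (g \<cdot> f')"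
  using Comp_Add[of f "Dom K f" "Dom K g" f' g "Cod K g"] assms by (auto simp: Hom_def)

lemma Add_Comp_Arr [simp]:
  assumes "f \<in> Arr K" "g \<in> Arr K" "g' \<in> Arr K" "Dom K g = Dom K g'" "Cod K g = Cod K g'" "Cod K f = Dom K g'"
  shows "Add K g g' \<cdot> f = Add K (g \<cdot> f) (g' \<cdot> f)"
  using Add_Comp[of f "Dom K f" "Dom K g" g "Cod K g" g'] assms by (auto simp: Hom_def)

lemma Comp_Zero [simp]:
  assumes "g \<in> Arr K" "Dom K g = Y" "X \<in> Obj K"
  shows "g \<cdot> Zero K X Y = Zero K X (Cod K g)"
proof (rule Add_left_cancel[of "g \<cdot> Zero K X Y"])
  have Y: "Y \<in> Obj K" using assms(1,2) by auto
  have "g \<cdot> Add K (Zero K X Y) (Zero K X Y) = Add K (g \<cdot> Zero K X Y) (g \<cdot> Zero K X Y)"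
    using assms Y by (simp del: Add_Zero)
  then show "Add K (g \<cdot> Zero K X Y) (g \<cdot> Zero K X Y) = Add K (g \<cdot> Zero K X Y) (Zero K X (Cod K g))"
    using assms Y by simp
qed (use assms in auto)

lemma Zero_Comp [simp]:
  assumes "g \<in> Arr K" "Cod K g = X" "Y \<in> Obj K"
  shows "Zero K X Y \<cdot> g = Zero K (Dom K g) Y"
proof (rule Add_left_cancel[of "Zero K X Y \<cdot> g"])
  have X: "X \<in> Obj K" using assms(1,2) by auto
  have "Add K (Zero K X Y) (Zero K X Y) \<cdot> g = Add K (Zero K X Y \<cdot> g) (Zero K X Y \<cdot> g)"
    using assms X by (simp del: Add_Zero)
  then show "Add K (Zero K X Y \<cdot> g) (Zero K X Y \<cdot> g) = Add K (Zero K X Y \<cdot> g) (Zero K (Dom K g) Y)"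
    using assms X by simp
qed (use assms in auto)

lemma Comp_Neg [simp]:
  assumes "f \<in> Arr K" "g \<in> Arr K" "Cod K f = Dom K g"
  shows "g \<cdot> Neg K f = Neg K (g \<cdot> f)"
proof (rule Neg_unique)
  have "g \<cdot> Add K f (Neg K f) = Add K (g \<cdot> f) (g \<cdot> Neg K f)"
    using assms by (simp del: Add_Neg)
  then show "Add K (g \<cdot> f) (g \<cdot> Neg K f) = Zero K (Dom K (g \<cdot> Neg K f)) (Cod K (g \<cdot> Neg K f))"
    using assms by simp
qed (use assms in auto)

lemma Neg_Comp [simp]:
  assumes "f \<in> Arr K" "g \<in> Arr K" "Cod K f = Dom K g"
  shows "Neg K g \<cdot> f = Neg K (g \<cdot> f)"
proof (rule Neg_unique)
  have "Add K g (Neg K g) \<cdot> f = Add K (g \<cdot> f) (Neg K g \<cdot> f)"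
    using assms by (simp del: Add_Neg)
  then show "Add K (g \<cdot> f) (Neg K g \<cdot> f) = Zero K (Dom K (Neg K g \<cdot> f)) (Cod K (Neg K g \<cdot> f))"
    using assms by simp
qed (use assms in auto)

lemma Zero_Comp_Hom: "g \<in> Hom K X Y \<Longrightarrow> Z \<in> Obj K \<Longrightarrow> Zero K Y Z \<cdot> g = Zero K X Z"
  by (simp add: Hom_def)

lemma Comp_Zero_Hom: "g \<in> Hom K Y Z \<Longrightarrow> X \<in> Obj K \<Longrightarrow> g \<cdot> Zero K X Y = Zero K X Z"
  by (auto simp: Hom_def)

lemma Neg_Zero [simp]: "X \<in> Obj K \<Longrightarrow> Y \<in> Obj K \<Longrightarrow> Neg K (Zero K X Y) = Zero K X Y"
  by (rule Neg_unique[symmetric]) auto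

text \<open>Differences turn the equality of two composites into the vanishing of one, so only maps
  killed by \<open>f\<close> need testing.\<close>

lemma epicI:
  assumes "f \<in> Hom K A B"
    and "\<And>X u. u \<in> Hom K B X \<Longrightarrow> u \<cdot> f = Zero K A X \<Longrightarrow> u = Zero K B X"
  shows "epic K f"
  unfolding epic_def
proof (intro conjI ballI impI)
  fix X u v assume *: "X \<in> Obj K" "u \<in> Hom K (Cod K f) X" "v \<in> Hom K (Cod K f) X" "u \<cdot> f = v \<cdot> f"
  have B: "Cod K f = B" and f: "f \<in> Arr K" "Dom K f = A" using assms(1) by (auto simp: Hom_def)
  have "Sub K u v \<cdot> f = Sub K (u \<cdot> f) (v \<cdot> f)" using * f by (simp add: Hom_def)
  also have "\<dots> = Zero K A X" unfolding *(4) using * f by (simp add: Hom_def)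
  finally have "Sub K u v = Zero K B X" using * B by (intro assms(2) Sub_Hom) auto
  then show "u = v" using * B Sub_eq_Zero by metis
qed (use assms in \<open>auto simp: Hom_def\<close>)

lemma monicI:
  assumes "f \<in> Hom K A B"
    and "\<And>X u. u \<in> Hom K X A \<Longrightarrow> f \<cdot> u = Zero K X B \<Longrightarrow> u = Zero K X A"
  shows "monic K f"
  unfolding monic_def
proof (intro conjI ballI impI)
  fix X u v assume *: "X \<in> Obj K" "u \<in> Hom K X (Dom K f)" "v \<in> Hom K X (Dom K f)" "f \<cdot> u = f \<cdot> v"
  have A: "Dom K f = A" and f: "f \<in> Arr K" "Cod K f = B" using assms(1) by (auto simp: Hom_def)
  have "f \<cdot> Sub K u v = Sub K (f \<cdot> u) (f \<cdot> v)" using * f by (simp add: Hom_def)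
  also have "\<dots> = Zero K X B" unfolding *(4) using * f by (simp add: Hom_def)
  finally have "Sub K u v = Zero K X A" using * A by (intro assms(2) Sub_Hom) auto
  then show "u = v" using * A Sub_eq_Zero by metis
qed (use assms in \<open>auto simp: Hom_def\<close>)

lemma epicD:
  assumes "epic K f" "f \<in> Hom K A B" "u \<in> Hom K B X" "u \<cdot> f = Zero K A X"
  shows "u = Zero K B X"
  using assms(1) unfolding epic_def
  by (metis (mono_tags, lifting) Hom_Obj Zero_Comp Zero_Hom assms(2-4) Hom_def mem_Collect_eq)

lemma monicD:
  assumes "monic K f" "f \<in> Hom K A B" "u \<in> Hom K X A" "f \<cdot> u = Zero K X B"
  shows "u = Zero K X A"
  using assms(1) unfolding monic_def
  by (metis (mono_tags, lifting) Hom_Obj Comp_Zero Zero_Hom assms(2-4) Hom_def mem_Collect_eq)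

lemma zero_object_Hom:
  assumes "zero_object K Z" "X \<in> Obj K"
  shows "f \<in> Hom K X Z \<longleftrightarrow> f = Zero K X Z" "f \<in> Hom K Z X \<longleftrightarrow> f = Zero K Z X"
  using assms Zero_Hom[of X Z] Zero_Hom[of Z X] unfolding zero_object_def by auto

lemma zero_objectI:
  assumes "Z \<in> Obj K" "Id K Z = Zero K Z Z"
  shows "zero_object K Z"
  unfolding zero_object_def
proof (intro conjI ballI)
  fix X assume X: "X \<in> Obj K"
  have 1: "f = Zero K X Z" if f: "f \<in> Hom K X Z" for f
  proof -
    have "f = Id K Z \<cdot> f" using f Id_Comp by simp
    also have "\<dots> = Zero K X Z" unfolding assms(2) using f assms(1) by (simp add: Hom_def)
    finally show ?thesis .
  qed
  have 2: "f = Zero K Z X" if f: "f \<in> Hom K Z X" for f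
  proof -
    have "f = f \<cdot> Id K Z" using f Comp_Id by simp
    also have "\<dots> = Zero K Z X" unfolding assms(2) using f assms(1) by (auto simp: Hom_def)
    finally show ?thesis .
  qed
  show "\<exists>!f. f \<in> Hom K X Z" using 1 Zero_Hom X assms(1) by blast
  show "\<exists>!f. f \<in> Hom K Z X" using 2 Zero_Hom X assms(1) by blast
qed (rule assms(1))

text \<open>Through \<open>Realn_zero\<close> this gives the trivial conflations
  \<open>A = A -> 0\<close> and, after swapping, \<open>0 -> A = A\<close>. Comparing a conflation
  with these yields its basic exactness properties.\<close>

lemma biproduct_zero_right:
  assumes "zero_object K Z" "A \<in> Obj K"
  shows "biproduct K A Z A (Id K A) (Zero K Z A) (Id K A) (Zero K A Z)"
proof -
  have Z: "Z \<in> Obj K" "Id K Z = Zero K Z Z"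
    using assms(1) zero_object_Hom(1)[OF assms(1), of Z "Id K Z"] Id_Hom by (auto simp: zero_object_def)
  then show ?thesis using assms(2) by (simp add: biproduct_def Hom_def)
qed

lemma biproduct_swap:
  assumes "biproduct K A B S i j p q"
  shows "biproduct K B A S j i q p"
  using assms Add_commute[of "i \<cdot> p" "j \<cdot> q"] by (auto simp: biproduct_def Hom_def)

end

section \<open>Integrality from a lifting property of cokernels\<close>

lemma (in category) pullback_lift:
  assumes "pullback K f g p q" "u \<in> Hom K X (Dom K f)" "v \<in> Hom K X (Dom K g)" "f \<cdot> u = g \<cdot> v"
  obtains w where "w \<in> Hom K X (Dom K q)" "p \<cdot> w = u" "q \<cdot> w = v"
proof -
  have "\<exists>!w. w \<in> Hom K X (Dom K p) \<and> p \<cdot> w = u \<and> q \<cdot> w = v"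
    using assms Hom_Obj(1)[OF assms(2)] unfolding pullback_def by blast
  moreover have "Dom K p = Dom K q" using assms(1) by (simp add: pullback_def)
  ultimately show ?thesis using that by auto
qed

lemma (in category) pushout_lift:
  assumes "pushout K f g p q" "u \<in> Hom K (Cod K f) X" "v \<in> Hom K (Cod K g) X" "u \<cdot> f = v \<cdot> g"
  obtains w where "w \<in> Hom K (Cod K q) X" "w \<cdot> p = u" "w \<cdot> q = v"
proof -
  have "\<exists>!w. w \<in> Hom K (Cod K p) X \<and> w \<cdot> p = u \<and> w \<cdot> q = v"
    using assms Hom_Obj(2)[OF assms(2)] unfolding pushout_def by blast
  moreover have "Cod K p = Cod K q" using assms(1) by (simp add: pushout_def)
  ultimately show ?thesis using that by auto
qed

text \<open>
  The lifting property combines two facts about abelian categories: \<open>A \<rightarrow> Ker (Coker \<phi>)\<close> is an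
  epimorphism, and epimorphisms are stable under pullback.
\<close>

locale coker_lifting = preabelian_category +
  assumes coker_lift: "\<phi> \<in> Hom K A G \<Longrightarrow> z \<in> Hom K Y G \<Longrightarrow>
    is_cokernel K c \<phi> \<Longrightarrow> c \<cdot> z = Zero K Y (Cod K c) \<Longrightarrow>
    \<exists>X. \<exists>e \<in> Hom K X Y. \<exists>k \<in> Hom K X A. epic K e \<and> \<phi> \<cdot> k = z \<cdot> e"
begin

text \<open>The maps \<open>k\<close> and \<open>e\<close> form a cone over \<open>f\<close> and
  \<open>g\<close>, so the epimorphism \<open>e\<close> factors through the pullback as
  \<open>q \<cdot> w\<close>. Its outer factor \<open>q\<close> is then epic.\<close>

lemma left_integral: "left_integral K"
  unfolding left_integral_def
proof (intro conjI allI impI)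
  fix f g p q assume pb: "pullback K f g p q" and f: "epic K f"
  obtain A D B P where h: "f \<in> Hom K A D" "g \<in> Hom K B D" "p \<in> Hom K P A" "q \<in> Hom K P B"
    using pb unfolding pullback_def Hom_def by fastforce
  obtain c where c: "is_cokernel K c f" using ex_cokernel h(1) by (auto simp: Hom_def)
  have cH: "c \<in> Hom K D (Cod K c)" and c0: "c \<cdot> f = Zero K A (Cod K c)"
    using c h by (auto simp: is_cokernel_def Hom_def)
  \<comment> \<open>An epimorphism has zero cokernel, so the lifting property applies to every
    \<open>g\<close>.\<close>
  have "c = Zero K D (Cod K c)" by (rule epicD[OF f h(1) cH c0])
  then have "c \<cdot> g = Zero K B (Cod K c)"
    using Zero_Comp_Hom[OF h(2) Hom_Obj(2)[OF cH]] by metis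
  then obtain X e k where X: "e \<in> Hom K X B" "k \<in> Hom K X A" "epic K e" "f \<cdot> k = g \<cdot> e"
    using coker_lift[OF h(1,2) c] by blast
  then obtain w where w: "w \<in> Hom K X P" "q \<cdot> w = e"
    using pullback_lift[OF pb, of k X e] h by (auto simp: Hom_def)
  show "epic K q"
  proof (rule epicI[OF h(4)])
    fix Y u assume u: "u \<in> Hom K B Y" "u \<cdot> q = Zero K P Y"
    have "u \<cdot> e = Zero K X Y"
      using Comp_eq_extend[OF u(2) w(1) h(4) u(1)] w u Zero_Comp[of w P Y] Hom_Obj[of u]
      by (simp add: Hom_def)
    then show "u = Zero K B Y" using epicD X u by blast
  qed
qed (rule preabelian_category_axioms)

text \<open>Apply the lifting property to \<open>(f, -g): A \<rightarrow> B \<oplus> C\<close> and \<open>(0, y): Y \<rightarrow> B \<oplus> C\<close>.\<close>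

lemma right_integral: "right_integral K"
  unfolding right_integral_def
proof (intro conjI allI impI)
  fix f g p q assume po: "pushout K f g p q" and f: "monic K f"
  obtain A B C D where h: "f \<in> Hom K A B" "g \<in> Hom K A C" "p \<in> Hom K B D" "q \<in> Hom K C D"
    using po unfolding pushout_def Hom_def by fastforce
  have O: "A \<in> Obj K" "B \<in> Obj K" "C \<in> Obj K" "D \<in> Obj K" using h Hom_Obj by metis+
  obtain S i j r s where bp: "biproduct K B C S i j r s" using ex_biproduct O by blast
  then have H: "i \<in> Hom K B S" "j \<in> Hom K C S" "r \<in> Hom K S B" "s \<in> Hom K S C"
    and e: "r \<cdot> i = Id K B" "s \<cdot> j = Id K C" "s \<cdot> i = Zero K B C" "r \<cdot> j = Zero K C B"
    unfolding biproduct_def by auto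
  define \<phi> where "\<phi> = Sub K (i \<cdot> f) (j \<cdot> g)"
  have phi: "\<phi> \<in> Hom K A S" using h H by (simp add: \<phi>_def Hom_def)
  obtain c where c: "is_cokernel K c \<phi>" using ex_cokernel phi by (auto simp: Hom_def)
  define E where "E = Cod K c"
  have cH: "c \<in> Hom K S E" and c0: "c \<cdot> \<phi> = Zero K A E"
    using c phi by (auto simp: is_cokernel_def Hom_def E_def)
  have EO: "E \<in> Obj K" using cH Hom_Obj by blast
  \<comment> \<open>The components of \<open>c\<close> form a cocone on \<open>f\<close> and
    \<open>g\<close> and factor through the pushout. Hence whatever \<open>q\<close> kills is sent
    by \<open>j\<close> to something that \<open>c\<close> kills.\<close>
  have "Sub K (c \<cdot> i \<cdot> f) (c \<cdot> j \<cdot> g) = Zero K A E"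
    using c0 cH h H by (simp add: \<phi>_def Hom_def)
  then have "c \<cdot> i \<cdot> f = c \<cdot> j \<cdot> g"
    using Sub_eq_Zero[of "c \<cdot> i \<cdot> f" A E "c \<cdot> j \<cdot> g"] cH h H by (simp add: Hom_def)
  moreover have "c \<cdot> i \<in> Hom K (Cod K f) E" "c \<cdot> j \<in> Hom K (Cod K g) E" and q: "Cod K q = D"
    using h H cH by (simp_all add: Hom_def)
  ultimately obtain w where w: "w \<in> Hom K D E" "w \<cdot> q = c \<cdot> j"
    using pushout_lift[OF po, of "c \<cdot> i" E "c \<cdot> j"] unfolding q by blast
  show "monic K q"
  proof (rule monicI[OF h(4)])
    fix Y y assume y: "y \<in> Hom K Y C" "q \<cdot> y = Zero K Y D"
    have "c \<cdot> (j \<cdot> y) = w \<cdot> (q \<cdot> y)"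
      unfolding Comp_assoc[OF y(1) H(2) cH] Comp_assoc[OF y(1) h(4) w(1)] w(2) ..
    also have "\<dots> = Zero K Y E" using y(2) w(1) Hom_Obj[OF y(1)] by (simp add: Hom_def)
    finally have "c \<cdot> (j \<cdot> y) = Zero K Y (Cod K c)" by (simp add: E_def)
    then obtain X e k where X: "e \<in> Hom K X Y" "k \<in> Hom K X A" "epic K e" "\<phi> \<cdot> k = j \<cdot> y \<cdot> e"
      using coker_lift[OF phi Comp_Hom[OF y(1) H(2)] c] by blast
    have XO: "X \<in> Obj K" "Y \<in> Obj K" using X(1) Hom_Obj by blast+
    have 0: "r \<cdot> (\<phi> \<cdot> k) = r \<cdot> (j \<cdot> y \<cdot> e)" "s \<cdot> (\<phi> \<cdot> k) = s \<cdot> (j \<cdot> y \<cdot> e)" using X(4) by simp_all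
    have r: "r \<cdot> (i \<cdot> x) = x" "s \<cdot> (i \<cdot> x) = Zero K X C" if "x \<in> Hom K X B" for x
      using Comp_eq_extend[OF e(1) that] Comp_eq_extend[OF e(3) that] that H O by (simp_all add: Hom_def)
    have s: "s \<cdot> (j \<cdot> x) = x" "r \<cdot> (j \<cdot> x) = Zero K X B" if "x \<in> Hom K X C" for x
      using Comp_eq_extend[OF e(2) that] Comp_eq_extend[OF e(4) that] that H O by (simp_all add: Hom_def)
    \<comment> \<open>The component in \<open>B\<close> gives \<open>f \<cdot> k = 0\<close>, so
      \<open>k = 0\<close> because \<open>f\<close> is monic. The component in \<open>C\<close> then
      gives \<open>y \<cdot> e = 0\<close>, and \<open>e\<close> is epic.\<close>
    have "f \<cdot> k = Zero K X B"
      using 0(1) r[of "f \<cdot> k"] s[of "g \<cdot> k"] s[of "y \<cdot> e"] h H X(1,2) y(1) O XO by (simp add: \<phi>_def Hom_def)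
    then have k: "k = Zero K X A" using monicD[OF f h(1) X(2)] by blast
    have "Neg K (g \<cdot> k) = y \<cdot> e"
      using 0(2) r[of "f \<cdot> k"] s[of "g \<cdot> k"] s[of "y \<cdot> e"] h H X(1,2) y(1) O XO by (simp add: \<phi>_def Hom_def)
    then have "y \<cdot> e = Zero K X C" using k h O XO by (simp add: Hom_def)
    then show "y = Zero K Y C" using epicD[OF X(3,1) y(1)] by blast
  qed
qed (rule preabelian_category_axioms)

end

section \<open>Opposite categories\<close>

definition op_cat :: "('o, 'm, 'z) category_scheme \<Rightarrow> ('o, 'm) category"
  where "op_cat K = \<lparr>Obj = Obj K, Arr = Arr K, Dom = Cod K, Cod = Dom K, Id = Id K,
    Comp = (\<lambda>g f. Comp K f g), Add = Add K, Zero = (\<lambda>X Y. Zero K Y X)\<rparr>"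

text \<open>Dual statements about \<B> are obtained by instantiating lemmas at
  \<open>op_ext \<B>\<close>. The heart is a plain category, which is why \<open>op_cat\<close>
  exists beside it.\<close>

definition op_ext :: "('o, 'm, 'e, 'z) ext_category_scheme \<Rightarrow> ('o, 'm, 'e) ext_category"
  where "op_ext B = \<lparr>Obj = Obj B, Arr = Arr B, Dom = Cod B, Cod = Dom B, Id = Id B,
    Comp = (\<lambda>g f. Comp B f g), Add = Add B, Zero = (\<lambda>X Y. Zero B Y X),
    Ext = (\<lambda>C A. Ext B A C), ExtMap = (\<lambda>g f. ExtMap B f g),
    Realn = (\<lambda>C A \<delta>. {(b, a). (a, b) \<in> Realn B A C \<delta>})\<rparr>"

lemma op_cat_sel [simp]:
  "Obj (op_cat K) = Obj K" "Arr (op_cat K) = Arr K" "Dom (op_cat K) = Cod K" "Cod (op_cat K) = Dom K"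
  "Id (op_cat K) = Id K" "Comp (op_cat K) g f = Comp K f g" "Add (op_cat K) = Add K"
  "Zero (op_cat K) X Y = Zero K Y X" "Hom (op_cat K) X Y = Hom K Y X"
  by (auto simp: op_cat_def Hom_def)

lemma op_ext_sel [simp]:
  "Obj (op_ext B) = Obj B" "Arr (op_ext B) = Arr B" "Dom (op_ext B) = Cod B" "Cod (op_ext B) = Dom B"
  "Id (op_ext B) = Id B" "Comp (op_ext B) g f = Comp B f g" "Add (op_ext B) = Add B"
  "Zero (op_ext B) X Y = Zero B Y X" "Hom (op_ext B) X Y = Hom B Y X"
  "HomGrp (op_ext B) X Y = HomGrp B Y X"
  "Ext (op_ext B) C A = Ext B A C" "ExtMap (op_ext B) g f = ExtMap B f g"
  "push (op_ext B) C f = pull B C f" "pull (op_ext B) C f = push B C f"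
  by (auto simp: op_ext_def Hom_def HomGrp_def push_def pull_def)

lemma op_cat_dual:
  "is_cokernel (op_cat K) k f \<longleftrightarrow> is_kernel K k f"
  "pullback (op_cat K) f g p q \<longleftrightarrow> pushout K f g p q"
  "pushout (op_cat K) f g p q \<longleftrightarrow> pullback K f g p q"
  "epic (op_cat K) f \<longleftrightarrow> monic K f"
  "monic (op_cat K) f \<longleftrightarrow> epic K f"
  by (auto simp: is_kernel_def is_cokernel_def pullback_def pushout_def epic_def monic_def)

lemma right_integral_dual:
  assumes "preabelian_category K" "left_integral (op_cat K)"
  shows "right_integral K"
  using assms by (auto simp: right_integral_def left_integral_def op_cat_dual)

lemma left_integral_dual:
  assumes "preabelian_category K" "right_integral (op_cat K)"
  shows "left_integral K"
  using assms by (auto simp: right_integral_def left_integral_def op_cat_dual)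

lemma op_ext_zero_object [simp]: "zero_object (op_ext B) Z \<longleftrightarrow> zero_object B Z"
  by (auto simp: zero_object_def)

lemma op_ext_isomorphism [simp]: "isomorphism (op_ext B) X Y f \<longleftrightarrow> isomorphism B Y X f"
  by (auto simp: isomorphism_def)

lemma op_ext_biproduct [simp]: "biproduct (op_ext B) X Y S i j p q \<longleftrightarrow> biproduct B X Y S p q i j"
  by (auto simp: biproduct_def)

text \<open>An equivalence of sequences is an isomorphism directed from the old middle term to the
  new one. Reversing arrows turns it round, so each inclusion passes to the inverse.\<close>

lemma seq_class_op:
  fixes L :: "('o, 'm, 'e, 'y) ext_category_scheme"
  assumes "category L" "a \<in> Hom L A B" "b \<in> Hom L B C"
  shows "seq_class (op_ext L) b a = {(b', a'). (a', b') \<in> seq_class L a b}"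
proof -
  interpret L: category L by fact
  have "(b', a') \<in> seq_class (op_ext L) b a \<longleftrightarrow> (a', b') \<in> seq_class L a b" for a' b'
  proof
    assume "(b', a') \<in> seq_class (op_ext L) b a"
    then obtain Y g where *: "b' \<in> Hom L Y C" "a' \<in> Hom L A Y" "isomorphism L Y B g"
      "b \<cdot>\<^bsub>L\<^esub> g = b'" "g \<cdot>\<^bsub>L\<^esub> a' = a"
      using assms by (auto simp: seq_class_def Hom_def)
    then obtain h where h: "h \<in> Hom L B Y" "h \<cdot>\<^bsub>L\<^esub> g = Id L Y" "g \<cdot>\<^bsub>L\<^esub> h = Id L B" "g \<in> Hom L Y B"
      by (auto simp: isomorphism_def)
    have "h \<cdot>\<^bsub>L\<^esub> a = a'"
      using L.Comp_assoc[OF *(2) h(4,1)] *(2,5) h(2) L.Id_Comp by simp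
    moreover have "b' \<cdot>\<^bsub>L\<^esub> h = b"
      using L.Comp_assoc[OF h(1,4) assms(3)] *(4) h(3) L.Comp_Id assms(3) by simp
    moreover have "isomorphism L B Y h" using h by (auto simp: isomorphism_def)
    ultimately show "(a', b') \<in> seq_class L a b"
      using * assms by (auto simp: seq_class_def Hom_def)
  next
    assume "(a', b') \<in> seq_class L a b"
    then obtain Y h where *: "b' \<in> Hom L Y C" "a' \<in> Hom L A Y" "isomorphism L B Y h"
      "h \<cdot>\<^bsub>L\<^esub> a = a'" "b' \<cdot>\<^bsub>L\<^esub> h = b"
      using assms by (auto simp: seq_class_def Hom_def)
    then obtain g where h: "h \<in> Hom L B Y" "h \<cdot>\<^bsub>L\<^esub> g = Id L Y" "g \<cdot>\<^bsub>L\<^esub> h = Id L B" "g \<in> Hom L Y B"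
      by (auto simp: isomorphism_def)
    have "g \<cdot>\<^bsub>L\<^esub> a' = a"
      using L.Comp_assoc[OF assms(2) h(1,4)] *(4) h(3) L.Id_Comp assms(2) by simp
    moreover have "b \<cdot>\<^bsub>L\<^esub> g = b'"
      using L.Comp_assoc[OF h(4,1) *(1)] *(1,5) h(2) L.Comp_Id by simp
    moreover have "isomorphism L Y B g" using h by (auto simp: isomorphism_def)
    ultimately show "(b', a') \<in> seq_class (op_ext L) b a"
      using * assms by (auto simp: seq_class_def Hom_def)
  qed
  then show ?thesis by auto
qed

lemma realised_op:
  fixes L :: "('o, 'm, 'e, 'y) ext_category_scheme"
  assumes "category L"
  shows "realised (op_ext L) \<delta> C b B a A \<longleftrightarrow> realised L \<delta> A a B b C"
proof (cases "a \<in> Hom L A B \<and> b \<in> Hom L B C")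
  case True
  then have "seq_class (op_ext L) b a = {(b', a'). (a', b') \<in> seq_class L a b}"
    using seq_class_op[OF assms] by blast
  moreover have "Realn (op_ext L) A C \<delta> = {(b', a'). (a', b') \<in> Realn L C A \<delta>}"
    by (simp add: op_ext_def)
  ultimately show ?thesis using True by (auto simp: realised_def set_eq_iff)
qed (auto simp: realised_def)

lemma conflation_op:
  assumes "category L"
  shows "conflation (op_ext L) C b B a A \<longleftrightarrow> conflation L A a B b C"
  by (simp add: conflation_def realised_op[OF assms])

section \<open>Extensions\<close>

context ET1
begin

lemma Ext_group: "C \<in> Obj \<B> \<Longrightarrow> A \<in> Obj \<B> \<Longrightarrow> group (Ext \<B> C A)"
  using Ext_comm_group comm_group.axioms(2) by blast

lemma ExtMap_closed:
  "g \<in> Hom \<B> Y C \<Longrightarrow> f \<in> Hom \<B> A X \<Longrightarrow> \<delta> \<in> carrier (Ext \<B> C A) \<Longrightarrow>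
    ExtMap \<B> g f \<delta> \<in> carrier (Ext \<B> Y X)"
  using ExtMap_hom unfolding hom_def by blast

lemma push_closed [intro]:
  "C \<in> Obj \<B> \<Longrightarrow> f \<in> Hom \<B> A X \<Longrightarrow> \<delta> \<in> carrier (Ext \<B> C A) \<Longrightarrow> push \<B> C f \<delta> \<in> carrier (Ext \<B> C X)"
  unfolding push_def using ExtMap_closed Id_Hom by blast

lemma pull_closed [intro]:
  "A \<in> Obj \<B> \<Longrightarrow> g \<in> Hom \<B> Y C \<Longrightarrow> \<delta> \<in> carrier (Ext \<B> C A) \<Longrightarrow> pull \<B> A g \<delta> \<in> carrier (Ext \<B> Y A)"
  unfolding pull_def using ExtMap_closed Id_Hom by blast

lemma push_Id: "C \<in> Obj \<B> \<Longrightarrow> A \<in> Obj \<B> \<Longrightarrow> \<delta> \<in> carrier (Ext \<B> C A) \<Longrightarrow> push \<B> C (Id \<B> A) \<delta> = \<delta>"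
  unfolding push_def by (rule ExtMap_Id)

lemma pull_Id: "C \<in> Obj \<B> \<Longrightarrow> A \<in> Obj \<B> \<Longrightarrow> \<delta> \<in> carrier (Ext \<B> C A) \<Longrightarrow> pull \<B> A (Id \<B> C) \<delta> = \<delta>"
  unfolding pull_def by (rule ExtMap_Id)

lemma push_Comp:
  assumes "C \<in> Obj \<B>" "f \<in> Hom \<B> A X" "f' \<in> Hom \<B> X X'" "\<delta> \<in> carrier (Ext \<B> C A)"
  shows "push \<B> C (f' \<cdot> f) \<delta> = push \<B> C f' (push \<B> C f \<delta>)"
  unfolding push_def using ExtMap_Comp[OF Id_Hom Id_Hom assms(2-4)] assms(1) by simp

lemma pull_Comp:
  assumes "A \<in> Obj \<B>" "g \<in> Hom \<B> Y C" "g' \<in> Hom \<B> Y' Y" "\<delta> \<in> carrier (Ext \<B> C A)"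
  shows "pull \<B> A (g \<cdot> g') \<delta> = pull \<B> A g' (pull \<B> A g \<delta>)"
  unfolding pull_def using ExtMap_Comp[OF assms(2,3) Id_Hom Id_Hom assms(4)] assms(1) by simp

lemma push_pull:
  assumes "g \<in> Hom \<B> Y C" "f \<in> Hom \<B> A X" "\<delta> \<in> carrier (Ext \<B> C A)"
  shows "push \<B> Y f (pull \<B> A g \<delta>) = pull \<B> X g (push \<B> C f \<delta>)"
proof -
  have O: "Y \<in> Obj \<B>" "C \<in> Obj \<B>" "A \<in> Obj \<B>" "X \<in> Obj \<B>" using assms Hom_Obj by metis+
  have "push \<B> Y f (pull \<B> A g \<delta>) = ExtMap \<B> (g \<cdot> Id \<B> Y) (f \<cdot> Id \<B> A) \<delta>"
    unfolding push_def pull_def using ExtMap_Comp[OF assms(1) Id_Hom Id_Hom assms(2,3)] O by simp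
  also have "\<dots> = ExtMap \<B> (Id \<B> C \<cdot> g) (Id \<B> X \<cdot> f) \<delta>"
    using Comp_Id Id_Comp assms(1,2) by simp
  also have "\<dots> = pull \<B> X g (push \<B> C f \<delta>)"
    unfolding push_def pull_def using ExtMap_Comp[OF Id_Hom assms(1,2) Id_Hom assms(3)] O by simp
  finally show ?thesis .
qed

lemma push_hom: "C \<in> Obj \<B> \<Longrightarrow> f \<in> Hom \<B> A X \<Longrightarrow> group_hom (Ext \<B> C A) (Ext \<B> C X) (push \<B> C f)"
  unfolding push_def group_hom_def group_hom_axioms_def
  using ExtMap_hom[OF Id_Hom, of C f A X] Ext_group Hom_Obj by metis

lemma pull_hom: "A \<in> Obj \<B> \<Longrightarrow> g \<in> Hom \<B> Y C \<Longrightarrow> group_hom (Ext \<B> C A) (Ext \<B> Y A) (pull \<B> A g)"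
  unfolding pull_def group_hom_def group_hom_axioms_def
  using ExtMap_hom[OF _ Id_Hom, of g Y C A] Ext_group Hom_Obj by metis

lemma push_one: "C \<in> Obj \<B> \<Longrightarrow> f \<in> Hom \<B> A X \<Longrightarrow> push \<B> C f \<one>\<^bsub>Ext \<B> C A\<^esub> = \<one>\<^bsub>Ext \<B> C X\<^esub>"
  using group_hom.hom_one push_hom by blast

lemma pull_one: "A \<in> Obj \<B> \<Longrightarrow> g \<in> Hom \<B> Y C \<Longrightarrow> pull \<B> A g \<one>\<^bsub>Ext \<B> C A\<^esub> = \<one>\<^bsub>Ext \<B> Y A\<^esub>"
  using group_hom.hom_one pull_hom by blast

lemma one_Ext: "C \<in> Obj \<B> \<Longrightarrow> A \<in> Obj \<B> \<Longrightarrow> \<one>\<^bsub>Ext \<B> C A\<^esub> \<in> carrier (Ext \<B> C A)"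
  using Ext_group group.is_monoid monoid.one_closed by blast

lemma realisedD:
  assumes "realised \<B> \<delta> A a B b C"
  shows "\<delta> \<in> carrier (Ext \<B> C A)" "a \<in> Hom \<B> A B" "b \<in> Hom \<B> B C"
    "A \<in> Obj \<B>" "B \<in> Obj \<B>" "C \<in> Obj \<B>"
  using assms Hom_Obj by (auto simp: realised_def)

end

text \<open>Each axiom is either self-dual or one of a dual pair, such as \<open>ET4\<close> and
  \<open>ET4_op\<close>. Every later result therefore comes with its dual.\<close>

lemma (in extriangulated_category) op_ext_extriangulated: "extriangulated_category (op_ext \<B>)"
proof -
  note R = realised_op[OF category_axioms]
  have cat: "category (op_ext \<B>)"
    by unfold_locales (auto simp: Id_Hom Comp_Id Id_Comp intro: Comp_Hom Comp_assoc[symmetric])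
  have pre: "preadditive_category (op_ext \<B>)"
    by (intro preadditive_category.intro preadditive_category_axioms.intro cat)
      (auto simp: HomGrp_comm_group intro: Comp_Add Add_Comp)
  have add: "additive_category (op_ext \<B>)"
  proof (intro additive_category.intro additive_category_axioms.intro pre)
    fix X Y assume "X \<in> Obj (op_ext \<B>)" "Y \<in> Obj (op_ext \<B>)"
    then show "\<exists>S i j p q. biproduct (op_ext \<B>) X Y S i j p q"
      using ex_biproduct[of X Y] by simp blast
  qed (simp add: ex_zero_object)
  have et1: "ET1 (op_ext \<B>)"
    by (intro ET1.intro ET1_axioms.intro add)
      (auto intro: Ext_comm_group ExtMap_hom ExtMap_Id ExtMap_Comp push_Add pull_Add)
  have et2: "ET2 (op_ext \<B>)"
  proof (intro ET2.intro ET2_axioms.intro et1)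
    fix C A \<delta> assume "C \<in> Obj (op_ext \<B>)" "A \<in> Obj (op_ext \<B>)" "\<delta> \<in> carrier (Ext (op_ext \<B>) C A)"
    then show "\<exists>a B b. realised (op_ext \<B>) \<delta> A a B b C" using Realn_class[of A C \<delta>] R by auto
  next
    fix \<delta> A a B b C \<delta>' A' a' B' b' C' f h
    assume "realised (op_ext \<B>) \<delta> A a B b C" "realised (op_ext \<B>) \<delta>' A' a' B' b' C'"
      "f \<in> Hom (op_ext \<B>) A A'" "h \<in> Hom (op_ext \<B>) C C'"
      "push (op_ext \<B>) C f \<delta> = pull (op_ext \<B>) A' h \<delta>'"
    then show "\<exists>g\<in>Hom (op_ext \<B>) B B'. g \<cdot>\<^bsub>op_ext \<B>\<^esub> a = a' \<cdot>\<^bsub>op_ext \<B>\<^esub> f \<and>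
        b' \<cdot>\<^bsub>op_ext \<B>\<^esub> g = h \<cdot>\<^bsub>op_ext \<B>\<^esub> b"
      using Realn_morphism[of \<delta>' C' b' B' a' A' \<delta> C b B a A h f] R by auto
  next
    fix A C S i j p q assume "biproduct (op_ext \<B>) A C S i j p q"
    \<comment> \<open>Reversal exchanges inclusions and projections as well as the two ends of the
      split sequence, hence the swap.\<close>
    then have "biproduct \<B> C A S q p j i" using biproduct_swap by simp
    then show "realised (op_ext \<B>) \<one>\<^bsub>Ext (op_ext \<B>) C A\<^esub> A i S q C"
      using Realn_zero[of C A S q p j i] R by simp
  next
    fix \<delta> A a B b C \<delta>' A' a' B' b' C' SA iA iA' pA pA' SB iB iB' pB pB' SC iC iC' pC pC'
    assume r: "realised (op_ext \<B>) \<delta> A a B b C" "realised (op_ext \<B>) \<delta>' A' a' B' b' C'"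
      and bp: "biproduct (op_ext \<B>) A A' SA iA iA' pA pA'" "biproduct (op_ext \<B>) B B' SB iB iB' pB pB'"
        "biproduct (op_ext \<B>) C C' SC iC iC' pC pC'"
    have "realised \<B>
        (push \<B> SA pC (pull \<B> C iA \<delta>) \<otimes>\<^bsub>Ext \<B> SA SC\<^esub> push \<B> SA pC' (pull \<B> C' iA' \<delta>'))
        SC (Add \<B> (pB \<cdot> b \<cdot> iC) (pB' \<cdot> b' \<cdot> iC'))
        SB (Add \<B> (pA \<cdot> a \<cdot> iB) (pA' \<cdot> a' \<cdot> iB')) SA"
      using Realn_sum[of \<delta> C b B a A \<delta>' C' b' B' a' A' SC pC pC' iC iC' SB pB pB' iB iB' SA pA pA' iA iA'] r bp R
      by simp
    \<comment> \<open>The dual expression pulls after pushing; by bifunctoriality the order does not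
      matter.\<close>
    moreover have "push \<B> SA pC (pull \<B> C iA \<delta>) = pull \<B> SC iA (push \<B> A pC \<delta>)"
      "push \<B> SA pC' (pull \<B> C' iA' \<delta>') = pull \<B> SC iA' (push \<B> A' pC' \<delta>')"
      using bp r by (auto intro!: push_pull simp: biproduct_def realised_def)
    moreover have "pB \<cdot> b \<cdot> iC = pB \<cdot> (b \<cdot> iC)" "pB' \<cdot> b' \<cdot> iC' = pB' \<cdot> (b' \<cdot> iC')"
      "pA \<cdot> a \<cdot> iB = pA \<cdot> (a \<cdot> iB)" "pA' \<cdot> a' \<cdot> iB' = pA' \<cdot> (a' \<cdot> iB')"
      using bp r by (auto simp: biproduct_def realised_def Hom_def)
    ultimately show "realised (op_ext \<B>)
        (push (op_ext \<B>) SC iA (pull (op_ext \<B>) A pC \<delta>) \<otimes>\<^bsub>Ext (op_ext \<B>) SC SA\<^esub>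
          push (op_ext \<B>) SC iA' (pull (op_ext \<B>) A' pC' \<delta>'))
        SA (Add (op_ext \<B>) (iB \<cdot>\<^bsub>op_ext \<B>\<^esub> a \<cdot>\<^bsub>op_ext \<B>\<^esub> pA) (iB' \<cdot>\<^bsub>op_ext \<B>\<^esub> a' \<cdot>\<^bsub>op_ext \<B>\<^esub> pA'))
        SB (Add (op_ext \<B>) (iC \<cdot>\<^bsub>op_ext \<B>\<^esub> b \<cdot>\<^bsub>op_ext \<B>\<^esub> pB) (iC' \<cdot>\<^bsub>op_ext \<B>\<^esub> b' \<cdot>\<^bsub>op_ext \<B>\<^esub> pB')) SC"
      by (simp add: R)
  qed
  show ?thesis
  proof (intro extriangulated_category.intro extriangulated_category_axioms.intro et2)
    fix \<delta> A a B b C \<delta>' A' a' B' b' C' f g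
    assume "realised (op_ext \<B>) \<delta> A a B b C" "realised (op_ext \<B>) \<delta>' A' a' B' b' C'"
      "f \<in> Hom (op_ext \<B>) A A'" "g \<in> Hom (op_ext \<B>) B B'"
      "g \<cdot>\<^bsub>op_ext \<B>\<^esub> a = a' \<cdot>\<^bsub>op_ext \<B>\<^esub> f"
    then show "\<exists>h\<in>Hom (op_ext \<B>) C C'. push (op_ext \<B>) C f \<delta> = pull (op_ext \<B>) A' h \<delta>' \<and>
        h \<cdot>\<^bsub>op_ext \<B>\<^esub> b = b' \<cdot>\<^bsub>op_ext \<B>\<^esub> g"
      using ET3_op[of \<delta>' C' b' B' a' A' \<delta> C b B a A g f] unfolding R op_ext_sel by metis
  next
    fix \<delta> A a B b C \<delta>' A' a' B' b' C' g h
    assume "realised (op_ext \<B>) \<delta> A a B b C" "realised (op_ext \<B>) \<delta>' A' a' B' b' C'"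
      "g \<in> Hom (op_ext \<B>) B B'" "h \<in> Hom (op_ext \<B>) C C'"
      "h \<cdot>\<^bsub>op_ext \<B>\<^esub> b = b' \<cdot>\<^bsub>op_ext \<B>\<^esub> g"
    then show "\<exists>f\<in>Hom (op_ext \<B>) A A'. push (op_ext \<B>) C f \<delta> = pull (op_ext \<B>) A' h \<delta>' \<and>
        g \<cdot>\<^bsub>op_ext \<B>\<^esub> a = a' \<cdot>\<^bsub>op_ext \<B>\<^esub> f"
      using ET3[of \<delta>' C' b' B' a' A' \<delta> C b B a A h g] unfolding R op_ext_sel by metis
  next
    fix \<delta> A a B a' D \<delta>' b C b' F
    assume "realised (op_ext \<B>) \<delta> A a B a' D" "realised (op_ext \<B>) \<delta>' B b C b' F"
    then have "realised \<B> \<delta> D a' B a A" "realised \<B> \<delta>' F b' C b B" by (simp_all add: R)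
    from ET4_op[OF this] show "\<exists>E \<delta>'' c c'. realised (op_ext \<B>) \<delta>'' A c C c' E \<and>
        (\<exists>d\<in>Hom (op_ext \<B>) D E. \<exists>e\<in>Hom (op_ext \<B>) E F.
          c = b \<cdot>\<^bsub>op_ext \<B>\<^esub> a \<and> c' \<cdot>\<^bsub>op_ext \<B>\<^esub> b = d \<cdot>\<^bsub>op_ext \<B>\<^esub> a' \<and> e \<cdot>\<^bsub>op_ext \<B>\<^esub> c' = b' \<and>
          realised (op_ext \<B>) (push (op_ext \<B>) F a' \<delta>') D d E e F \<and>
          pull (op_ext \<B>) A d \<delta>'' = \<delta> \<and> push (op_ext \<B>) E a \<delta>'' = pull (op_ext \<B>) B e \<delta>')"
      by (simp add: R)
  next
    fix \<delta> D a' B a A \<delta>' F b' C b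
    assume "realised (op_ext \<B>) \<delta> D a' B a A" "realised (op_ext \<B>) \<delta>' F b' C b B"
    then have "realised \<B> \<delta> A a B a' D" "realised \<B> \<delta>' B b C b' F" by (simp_all add: R)
    from ET4[OF this] show "\<exists>E \<delta>'' c c'. realised (op_ext \<B>) \<delta>'' E c' C c A \<and>
        (\<exists>d\<in>Hom (op_ext \<B>) E D. \<exists>e\<in>Hom (op_ext \<B>) F E.
          c = a \<cdot>\<^bsub>op_ext \<B>\<^esub> b \<and> b \<cdot>\<^bsub>op_ext \<B>\<^esub> c' = a' \<cdot>\<^bsub>op_ext \<B>\<^esub> d \<and> c' \<cdot>\<^bsub>op_ext \<B>\<^esub> e = b' \<and>
          realised (op_ext \<B>) (pull (op_ext \<B>) F a' \<delta>') F e E d D \<and>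
          push (op_ext \<B>) A d \<delta>'' = \<delta> \<and> pull (op_ext \<B>) E a \<delta>'' = push (op_ext \<B>) B e \<delta>')"
      by (simp add: R)
  qed
qed

section \<open>Exact sequences\<close>

context extriangulated_category
begin

lemma realised_zero_left:
  assumes "zero_object \<B> Z" "Y \<in> Obj \<B>"
  shows "realised \<B> \<one>\<^bsub>Ext \<B> Y Z\<^esub> Z (Zero \<B> Z Y) Y (Id \<B> Y) Y"
  by (rule Realn_zero[OF biproduct_swap[OF biproduct_zero_right[OF assms]]])

lemma realised_zero_right:
  assumes "zero_object \<B> Z" "Y \<in> Obj \<B>"
  shows "realised \<B> \<one>\<^bsub>Ext \<B> Z Y\<^esub> Y (Id \<B> Y) Y (Zero \<B> Y Z) Z"
  by (rule Realn_zero[OF biproduct_zero_right[OF assms]])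

text \<open>\<open>ET3\<close>, applied to the map from \<open>A = A -> 0\<close> with components
  \<open>1\<close> and \<open>a\<close>, factors \<open>b \<cdot> a\<close> through a zero
  object.\<close>

lemma realised_Comp_Zero:
  assumes r: "realised \<B> \<delta> A a B b C"
  shows "b \<cdot> a = Zero \<B> A C"
proof -
  obtain Z where Z: "zero_object \<B> Z" using ex_zero_object by blast
  note D = realisedD[OF r]
  obtain h where h: "h \<in> Hom \<B> Z C" "h \<cdot> Zero \<B> A Z = b \<cdot> a"
    using ET3[OF realised_zero_right[OF Z D(4)] r Id_Hom[OF D(4)] D(2)] by blast
  then show ?thesis using Comp_Zero_Hom[OF h(1) D(4)] by simp
qed

text \<open>Since \<open>y \<cdot> a = 0\<close>, the pair \<open>(0, y)\<close> is the start of a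
  map to the trivial conflation \<open>0 -> Y = Y\<close>. \<open>ET3\<close> supplies its third
  component.\<close>

lemma factor_through_deflation:
  assumes r: "realised \<B> \<delta> A a B b C" and y: "y \<in> Hom \<B> B Y" "y \<cdot> a = Zero \<B> A Y"
  shows "\<exists>t \<in> Hom \<B> C Y. t \<cdot> b = y"
proof -
  obtain Z where Z: "zero_object \<B> Z" using ex_zero_object by blast
  note D = realisedD[OF r]
  have O: "Y \<in> Obj \<B>" "Z \<in> Obj \<B>" using y Hom_Obj Z zero_object_def by metis+
  have "y \<cdot> a = Zero \<B> Z Y \<cdot> Zero \<B> A Z" using y O D by simp
  from ET3[OF r realised_zero_left[OF Z O(1)] Zero_Hom[OF D(4) O(2)] y(1) this]
  obtain h where "h \<in> Hom \<B> C Y" "h \<cdot> b = Id \<B> Y \<cdot> y" by blast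
  then show ?thesis using Id_Comp[OF y(1)] by auto
qed

text \<open>The vanishing pushforward makes \<open>(x, 0)\<close> a morphism of extensions to the
  trivial one realised by \<open>Y = Y -> 0\<close>. The middle map of a realisation is the
  extension of \<open>x\<close>.\<close>

lemma extend_along_inflation:
  assumes r: "realised \<B> \<delta> A a B b C" and x: "x \<in> Hom \<B> A Y" "push \<B> C x \<delta> = \<one>\<^bsub>Ext \<B> C Y\<^esub>"
  shows "\<exists>y \<in> Hom \<B> B Y. y \<cdot> a = x"
proof -
  obtain Z where Z: "zero_object \<B> Z" using ex_zero_object by blast
  note D = realisedD[OF r]
  have O: "Y \<in> Obj \<B>" "Z \<in> Obj \<B>" using x Hom_Obj Z zero_object_def by metis+
  have h: "Zero \<B> C Z \<in> Hom \<B> C Z" using Zero_Hom D O by blast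
  have "push \<B> C x \<delta> = pull \<B> Y (Zero \<B> C Z) \<one>\<^bsub>Ext \<B> Z Y\<^esub>"
    using x pull_one[OF O(1) h] by simp
  from Realn_morphism[OF r realised_zero_right[OF Z O(1)] x(1) h this]
  obtain g where "g \<in> Hom \<B> B Y" "g \<cdot> a = Id \<B> Y \<cdot> x" by blast
  then show ?thesis using Id_Comp[OF x(1)] by auto
qed

text \<open>\<open>ET3\<close> for \<open>(a, 1)\<close> into \<open>B = B -> 0\<close> exhibits the
  pushforward as the pullback of a zero extension.\<close>

lemma push_inflation:
  assumes r: "realised \<B> \<delta> A a B b C"
  shows "push \<B> C a \<delta> = \<one>\<^bsub>Ext \<B> C B\<^esub>"
proof -
  obtain Z where Z: "zero_object \<B> Z" using ex_zero_object by blast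
  note D = realisedD[OF r]
  from ET3[OF r realised_zero_right[OF Z D(5)] D(2) Id_Hom[OF D(5)] refl]
  obtain h where "h \<in> Hom \<B> C Z" "push \<B> C a \<delta> = pull \<B> B h \<one>\<^bsub>Ext \<B> Z B\<^esub>" by blast
  then show ?thesis using pull_one[OF D(5)] by metis
qed

lemma push_extendable:
  assumes r: "realised \<B> \<delta> A a B b C" and y: "y \<in> Hom \<B> B Y"
  shows "push \<B> C (y \<cdot> a) \<delta> = \<one>\<^bsub>Ext \<B> C Y\<^esub>"
  using push_Comp[OF realisedD(6,2)[OF r] y realisedD(1)[OF r]] push_inflation[OF r]
    push_one[OF realisedD(6)[OF r] y] by simp

text \<open>Let \<epsilon> be realised by \<open>Y -> Z -> B\<close>. \<open>ET4_op\<close> composes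
  the deflations \<open>Z -> B -> C\<close> into an extension \<theta> with kernel \<open>E\<close>,
  and \<open>Y -> E -> A\<close> realises the pullback of \<epsilon> along \<open>a\<close>. That
  pullback is zero, so \<open>Y -> E\<close> has a retraction \<open>s\<close>, and pushing \<theta>
  along \<open>s\<close> gives \<eta>.\<close>

lemma Ext_exact_middle:
  assumes r: "realised \<B> \<delta> A a B b C" and Y: "Y \<in> Obj \<B>" "\<epsilon> \<in> carrier (Ext \<B> B Y)"
    and 0: "pull \<B> Y a \<epsilon> = \<one>\<^bsub>Ext \<B> A Y\<^esub>"
  shows "\<exists>\<eta> \<in> carrier (Ext \<B> C Y). pull \<B> Y b \<eta> = \<epsilon>"
proof -
  note D = realisedD[OF r]
  obtain z Z w where z: "realised \<B> \<epsilon> Y z Z w B" using Realn_class[OF D(5) Y] by blast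
  from ET4_op[OF r z] obtain E \<theta> c' d e where E: "realised \<B> \<theta> E c' Z (b \<cdot> w) C"
    "d \<in> Hom \<B> E A" "e \<in> Hom \<B> Y E" "realised \<B> (pull \<B> Y a \<epsilon>) Y e E d A"
    "pull \<B> E b \<theta> = push \<B> B e \<epsilon>" by blast
  have "push \<B> A (Id \<B> Y) (pull \<B> Y a \<epsilon>) = \<one>\<^bsub>Ext \<B> A Y\<^esub>"
    unfolding 0 using push_Id[OF D(4) Y(1)] one_Ext[OF D(4) Y(1)] by blast
  then obtain s where s: "s \<in> Hom \<B> E Y" "s \<cdot> e = Id \<B> Y"
    using extend_along_inflation[OF E(4) Id_Hom[OF Y(1)]] by blast
  have "pull \<B> Y b (push \<B> C s \<theta>) = push \<B> B s (pull \<B> E b \<theta>)"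
    using push_pull[OF D(3) s(1) realisedD(1)[OF E(1)]] by simp
  also have "\<dots> = push \<B> B (s \<cdot> e) \<epsilon>"
    unfolding E(5) using push_Comp[OF D(5) E(3) s(1) Y(2)] by simp
  also have "\<dots> = \<epsilon>" unfolding s(2) using push_Id[OF D(5) Y] .
  finally show ?thesis using push_closed[OF D(6) s(1) realisedD(1)[OF E(1)]] by blast
qed

text \<open>This lemma and the next three are earlier ones read in
  \<open>op_ext \<B>\<close>.\<close>

lemma factor_through_inflation:
  assumes "realised \<B> \<delta> A a B b C" "y \<in> Hom \<B> Y B" "b \<cdot> y = Zero \<B> Y C"
  shows "\<exists>t \<in> Hom \<B> Y A. a \<cdot> t = y"
  using extriangulated_category.factor_through_deflation[OF op_ext_extriangulated,
      unfolded op_ext_sel realised_op[OF category_axioms], OF assms] .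

lemma lift_along_deflation:
  assumes "realised \<B> \<delta> A a B b C" "x \<in> Hom \<B> Y C" "pull \<B> A x \<delta> = \<one>\<^bsub>Ext \<B> Y A\<^esub>"
  shows "\<exists>y \<in> Hom \<B> Y B. b \<cdot> y = x"
  using extriangulated_category.extend_along_inflation[OF op_ext_extriangulated,
      unfolded op_ext_sel realised_op[OF category_axioms], OF assms] .

lemma pull_liftable:
  assumes "realised \<B> \<delta> A a B b C" "y \<in> Hom \<B> Y B"
  shows "pull \<B> A (b \<cdot> y) \<delta> = \<one>\<^bsub>Ext \<B> Y A\<^esub>"
  using extriangulated_category.push_extendable[OF op_ext_extriangulated,
      unfolded op_ext_sel realised_op[OF category_axioms], OF assms] .

lemma Ext_exact_middle_op:
  assumes "realised \<B> \<delta> A a B b C" "Y \<in> Obj \<B>" "\<epsilon> \<in> carrier (Ext \<B> Y B)"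
    "push \<B> Y b \<epsilon> = \<one>\<^bsub>Ext \<B> Y C\<^esub>"
  shows "\<exists>\<eta> \<in> carrier (Ext \<B> Y A). push \<B> Y a \<eta> = \<epsilon>"
  using extriangulated_category.Ext_exact_middle[OF op_ext_extriangulated,
      unfolded op_ext_sel realised_op[OF category_axioms], OF assms] .

text \<open>As the pullback of \<eta> along \<open>b\<close> vanishes, \<open>b\<close> lifts
  through the deflation realising \<eta>. \<open>ET3_op\<close> completes this lift and the identity
  of \<open>C\<close> to a morphism of extensions, whose first component is \<tau>.\<close>

lemma Ext_exact_left:
  assumes r: "realised \<B> \<delta> A a B b C" and Y: "Y \<in> Obj \<B>" "\<eta> \<in> carrier (Ext \<B> C Y)"
    and 0: "pull \<B> Y b \<eta> = \<one>\<^bsub>Ext \<B> B Y\<^esub>"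
  shows "\<exists>\<tau> \<in> Hom \<B> A Y. push \<B> C \<tau> \<delta> = \<eta>"
proof -
  note D = realisedD[OF r]
  obtain z Z w where z: "realised \<B> \<eta> Y z Z w C" using Realn_class[OF D(6) Y] by blast
  obtain g where g: "g \<in> Hom \<B> B Z" "w \<cdot> g = b" using lift_along_deflation[OF z D(3) 0] by blast
  have "Id \<B> C \<cdot> b = w \<cdot> g" using Id_Comp[OF D(3)] g(2) by simp
  from ET3_op[OF r z g(1) Id_Hom[OF D(6)] this]
  obtain f where "f \<in> Hom \<B> A Y" "push \<B> C f \<delta> = pull \<B> Y (Id \<B> C) \<eta>" by blast
  then show ?thesis using pull_Id[OF D(6) Y] by auto
qed

text \<open>The obstruction to extending \<open>x\<close> along \<open>m\<close> is the pushforward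
  of \<delta> along \<open>y \<cdot> a\<close>, which is zero. An extension \<open>z\<close> agrees
  with \<open>y\<close> only after composition with \<open>a\<close>, so the discrepancy is
  \<open>t \<cdot> b = t \<cdot> q \<cdot> g\<close>. Subtracting \<open>t \<cdot> q\<close> from
  \<open>z\<close> removes it and leaves \<open>z \<cdot> m\<close> unchanged because
  \<open>q \<cdot> m = 0\<close>.\<close>

lemma weak_pushout:
  assumes r: "realised \<B> \<delta> A a B b C" and r': "realised \<B> (push \<B> C f \<delta>) A' m M q C"
    and f: "f \<in> Hom \<B> A A'" and g: "g \<in> Hom \<B> B M" "g \<cdot> a = m \<cdot> f" "q \<cdot> g = b"
    and x: "x \<in> Hom \<B> A' Y" and y: "y \<in> Hom \<B> B Y" and xy: "x \<cdot> f = y \<cdot> a"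
  shows "\<exists>z \<in> Hom \<B> M Y. z \<cdot> m = x \<and> z \<cdot> g = y"
proof -
  note D = realisedD[OF r] and D' = realisedD[OF r']
  have "push \<B> C x (push \<B> C f \<delta>) = \<one>\<^bsub>Ext \<B> C Y\<^esub>"
    using push_Comp[OF D(6) f x D(1)] push_extendable[OF r y] xy by simp
  then obtain z where z: "z \<in> Hom \<B> M Y" "z \<cdot> m = x"
    using extend_along_inflation[OF r' x] by blast
  define v where "v = Sub \<B> (z \<cdot> g) y"
  have v: "v \<in> Hom \<B> B Y" unfolding v_def using z g y by (simp add: Hom_def)
  have "z \<cdot> g \<cdot> a = y \<cdot> a"
    using Comp_assoc[OF D(2) g(1) z(1)] Comp_assoc[OF f D'(2) z(1)] g(2) z(2) xy by simp
  then have "v \<cdot> a = Zero \<B> A Y"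
    unfolding v_def using z(1) g(1) y D(2) Sub_eq_Zero[of "z \<cdot> g \<cdot> a" A Y "y \<cdot> a"]
    by (simp add: Hom_def del: Comp_assoc_Arr)
  then obtain t where t: "t \<in> Hom \<B> C Y" "t \<cdot> b = v" using factor_through_deflation[OF r v] by blast
  have "Sub \<B> z (t \<cdot> q) \<in> Hom \<B> M Y" using z(1) t(1) D'(3) by (simp add: Hom_def)
  moreover have "Sub \<B> z (t \<cdot> q) \<cdot> m = x"
  proof -
    have "Sub \<B> z (t \<cdot> q) \<cdot> m = Sub \<B> (z \<cdot> m) (t \<cdot> (q \<cdot> m))"
      using z(1) t(1) D'(2,3) by (simp add: Hom_def)
    also have "\<dots> = x" unfolding realised_Comp_Zero[OF r'] z(2)
      using x t(1) D'(4) Hom_Obj[OF x] by (simp add: Hom_def)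
    finally show ?thesis .
  qed
  moreover have "Sub \<B> z (t \<cdot> q) \<cdot> g = y"
  proof -
    have "Sub \<B> z (t \<cdot> q) \<cdot> g = Sub \<B> (z \<cdot> g) (t \<cdot> (q \<cdot> g))"
      using z(1) t(1) D'(2,3) g(1) by (simp add: Hom_def)
    also have "\<dots> = y" unfolding g(3) t(2) v_def using z(1) g(1) y by (simp add: Hom_def)
    finally show ?thesis .
  qed
  ultimately show ?thesis by blast
qed

lemma weak_pullback:
  assumes "realised \<B> \<delta> A a B b C" "realised \<B> (pull \<B> A h \<delta>) A m M q C'"
    "h \<in> Hom \<B> C' C" "g \<in> Hom \<B> M B" "b \<cdot> g = h \<cdot> q" "g \<cdot> m = a"
    "x \<in> Hom \<B> Y C'" "y \<in> Hom \<B> Y B" "h \<cdot> x = b \<cdot> y"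
  shows "\<exists>z \<in> Hom \<B> Y M. q \<cdot> z = x \<and> g \<cdot> z = y"
  using extriangulated_category.weak_pushout[OF op_ext_extriangulated,
      unfolded op_ext_sel realised_op[OF category_axioms], OF assms] .

end

section \<open>Weak pullback squares along inflations, and the splitting of zero extensions\<close>

lemma (in preadditive_category) biproduct_Comp:
  assumes "biproduct K A B S i j p q"
  shows "x \<in> Arr K \<Longrightarrow> Cod K x = A \<Longrightarrow> p \<cdot> (i \<cdot> x) = x"
    "x \<in> Arr K \<Longrightarrow> Cod K x = A \<Longrightarrow> q \<cdot> (i \<cdot> x) = Zero K (Dom K x) B"
    "x \<in> Arr K \<Longrightarrow> Cod K x = B \<Longrightarrow> q \<cdot> (j \<cdot> x) = x"
    "x \<in> Arr K \<Longrightarrow> Cod K x = B \<Longrightarrow> p \<cdot> (j \<cdot> x) = Zero K (Dom K x) A"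
    "p \<cdot> i = Id K A" "q \<cdot> i = Zero K A B" "q \<cdot> j = Id K B" "p \<cdot> j = Zero K B A"
    "i \<in> Arr K" "j \<in> Arr K" "p \<in> Arr K" "q \<in> Arr K"
    "Dom K i = A" "Cod K i = S" "Dom K j = B" "Cod K j = S"
    "Dom K p = S" "Cod K p = A" "Dom K q = S" "Cod K q = B"
    "A \<in> Obj K" "B \<in> Obj K" "S \<in> Obj K"
proof -
  have H: "i \<in> Hom K A S" "j \<in> Hom K B S" "p \<in> Hom K S A" "q \<in> Hom K S B"
    and e: "p \<cdot> i = Id K A" "q \<cdot> i = Zero K A B" "q \<cdot> j = Id K B" "p \<cdot> j = Zero K B A"
    using assms by (auto simp: biproduct_def)
  have O: "A \<in> Obj K" "B \<in> Obj K" "S \<in> Obj K" using H Hom_Obj by metis+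
  show "p \<cdot> i = Id K A" "q \<cdot> i = Zero K A B" "q \<cdot> j = Id K B" "p \<cdot> j = Zero K B A"
    "i \<in> Arr K" "j \<in> Arr K" "p \<in> Arr K" "q \<in> Arr K"
    "Dom K i = A" "Cod K i = S" "Dom K j = B" "Cod K j = S"
    "Dom K p = S" "Cod K p = A" "Dom K q = S" "Cod K q = B"
    "A \<in> Obj K" "B \<in> Obj K" "S \<in> Obj K"
    using e O H by (auto simp: Hom_def)
  show "p \<cdot> (i \<cdot> x) = x" "q \<cdot> (i \<cdot> x) = Zero K (Dom K x) B" if x: "x \<in> Arr K" "Cod K x = A"
    using Comp_eq_extend[OF e(1), of x "Dom K x" A S A] Comp_eq_extend[OF e(2), of x "Dom K x" A S B] H x O
    by (simp_all add: Hom_def)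
  show "q \<cdot> (j \<cdot> x) = x" "p \<cdot> (j \<cdot> x) = Zero K (Dom K x) A" if x: "x \<in> Arr K" "Cod K x = B"
    using Comp_eq_extend[OF e(3), of x "Dom K x" B S B] Comp_eq_extend[OF e(4), of x "Dom K x" B S A] H x O
    by (simp_all add: Hom_def)
qed

context extriangulated_category
begin

text \<open>
  The square of \<open>a\<close> and \<open>f\<close> comes from (ET4) for the composite of the split inflation
  \<open>(1, -f): A \<rightarrow> A \<oplus> A'\<close> with \<open>a \<oplus> 1: A \<oplus> A' \<rightarrow> B \<oplus> A'\<close>. That it is also a weak pullback does
  not follow from the realisations of its two rows alone.
\<close>

lemma pushout_square:
  assumes r: "realised \<B> \<delta> A a B b C" and f: "f \<in> Hom \<B> A A'"
  shows "\<exists>M m n q. realised \<B> (push \<B> C f \<delta>) A' m M q C \<and> n \<in> Hom \<B> B M \<and> q \<cdot> n = b \<and> n \<cdot> a = m \<cdot> f \<and>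
    (\<forall>Y. \<forall>x \<in> Hom \<B> Y A'. \<forall>y \<in> Hom \<B> Y B. m \<cdot> x = n \<cdot> y \<longrightarrow> (\<exists>k \<in> Hom \<B> Y A. f \<cdot> k = x \<and> a \<cdot> k = y))"
proof -
  note D = realisedD[OF r]
  have A': "A' \<in> Obj \<B>" using f Hom_Obj by blast
  obtain Z where Z: "zero_object \<B> Z" using ex_zero_object by blast
  have ZO: "Z \<in> Obj \<B>" using Z zero_object_def by metis
  obtain S i j p q where bp: "biproduct \<B> A A' S i j p q" using ex_biproduct D A' by blast
  obtain S2 i2 j2 p2 q2 where bp2: "biproduct \<B> B A' S2 i2 j2 p2 q2" using ex_biproduct D A' by blast
  note b1 = biproduct_Comp[OF bp] and b2 = biproduct_Comp[OF bp2]
  note H = D(2)[unfolded Hom_def, simplified] D(3)[unfolded Hom_def, simplified] f[unfolded Hom_def, simplified]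
  \<comment> \<open>\<open>i' = (1, -f)\<close> and \<open>q' = (f, 1)\<close> are a change of
    coordinates on \<open>S\<close>: together with \<open>j\<close> and \<open>p\<close> they form
    another biproduct structure.\<close>
  define i' where "i' = Sub \<B> i (j \<cdot> f)"
  define q' where "q' = Add \<B> q (f \<cdot> p)"
  have Hi: "i' \<in> Arr \<B>" "Dom \<B> i' = A" "Cod \<B> i' = S" unfolding i'_def using H b1 by simp_all
  have Hq: "q' \<in> Arr \<B>" "Dom \<B> q' = S" "Cod \<B> q' = A'" unfolding q'_def using H b1 by simp_all
  have qi: "q' \<cdot> i = f" unfolding q'_def using H b1 by simp
  have bp': "biproduct \<B> A A' S i' j p q'"
    unfolding biproduct_def
  proof (intro conjI)
    show "p \<cdot> i' = Id \<B> A" unfolding i'_def using H b1 by simp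
    show "q' \<cdot> j = Id \<B> A'" unfolding q'_def using H b1 by simp
    show "q' \<cdot> i' = Zero \<B> A A'" unfolding q'_def i'_def using H b1 by simp
    have "Add \<B> (i' \<cdot> p) (j \<cdot> q') = Add \<B> (i \<cdot> p) (Add \<B> (Neg \<B> (j \<cdot> (f \<cdot> p))) (Add \<B> (j \<cdot> q) (j \<cdot> (f \<cdot> p))))"
      unfolding q'_def i'_def using H b1 by simp
    also have "\<dots> = Add \<B> (i \<cdot> p) (Add \<B> (Neg \<B> (j \<cdot> (f \<cdot> p))) (Add \<B> (j \<cdot> (f \<cdot> p)) (j \<cdot> q)))"
      using H b1 Add_commute[of "j \<cdot> q" "j \<cdot> (f \<cdot> p)"] by simp
    also have "\<dots> = Id \<B> S" using H b1 bp by (simp add: biproduct_def)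
    finally show "Add \<B> (i' \<cdot> p) (j \<cdot> q') = Id \<B> S" .
  qed (use Hi Hq b1 in \<open>simp_all add: Hom_def\<close>)
  define aa where "aa = Add \<B> (i2 \<cdot> (a \<cdot> p)) (j2 \<cdot> q)"
  have Ha: "aa \<in> Arr \<B>" "Dom \<B> aa = S" "Cod \<B> aa = S2" unfolding aa_def using H b1 b2 by simp_all
  have r1: "realised \<B> \<one>\<^bsub>Ext \<B> A' A\<^esub> A i' S q' A'" by (rule Realn_zero[OF bp'])
  \<comment> \<open>\<open>C\<close> itself serves as the sum of \<open>C\<close> and a zero object,
    so the class of the direct sum of \<delta> with \<open>A' = A' -> 0\<close> reduces to \<delta>
    pushed along \<open>i\<close>.\<close>
  have "pull \<B> A (Id \<B> C) \<delta> = \<delta>" using pull_Id D by blast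
  moreover have "push \<B> C j (pull \<B> A' (Zero \<B> C Z) \<one>\<^bsub>Ext \<B> Z A'\<^esub>) = \<one>\<^bsub>Ext \<B> C S\<^esub>"
    using pull_one[OF A' Zero_Hom[OF D(6) ZO]] push_one[OF D(6), of j A' S] b1 by (simp add: Hom_def)
  moreover have "push \<B> C i \<delta> \<in> carrier (Ext \<B> C S)" using push_closed[OF D(6) _ D(1), of i S] b1 by (simp add: Hom_def)
  moreover have "group (Ext \<B> C S)" using Ext_group D(6) b1 by blast
  ultimately have "push \<B> C i (pull \<B> A (Id \<B> C) \<delta>) \<otimes>\<^bsub>Ext \<B> C S\<^esub>
      push \<B> C j (pull \<B> A' (Zero \<B> C Z) \<one>\<^bsub>Ext \<B> Z A'\<^esub>) = push \<B> C i \<delta>"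
    by (simp add: group.is_monoid)
  moreover have "Add \<B> (i2 \<cdot> a \<cdot> p) (j2 \<cdot> Id \<B> A' \<cdot> q) = aa" unfolding aa_def using H b1 b2 by simp
  moreover have "Add \<B> (Id \<B> C \<cdot> b \<cdot> p2) (Zero \<B> Z C \<cdot> Zero \<B> A' Z \<cdot> q2) = b \<cdot> p2"
    using H b1 b2 ZO D A' by simp
  ultimately have r2: "realised \<B> (push \<B> C i \<delta>) S aa S2 (b \<cdot> p2) C"
    using Realn_sum[OF r realised_zero_right[OF Z A'] bp bp2 biproduct_zero_right[OF Z D(6)]] by simp
  \<comment> \<open>The composite inflation is \<open>(a, -f)\<close>, with deflation
    \<open>c'\<close> onto \<open>M\<close>. The row \<open>A' -> M -> C\<close> realises \<delta>
    pushed along \<open>q' \<cdot> i = f\<close>.\<close>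
  from ET4[OF r1 r2] obtain M \<theta> c' d e where M: "realised \<B> \<theta> A (aa \<cdot> i') S2 c' M"
    "d \<in> Hom \<B> A' M" "e \<in> Hom \<B> M C" "c' \<cdot> aa = d \<cdot> q'" "e \<cdot> c' = b \<cdot> p2"
    "realised \<B> (push \<B> C q' (push \<B> C i \<delta>)) A' d M e C" by blast
  have "push \<B> C q' (push \<B> C i \<delta>) = push \<B> C f \<delta>"
    using push_Comp[of C i A S q' A' \<delta>] qi D b1 Hq by (simp add: Hom_def)
  then have r3: "realised \<B> (push \<B> C f \<delta>) A' d M e C" using M(6) by simp
  note HM = realisedD(3)[OF M(1), unfolded Hom_def, simplified] M(2)[unfolded Hom_def, simplified]
    M(3)[unfolded Hom_def, simplified]
  have aai: "aa \<cdot> i' = Sub \<B> (i2 \<cdot> a) (j2 \<cdot> f)" unfolding aa_def i'_def using H b1 b2 by simp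
  have aaj: "aa \<cdot> j = j2" unfolding aa_def using H b1 b2 by simp
  have cj: "c' \<cdot> j2 = d"
  proof -
    have "c' \<cdot> j2 = c' \<cdot> aa \<cdot> j" using aaj HM Ha b1 by simp
    also have "\<dots> = d \<cdot> (q' \<cdot> j)" unfolding M(4) using HM Hq b1 by simp
    also have "\<dots> = d" using bp' HM by (simp add: biproduct_def)
    finally show ?thesis .
  qed
  define n where "n = c' \<cdot> i2"
  have n: "n \<in> Hom \<B> B M" unfolding n_def using HM b2 by (simp add: Hom_def)
  have cc: "Sub \<B> (n \<cdot> a) (d \<cdot> f) = c' \<cdot> (aa \<cdot> i')"
    unfolding aai n_def cj[symmetric] using H HM b2 by simp
  have na: "n \<cdot> a = d \<cdot> f"
    using cc[unfolded realised_Comp_Zero[OF M(1)]] Sub_eq_Zero[of "n \<cdot> a" A M "d \<cdot> f"] n H HM by (simp add: Hom_def)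
  have en: "e \<cdot> n = b"
  proof -
    have "e \<cdot> n = e \<cdot> c' \<cdot> i2" unfolding n_def using HM b2 by simp
    also have "\<dots> = b" unfolding M(5) using H b2 by simp
    finally show ?thesis .
  qed
  \<comment> \<open>Here \<open>c'\<close> kills \<open>(y, -x)\<close>, which therefore factors
    through the inflation \<open>(a, -f)\<close>. A single \<open>k\<close> thus satisfies both
    equations.\<close>
  have "\<exists>k \<in> Hom \<B> Y A. f \<cdot> k = x \<and> a \<cdot> k = y"
    if x: "x \<in> Hom \<B> Y A'" and y: "y \<in> Hom \<B> Y B" and xy: "d \<cdot> x = n \<cdot> y" for Y x y
  proof -
    note Hx = x[unfolded Hom_def, simplified] y[unfolded Hom_def, simplified]
    have Y: "Y \<in> Obj \<B>" using x Hom_Obj by blast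
    define v where "v = Sub \<B> (i2 \<cdot> y) (j2 \<cdot> x)"
    have v: "v \<in> Hom \<B> Y S2" unfolding v_def using Hx b2 by (simp add: Hom_def)
    have "c' \<cdot> v = Sub \<B> (n \<cdot> y) (d \<cdot> x)" unfolding v_def n_def cj[symmetric] using Hx HM b2 by simp
    also have "\<dots> = Zero \<B> Y M" unfolding xy using n Hx by (simp add: Hom_def)
    finally obtain k where k: "k \<in> Hom \<B> Y A" "aa \<cdot> i' \<cdot> k = v"
      using factor_through_inflation[OF M(1) v] by blast
    note Hk = k(1)[unfolded Hom_def, simplified]
    have 1: "p2 \<cdot> (aa \<cdot> i' \<cdot> k) = p2 \<cdot> v" and 2: "q2 \<cdot> (aa \<cdot> i' \<cdot> k) = q2 \<cdot> v" using k(2) by simp_all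
    have "a \<cdot> k = y" using 1 unfolding aai v_def using H Hx Hk b2 Y D by simp
    moreover have "f \<cdot> k = x"
    proof -
      have "Neg \<B> (f \<cdot> k) = Neg \<B> x" using 2 unfolding aai v_def using H Hx Hk b2 Y D by simp
      moreover have "f \<cdot> k \<in> Arr \<B>" "x \<in> Arr \<B>" using H Hx Hk by simp_all
      ultimately show ?thesis using Neg_Neg by metis
    qed
    ultimately show ?thesis using k(1) by blast
  qed
  then show ?thesis using r3 n en na by blast
qed

text \<open>Vanishing gives a retraction \<open>t\<close> of \<open>a\<close> and a section
  \<open>s0\<close> of \<open>b\<close>; subtracting \<open>a \<cdot> t \<cdot> s0\<close> from
  \<open>s0\<close> makes the section orthogonal to \<open>t\<close>. Now
  \<open>1 - a \<cdot> t\<close> kills \<open>a\<close>, so it is \<open>w \<cdot> b\<close> for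
  some \<open>w\<close>, and composing with \<open>s\<close> identifies \<open>w\<close> as
  \<open>s\<close>.\<close>

lemma split_biproduct:
  assumes r: "realised \<B> \<one>\<^bsub>Ext \<B> C A\<^esub> A a B b C"
  shows "\<exists>s t. biproduct \<B> A C B a s t b"
proof -
  note D = realisedD[OF r]
  have "push \<B> C (Id \<B> A) \<one>\<^bsub>Ext \<B> C A\<^esub> = \<one>\<^bsub>Ext \<B> C A\<^esub>" using push_one Id_Hom D by blast
  then obtain t where t: "t \<in> Hom \<B> B A" "t \<cdot> a = Id \<B> A"
    using extend_along_inflation[OF r Id_Hom[OF D(4)]] by blast
  have "pull \<B> A (Id \<B> C) \<one>\<^bsub>Ext \<B> C A\<^esub> = \<one>\<^bsub>Ext \<B> C A\<^esub>" using pull_one Id_Hom D by blast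
  then obtain s0 where s0: "s0 \<in> Hom \<B> C B" "b \<cdot> s0 = Id \<B> C"
    using lift_along_deflation[OF r Id_Hom[OF D(6)]] by blast
  note H = D(2)[unfolded Hom_def, simplified] D(3)[unfolded Hom_def, simplified]
    t(1)[unfolded Hom_def, simplified] s0(1)[unfolded Hom_def, simplified]
  note ba = realised_Comp_Zero[OF r]
  define s where "s = Sub \<B> s0 (a \<cdot> (t \<cdot> s0))"
  have s: "s \<in> Hom \<B> C B" unfolding s_def using H by (simp add: Hom_def)
  have "b \<cdot> s = Sub \<B> (b \<cdot> s0) (b \<cdot> (a \<cdot> (t \<cdot> s0)))" unfolding s_def using H by simp
  also have "b \<cdot> (a \<cdot> (t \<cdot> s0)) = Zero \<B> C C"
    using Comp_eq_extend[OF ba Comp_Hom[OF s0(1) t(1)] D(2,3)] H D by simp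
  finally have bs: "b \<cdot> s = Id \<B> C" using s0 D by simp
  have "t \<cdot> s = Sub \<B> (t \<cdot> s0) (t \<cdot> (a \<cdot> (t \<cdot> s0)))" unfolding s_def using H by simp
  also have "t \<cdot> (a \<cdot> (t \<cdot> s0)) = t \<cdot> s0"
    using Comp_eq_extend[OF t(2) Comp_Hom[OF s0(1) t(1)] D(2) t(1)] H by simp
  finally have ts: "t \<cdot> s = Zero \<B> C A" using H by simp
  define v where "v = Sub \<B> (Id \<B> B) (a \<cdot> t)"
  have v: "v \<in> Hom \<B> B B" unfolding v_def using H D by (simp add: Hom_def)
  have "v \<cdot> a = Sub \<B> a (a \<cdot> (t \<cdot> a))" unfolding v_def using H D by simp
  also have "\<dots> = Zero \<B> A B" unfolding t(2) using H by simp
  finally obtain w where w: "w \<in> Hom \<B> C B" "w \<cdot> b = v" using factor_through_deflation[OF r v] by blast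
  have "w = w \<cdot> b \<cdot> s" using Comp_assoc[OF s D(3) w(1)] bs Comp_Id[OF w(1)] by simp
  also have "\<dots> = Sub \<B> s (a \<cdot> (t \<cdot> s))" unfolding w(2) v_def using H D s by (simp add: Hom_def)
  also have "\<dots> = s" unfolding ts using H D s by (simp add: Hom_def)
  finally have sb: "s \<cdot> b = v" using w(2) by simp
  have "Add \<B> (a \<cdot> t) v = Add \<B> (Id \<B> B) (Sub \<B> (a \<cdot> t) (a \<cdot> t))"
    unfolding v_def by (rule Add_left_commute) (use H D in simp_all)
  also have "\<dots> = Id \<B> B" using H D by simp
  finally have "Add \<B> (a \<cdot> t) (s \<cdot> b) = Id \<B> B" unfolding sb .
  then show ?thesis using D t s bs ts ba unfolding biproduct_def by blast
qed

end

section \<open>Ideals of morphisms factoring through a subcategory\<close>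

lemma factor_ideal_iff:
  "h \<in> factor_ideal K \<W> X Y \<longleftrightarrow> (\<exists>W \<in> \<W>. \<exists>f \<in> Hom K X W. \<exists>g \<in> Hom K W Y. h = g \<cdot>\<^bsub>K\<^esub> f)"
  by (auto simp: factor_ideal_def)

lemma factor_idealI:
  "W \<in> \<W> \<Longrightarrow> f \<in> Hom K X W \<Longrightarrow> g \<in> Hom K W Y \<Longrightarrow> g \<cdot>\<^bsub>K\<^esub> f \<in> factor_ideal K \<W> X Y"
  by (auto simp: factor_ideal_def)

lemma factor_ideal_op [simp]: "factor_ideal (op_ext B) \<W> X Y = factor_ideal B \<W> Y X"
proof -
  have "h \<in> factor_ideal (op_ext B) \<W> X Y \<longleftrightarrow> h \<in> factor_ideal B \<W> Y X" for h
    unfolding factor_ideal_iff op_ext_sel by metis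
  then show ?thesis by blast
qed

context category
begin

lemma factor_ideal_Hom: "h \<in> factor_ideal K \<W> X Y \<Longrightarrow> h \<in> Hom K X Y"
  by (auto simp: factor_ideal_iff intro: Comp_Hom)

lemma factor_ideal_Comp_left:
  assumes "h \<in> factor_ideal K \<W> X Y" "g \<in> Hom K Y Z"
  shows "g \<cdot> h \<in> factor_ideal K \<W> X Z"
proof -
  obtain W f k where h: "W \<in> \<W>" "f \<in> Hom K X W" "k \<in> Hom K W Y" "h = k \<cdot> f"
    using assms(1) by (auto simp: factor_ideal_iff)
  show ?thesis unfolding h(4) Comp_assoc[OF h(2,3) assms(2)]
    using factor_idealI[OF h(1,2) Comp_Hom[OF h(3) assms(2)]] .
qed

lemma factor_ideal_Comp_right:
  assumes "h \<in> factor_ideal K \<W> X Y" "g \<in> Hom K Z X"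
  shows "h \<cdot> g \<in> factor_ideal K \<W> Z Y"
proof -
  obtain W f k where h: "W \<in> \<W>" "f \<in> Hom K X W" "k \<in> Hom K W Y" "h = k \<cdot> f"
    using assms(1) by (auto simp: factor_ideal_iff)
  show ?thesis unfolding h(4) Comp_assoc[OF assms(2) h(2,3), symmetric]
    using factor_idealI[OF h(1) Comp_Hom[OF assms(2) h(2)] h(3)] .
qed

end

context additive_category
begin

lemma factor_ideal_Zero:
  assumes "additive_subcategory K \<W>" "X \<in> Obj K" "Y \<in> Obj K"
  shows "Zero K X Y \<in> factor_ideal K \<W> X Y"
proof -
  obtain Z where Z: "Z \<in> \<W>" "zero_object K Z" using assms(1) by (auto simp: additive_subcategory_def)
  then have "Z \<in> Obj K" by (simp add: zero_object_def)
  then show ?thesis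
    using factor_idealI[OF Z(1) Zero_Hom[of X Z] Zero_Hom[of Z Y]] Comp_Zero_Hom[OF Zero_Hom, of Z Y X] assms by simp
qed

lemma factor_ideal_Neg:
  assumes "h \<in> factor_ideal K \<W> X Y"
  shows "Neg K h \<in> factor_ideal K \<W> X Y"
proof -
  obtain W f k where h: "W \<in> \<W>" "f \<in> Hom K X W" "k \<in> Hom K W Y" "h = k \<cdot> f"
    using assms by (auto simp: factor_ideal_iff)
  have "Neg K h = Neg K k \<cdot> f" unfolding h(4) using h(2,3) by (simp add: Hom_def)
  then show ?thesis using factor_idealI[OF h(1,2) Neg_Hom[OF h(3)]] by simp
qed

text \<open>The sum factors through the biproduct of the two intermediate objects.\<close>

lemma factor_ideal_Add:
  assumes W: "additive_subcategory K \<W>" and "h \<in> factor_ideal K \<W> X Y" "h' \<in> factor_ideal K \<W> X Y"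
  shows "Add K h h' \<in> factor_ideal K \<W> X Y"
proof -
  obtain W f k where h: "W \<in> \<W>" "f \<in> Hom K X W" "k \<in> Hom K W Y" "h = k \<cdot> f"
    using assms(2) by (auto simp: factor_ideal_iff)
  obtain W' f' k' where h': "W' \<in> \<W>" "f' \<in> Hom K X W'" "k' \<in> Hom K W' Y" "h' = k' \<cdot> f'"
    using assms(3) by (auto simp: factor_ideal_iff)
  have O: "W \<in> Obj K" "W' \<in> Obj K" "X \<in> Obj K" "Y \<in> Obj K" using h h' Hom_Obj by metis+
  obtain S i j p q where bp: "biproduct K W W' S i j p q" using ex_biproduct O by blast
  then have S: "S \<in> \<W>" using W h(1) h'(1) unfolding additive_subcategory_def by blast
  note b = biproduct_Comp[OF bp]
  note H = h(2,3)[unfolded Hom_def, simplified] h'(2,3)[unfolded Hom_def, simplified]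
  have "Add K h h' = Add K (k \<cdot> p) (k' \<cdot> q) \<cdot> Add K (i \<cdot> f) (j \<cdot> f')"
    unfolding h(4) h'(4) using H b O by simp
  moreover have "Add K (i \<cdot> f) (j \<cdot> f') \<in> Hom K X S" "Add K (k \<cdot> p) (k' \<cdot> q) \<in> Hom K S Y"
    using H b by (simp_all add: Hom_def)
  ultimately show ?thesis using factor_idealI[OF S] by simp
qed

lemma factor_ideal_cong:
  assumes "additive_subcategory K \<W>" "f \<in> Hom K X Y" "g \<in> Hom K X Y"
    "Sub K f g \<in> factor_ideal K \<W> X Y" "g \<in> factor_ideal K \<W> X Y"
  shows "f \<in> factor_ideal K \<W> X Y"
proof -
  have "Add K (Sub K f g) g = f" using assms(2,3) by (simp add: Hom_def)
  then show ?thesis using factor_ideal_Add[OF assms(1,4,5)] by simp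
qed

end

section \<open>Cotorsion pairs\<close>

lemma Ext_vanishD: "Ext_vanish \<B> \<X> \<Y> \<Longrightarrow> X \<in> \<X> \<Longrightarrow> Y \<in> \<Y> \<Longrightarrow> \<epsilon> \<in> carrier (Ext \<B> X Y) \<Longrightarrow> \<epsilon> = \<one>\<^bsub>Ext \<B> X Y\<^esub>"
  by (auto simp: Ext_vanish_def)

lemma cotorsion_pairD:
  assumes "cotorsion_pair \<B> \<U> \<V>"
  shows "additive_subcategory \<B> \<U>" "summand_closed \<B> \<U>" "Ext_vanish \<B> \<U> \<V>"
    "\<U> \<subseteq> Obj \<B>" "\<V> \<subseteq> Obj \<B>" "additive_subcategory \<B> \<V>"
    "X \<in> Obj \<B> \<Longrightarrow> \<exists>Y \<in> \<V>. \<exists>Z \<in> \<U>. \<exists>a b \<delta>. realised \<B> \<delta> Y a Z b X"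
    "X \<in> Obj \<B> \<Longrightarrow> \<exists>Y \<in> \<V>. \<exists>Z \<in> \<U>. \<exists>a b \<delta>. realised \<B> \<delta> X a Y b Z"
proof -
  have "Obj \<B> = Cone \<B> \<V> \<U>" "Obj \<B> = CoCone \<B> \<V> \<U>" using assms by (auto simp: cotorsion_pair_def)
  then show "X \<in> Obj \<B> \<Longrightarrow> \<exists>Y \<in> \<V>. \<exists>Z \<in> \<U>. \<exists>a b \<delta>. realised \<B> \<delta> Y a Z b X"
    "X \<in> Obj \<B> \<Longrightarrow> \<exists>Y \<in> \<V>. \<exists>Z \<in> \<U>. \<exists>a b \<delta>. realised \<B> \<delta> X a Y b Z"
    unfolding Cone_def CoCone_def conflation_def by fast+
  show "additive_subcategory \<B> \<U>" "summand_closed \<B> \<U>" "Ext_vanish \<B> \<U> \<V>" "additive_subcategory \<B> \<V>"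
    using assms unfolding cotorsion_pair_def by blast+
  then show "\<U> \<subseteq> Obj \<B>" "\<V> \<subseteq> Obj \<B>" unfolding additive_subcategory_def by blast+
qed

context extriangulated_category
begin

text \<open>In a conflation \<open>Y -> Z -> X\<close> with \<open>Y\<close> in \<V> and
  \<open>Z\<close> in \<U>, the extension vanishes by hypothesis, so \<open>X\<close> is a direct
  summand of \<open>Z\<close>.\<close>

lemma cotorsion_left_mem:
  assumes UV: "cotorsion_pair \<B> \<U> \<V>" and X: "X \<in> Obj \<B>"
    and 0: "\<And>Y \<epsilon>. Y \<in> \<V> \<Longrightarrow> \<epsilon> \<in> carrier (Ext \<B> X Y) \<Longrightarrow> \<epsilon> = \<one>\<^bsub>Ext \<B> X Y\<^esub>"
  shows "X \<in> \<U>"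
proof -
  obtain Y Z a b \<delta> where Y: "Y \<in> \<V>" "Z \<in> \<U>" and r: "realised \<B> \<delta> Y a Z b X"
    using cotorsion_pairD(7)[OF UV X] by blast
  have "realised \<B> \<one>\<^bsub>Ext \<B> X Y\<^esub> Y a Z b X" using 0[OF Y(1) realisedD(1)[OF r]] r by simp
  then obtain s t where "biproduct \<B> Y X Z a s t b" using split_biproduct by blast
  then have "biproduct \<B> X Y Z s a b t" by (rule biproduct_swap)
  then show ?thesis using cotorsion_pairD(2)[OF UV] Y(2) unfolding summand_closed_def by blast
qed

text \<open>An extension over \<open>B\<close> restricts to zero on \<open>A\<close>, so it is
  pulled back from \<open>C\<close>, where it vanishes too.\<close>

lemma Ext_vanish_extension:
  assumes r: "realised \<B> \<delta> A a B b C" and Y: "Y \<in> Obj \<B>"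
    and A: "\<And>\<epsilon>. \<epsilon> \<in> carrier (Ext \<B> A Y) \<Longrightarrow> \<epsilon> = \<one>\<^bsub>Ext \<B> A Y\<^esub>"
    and C: "\<And>\<epsilon>. \<epsilon> \<in> carrier (Ext \<B> C Y) \<Longrightarrow> \<epsilon> = \<one>\<^bsub>Ext \<B> C Y\<^esub>"
    and e: "\<epsilon> \<in> carrier (Ext \<B> B Y)"
  shows "\<epsilon> = \<one>\<^bsub>Ext \<B> B Y\<^esub>"
proof -
  note D = realisedD[OF r]
  obtain \<eta> where "\<eta> \<in> carrier (Ext \<B> C Y)" "pull \<B> Y b \<eta> = \<epsilon>"
    using Ext_exact_middle[OF r Y e] A[OF pull_closed[OF Y D(2) e]] by blast
  then show ?thesis using C pull_one[OF Y D(3)] by metis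
qed

lemma cotorsion_left_extension_closed:
  assumes UV: "cotorsion_pair \<B> \<U> \<V>" and r: "realised \<B> \<delta> A a B b C" and "A \<in> \<U>" "C \<in> \<U>"
  shows "B \<in> \<U>"
proof (rule cotorsion_left_mem[OF UV realisedD(5)[OF r]])
  fix Y \<epsilon> assume "Y \<in> \<V>" "\<epsilon> \<in> carrier (Ext \<B> B Y)"
  then show "\<epsilon> = \<one>\<^bsub>Ext \<B> B Y\<^esub>"
    using Ext_vanish_extension[OF r] Ext_vanishD[OF cotorsion_pairD(3)[OF UV]] assms(3,4)
      cotorsion_pairD(5)[OF UV] by blast
qed

end

lemma op_ext_subcategory:
  assumes "category \<B>"
  shows "Cone (op_ext \<B>) \<Y> \<X> = CoCone \<B> \<X> \<Y>" "CoCone (op_ext \<B>) \<Y> \<X> = Cone \<B> \<X> \<Y>"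
    "Star (op_ext \<B>) \<X> \<Y> = Star \<B> \<Y> \<X>"
    "Proj (op_ext \<B>) = Inj \<B>" "enough_projectives (op_ext \<B>) \<longleftrightarrow> enough_injectives \<B>"
proof -
  show C: "Cone (op_ext \<B>) \<Y> \<X> = CoCone \<B> \<X> \<Y>" "CoCone (op_ext \<B>) \<Y> \<X> = Cone \<B> \<X> \<Y>"
    "Star (op_ext \<B>) \<X> \<Y> = Star \<B> \<Y> \<X>"
    unfolding Cone_def CoCone_def Star_def conflation_op[OF assms] op_ext_sel by blast+
  show P: "Proj (op_ext \<B>) = Inj \<B>"
    unfolding Proj_def Inj_def conflation_op[OF assms] op_ext_sel by blast
  show "enough_projectives (op_ext \<B>) \<longleftrightarrow> enough_injectives \<B>"
    unfolding enough_projectives_def enough_injectives_def P conflation_op[OF assms] op_ext_sel by blast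
qed

text \<open>The vanishing of extensions of \<S> by \<V> becomes that of extensions of \<V> by \<S>.
  Hence the two pairs change order in addition to each being reversed.\<close>

lemma twin_cotorsion_pair_op:
  assumes "category \<B>" "twin_cotorsion_pair \<B> \<S> \<T> \<U> \<V>"
  shows "twin_cotorsion_pair (op_ext \<B>) \<V> \<U> \<T> \<S>"
proof -
  have "additive_subcategory (op_ext \<B>) \<X>" if "additive_subcategory \<B> \<X>" for \<X>
    using that unfolding additive_subcategory_def op_ext_biproduct op_ext_zero_object op_ext_sel by blast
  moreover have "summand_closed (op_ext \<B>) \<X>" if "summand_closed \<B> \<X>" for \<X>
    using that unfolding summand_closed_def op_ext_biproduct by blast
  moreover have "Ext_vanish (op_ext \<B>) \<Y> \<X>" if "Ext_vanish \<B> \<X> \<Y>" for \<X> \<Y>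
    using that by (auto simp: Ext_vanish_def)
  ultimately have "cotorsion_pair (op_ext \<B>) \<Y> \<X>" if "cotorsion_pair \<B> \<X> \<Y>" for \<X> \<Y>
    using that unfolding cotorsion_pair_def op_ext_subcategory[OF assms(1)] op_ext_sel by blast
  then show ?thesis using assms(2) \<open>\<And>\<Y> \<X>. Ext_vanish \<B> \<X> \<Y> \<Longrightarrow> Ext_vanish (op_ext \<B>) \<Y> \<X>\<close>
    unfolding twin_cotorsion_pair_def by blast
qed

section \<open>Twin cotorsion pairs\<close>

locale twin_cotorsion = extriangulated_category +
  fixes \<S> \<T> \<U> \<V> :: "'a set"
  assumes twin: "twin_cotorsion_pair \<B> \<S> \<T> \<U> \<V>"
begin

lemma ST: "cotorsion_pair \<B> \<S> \<T>" and UV: "cotorsion_pair \<B> \<U> \<V>" and SV: "Ext_vanish \<B> \<S> \<V>"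
  using twin by (auto simp: twin_cotorsion_pair_def)

lemma S_subset_U: "\<S> \<subseteq> \<U>"
proof
  fix X assume X: "X \<in> \<S>"
  show "X \<in> \<U>"
    using cotorsion_left_mem[OF UV] Ext_vanishD[OF SV X] X cotorsion_pairD(4)[OF ST] by blast
qed

lemma twin_cotorsion_op: "twin_cotorsion (op_ext \<B>) \<V> \<U> \<T> \<S>"
  using op_ext_extriangulated twin_cotorsion_pair_op[OF category_axioms twin]
  by (simp add: twin_cotorsion_def twin_cotorsion_axioms_def)

section \<open>The subcategories defining the heart, and the morphisms that vanish in it\<close>

abbreviation W where "W \<equiv> \<T> \<inter> \<U>"
abbreviation B_minus where "B_minus \<equiv> CoCone \<B> W \<S>"
abbreviation B_plus where "B_plus \<equiv> Cone \<B> \<V> W"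
abbreviation null where "null \<equiv> factor_ideal \<B> W"

text \<open>\<U> and \<T> may be given different zero objects. The one in \<T> is also a biproduct
  of two copies of the one in \<U>, hence lies in both.\<close>

lemma W_additive: "additive_subcategory \<B> W"
proof -
  obtain Z where Z: "Z \<in> \<U>" "zero_object \<B> Z"
    using cotorsion_pairD(1)[OF UV] unfolding additive_subcategory_def by blast
  obtain Z' where Z': "Z' \<in> \<T>" "zero_object \<B> Z'"
    using cotorsion_pairD(6)[OF ST] unfolding additive_subcategory_def by blast
  have O: "Z \<in> Obj \<B>" "Z' \<in> Obj \<B>" using Z Z' by (auto simp: zero_object_def)
  have "Id \<B> Z = Zero \<B> Z Z" "Id \<B> Z' = Zero \<B> Z' Z'"
    using zero_object_Hom(1)[OF Z(2) O(1)] zero_object_Hom(1)[OF Z'(2) O(2)] Id_Hom O by metis+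
  then have "biproduct \<B> Z Z Z' (Zero \<B> Z Z') (Zero \<B> Z Z') (Zero \<B> Z' Z) (Zero \<B> Z' Z)"
    using O by (simp add: biproduct_def Hom_def)
  then have "Z' \<in> \<U>" using cotorsion_pairD(1)[OF UV] Z(1) unfolding additive_subcategory_def by blast
  then show ?thesis using Z' cotorsion_pairD(1)[OF UV] cotorsion_pairD(6)[OF ST]
    unfolding additive_subcategory_def by blast
qed

text \<open>The obstruction lies in \<open>Ext \<B> C Y\<close>, which vanishes for \<open>C\<close>
  in \<S> and \<open>Y\<close> in \<T>.\<close>

lemma extend_to_T:
  assumes r: "realised \<B> \<delta> A a B b C" and "C \<in> \<S>" "Y \<in> \<T>" "x \<in> Hom \<B> A Y"
  shows "\<exists>y \<in> Hom \<B> B Y. y \<cdot> a = x"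
  using extend_along_inflation[OF r assms(4)] Ext_vanishD[OF cotorsion_pairD(3)[OF ST] assms(2,3)]
    push_closed[OF realisedD(6)[OF r] assms(4) realisedD(1)[OF r]] by blast

lemma lift_from_U:
  assumes r: "realised \<B> \<delta> A a B b C" and "A \<in> \<V>" "Y \<in> \<U>" "x \<in> Hom \<B> Y C"
  shows "\<exists>y \<in> Hom \<B> Y B. b \<cdot> y = x"
  using lift_along_deflation[OF r assms(4)] Ext_vanishD[OF cotorsion_pairD(3)[OF UV] assms(3,2)]
    pull_closed[OF realisedD(4)[OF r] assms(4) realisedD(1)[OF r]] by blast

lemma B_minusE:
  assumes "X \<in> B_minus"
  obtains \<delta> a W0 b S0 where "W0 \<in> \<T>" "W0 \<in> \<U>" "S0 \<in> \<S>" "realised \<B> \<delta> X a W0 b S0"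
  using assms by (auto simp: CoCone_def conflation_def)

lemma B_plusE:
  assumes "X \<in> B_plus"
  obtains \<delta> V0 a W0 b where "W0 \<in> \<T>" "W0 \<in> \<U>" "V0 \<in> \<V>" "realised \<B> \<delta> V0 a W0 b X"
  using assms by (auto simp: Cone_def conflation_def)

lemma B_minusI:
  assumes r: "realised \<B> \<delta> X a W0 b S0" and "W0 \<in> W" "S0 \<in> \<S>"
  shows "X \<in> B_minus"
  using assms realisedD(4)[OF r] unfolding CoCone_def conflation_def by blast

lemma B_plusI:
  assumes r: "realised \<B> \<delta> V0 a W0 b X" and "W0 \<in> W" "V0 \<in> \<V>"
  shows "X \<in> B_plus"
  using assms realisedD(6)[OF r] unfolding Cone_def conflation_def by blast

text \<open>The deflation \<open>W0 -> C\<close> has kernel in \<V>, so every map from \<U> lifts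
  through it.\<close>

lemma null_from_U:
  assumes "X \<in> \<U>" "C \<in> B_plus" "x \<in> Hom \<B> X C"
  shows "x \<in> null X C"
proof -
  obtain \<delta> V0 a W0 b where c: "W0 \<in> \<T>" "W0 \<in> \<U>" "V0 \<in> \<V>" "realised \<B> \<delta> V0 a W0 b C"
    using B_plusE assms(2) by metis
  obtain y where "y \<in> Hom \<B> X W0" "b \<cdot> y = x" using lift_from_U[OF c(4,3) assms(1,3)] by blast
  then show ?thesis using factor_idealI[of W0 W y \<B> X b C] realisedD(3)[OF c(4)] c by auto
qed

text \<open>Choose \<open>Y -> T' -> S'\<close> from the pair of \<S> and \<T>; what has to be shown
  is \<open>T' \<in> \<U>\<close>. By \<open>ET4\<close> the composite \<open>X -> T'\<close> has
  cone \<open>E\<close>, an extension of objects of \<S>. Both \<open>T'\<close> and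
  \<open>W0\<close> are then approximations of \<open>X\<close> in \<T> with cone in \<S>, so each
  inflation of \<open>X\<close> extends along the other.\<close>

lemma B_minus_cone:
  assumes X: "X \<in> B_minus" and r: "realised \<B> \<delta> X a Y b S0" and S0: "S0 \<in> \<S>"
  shows "Y \<in> B_minus"
proof -
  obtain \<delta>1 w W0 w' S1 where W0: "W0 \<in> \<T>" "W0 \<in> \<U>" "S1 \<in> \<S>" and r1: "realised \<B> \<delta>1 X w W0 w' S1"
    using B_minusE X by metis
  obtain T' S' t t' \<delta>2 where T': "T' \<in> \<T>" "S' \<in> \<S>" and r2: "realised \<B> \<delta>2 Y t T' t' S'"
    using cotorsion_pairD(8)[OF ST realisedD(5)[OF r]] by blast
  from ET4[OF r r2] obtain E \<delta>3 c' d e \<delta>4 where E: "realised \<B> \<delta>3 X (t \<cdot> a) T' c' E"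
    "realised \<B> \<delta>4 S0 d E e S'" by blast
  have ES: "E \<in> \<S>" by (rule cotorsion_left_extension_closed[OF ST E(2) S0 T'(2)])
  obtain \<phi> where p: "\<phi> \<in> Hom \<B> T' W0" "\<phi> \<cdot> (t \<cdot> a) = w"
    using extend_to_T[OF E(1) ES W0(1) realisedD(2)[OF r1]] by blast
  obtain \<psi> where q: "\<psi> \<in> Hom \<B> W0 T'" "\<psi> \<cdot> w = t \<cdot> a"
    using extend_to_T[OF r1 W0(3) T'(1) realisedD(2)[OF E(1)]] by blast
  note D = realisedD[OF E(1)]
  have pq: "\<psi> \<cdot> \<phi> \<in> Hom \<B> T' T'" using p q Comp_Hom by blast
  define v where "v = Sub \<B> (Id \<B> T') (\<psi> \<cdot> \<phi>)"
  have v: "v \<in> Hom \<B> T' T'" unfolding v_def by (rule Sub_Hom[OF Id_Hom[OF D(5)] pq])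
  have "v \<cdot> (t \<cdot> a) = Sub \<B> (t \<cdot> a) (\<psi> \<cdot> (\<phi> \<cdot> (t \<cdot> a)))"
    unfolding v_def using D p(1) q(1) realisedD[OF r] realisedD[OF r2] by (simp add: Hom_def)
  also have "\<dots> = Zero \<B> X T'" unfolding p(2) q(2) using D(2) by (simp add: Hom_def)
  finally obtain s where s: "s \<in> Hom \<B> E T'" "s \<cdot> c' = v" using factor_through_deflation[OF E(1) v] by blast
  \<comment> \<open>The identity of \<open>T'\<close> is \<open>\<psi> \<cdot> \<phi>\<close>, which
    passes through \<open>W0\<close> in \<U>, plus \<open>v\<close>, which passes through
    \<open>E\<close> in \<S>. Extensions by \<V> vanish on both, hence on \<open>T'\<close>.\<close>
  have "T' \<in> \<U>"
  proof (rule cotorsion_left_mem[OF UV D(5)])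
    fix V0 \<epsilon> assume V0: "V0 \<in> \<V>" and e: "\<epsilon> \<in> carrier (Ext \<B> T' V0)"
    have VO: "V0 \<in> Obj \<B>" using V0 cotorsion_pairD(5)[OF UV] by blast
    have W0O: "W0 \<in> Obj \<B>" and EO: "E \<in> Obj \<B>" using p s Hom_Obj by blast+
    have "pull \<B> V0 (\<psi> \<cdot> \<phi>) \<epsilon> = pull \<B> V0 \<phi> (pull \<B> V0 \<psi> \<epsilon>)" by (rule pull_Comp[OF VO q(1) p(1) e])
    also have "pull \<B> V0 \<psi> \<epsilon> = \<one>\<^bsub>Ext \<B> W0 V0\<^esub>"
      using Ext_vanishD[OF cotorsion_pairD(3)[OF UV] W0(2) V0] pull_closed[OF VO q(1) e] by blast
    finally have 1: "pull \<B> V0 (\<psi> \<cdot> \<phi>) \<epsilon> = \<one>\<^bsub>Ext \<B> T' V0\<^esub>" using pull_one[OF VO p(1)] by simp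
    have "pull \<B> V0 v \<epsilon> = pull \<B> V0 c' (pull \<B> V0 s \<epsilon>)"
      unfolding s(2)[symmetric] by (rule pull_Comp[OF VO s(1) D(3) e])
    also have "pull \<B> V0 s \<epsilon> = \<one>\<^bsub>Ext \<B> E V0\<^esub>"
      using Ext_vanishD[OF SV ES V0] pull_closed[OF VO s(1) e] by blast
    finally have 2: "pull \<B> V0 v \<epsilon> = \<one>\<^bsub>Ext \<B> T' V0\<^esub>" using pull_one[OF VO D(3)] by simp
    have "Add \<B> v (\<psi> \<cdot> \<phi>) = Id \<B> T'" unfolding v_def using pq D(5) by (simp add: Hom_def del: Comp_Arr)
    then have "\<epsilon> = pull \<B> V0 (Add \<B> v (\<psi> \<cdot> \<phi>)) \<epsilon>" using pull_Id[OF D(5) VO e] by simp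
    also have "\<dots> = \<one>\<^bsub>Ext \<B> T' V0\<^esub>"
      unfolding pull_Add[OF VO v pq e] 1 2 using Ext_group[OF D(5) VO] by (simp add: group.is_monoid)
    finally show "\<epsilon> = \<one>\<^bsub>Ext \<B> T' V0\<^esub>" .
  qed
  then show ?thesis using B_minusI[OF r2] T' by blast
qed

text \<open>An inflation with cone in \<S> is epic modulo \<W> against \<open>B_plus\<close>. The
  factor \<open>f\<close> extends along \<open>m\<close> because it ends in \<T>; what remains of
  \<open>h\<close> kills \<open>m\<close>, so it passes through \<open>S0\<close>, and maps from
  \<S> to \<open>B_plus\<close> are null.\<close>

lemma null_cancel:
  assumes r: "realised \<B> \<delta> X m Y q S0" and S0: "S0 \<in> \<S>" and C: "C \<in> B_plus"
    and h: "h \<in> Hom \<B> Y C" "h \<cdot> m \<in> null X C"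
  shows "h \<in> null Y C"
proof -
  note D = realisedD[OF r]
  obtain W0 f g where f: "W0 \<in> W" "f \<in> Hom \<B> X W0" "g \<in> Hom \<B> W0 C" "h \<cdot> m = g \<cdot> f"
    using h(2) by (auto simp: factor_ideal_iff)
  obtain f' where f': "f' \<in> Hom \<B> Y W0" "f' \<cdot> m = f" using extend_to_T[OF r S0 _ f(2)] f(1) by blast
  have gf: "g \<cdot> f' \<in> Hom \<B> Y C" using f' f Comp_Hom by blast
  define v where "v = Sub \<B> h (g \<cdot> f')"
  have v: "v \<in> Hom \<B> Y C" unfolding v_def by (rule Sub_Hom[OF h(1) gf])
  have "v \<cdot> m = Sub \<B> (h \<cdot> m) (g \<cdot> (f' \<cdot> m))"
    unfolding v_def using D h(1) f(3) f'(1) by (simp add: Hom_def)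
  also have "\<dots> = Zero \<B> X C" unfolding f'(2) f(4) using f(2,3) by (simp add: Hom_def)
  finally obtain t where t: "t \<in> Hom \<B> S0 C" "t \<cdot> q = v" using factor_through_deflation[OF r v] by blast
  have "t \<in> null S0 C" using null_from_U[OF _ C t(1)] S0 S_subset_U by blast
  then have "Sub \<B> h (g \<cdot> f') \<in> null Y C" using factor_ideal_Comp_right[OF _ D(3)] t(2) v_def by metis
  then show ?thesis
    using factor_ideal_cong[OF W_additive h(1) gf] factor_idealI[OF f(1) f'(1) f(3)] by blast
qed

text \<open>The reflection \<open>X \<rightarrow> X'\<close> of Liu--Nakaoka, obtained by (ET4) from \<open>V \<rightarrow> U \<rightarrow> X\<close> and \<open>U \<rightarrow> T \<rightarrow> S\<close>.\<close>

lemma reflection: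
  assumes X: "X \<in> Obj \<B>"
  shows "\<exists>X' r. X' \<in> B_plus \<and> r \<in> Hom \<B> X X' \<and>
    (\<exists>S0 \<in> \<S>. \<exists>\<delta> e. realised \<B> \<delta> X r X' e S0) \<and>
    (\<forall>C \<in> B_plus. \<forall>g \<in> Hom \<B> X C. \<exists>g' \<in> Hom \<B> X' C. g' \<cdot> r = g) \<and>
    (\<exists>U0 \<in> \<U>. \<exists>u \<in> Hom \<B> U0 X. \<forall>Y. \<forall>x \<in> Hom \<B> Y X. r \<cdot> x \<in> null Y X' \<longrightarrow> (\<exists>y \<in> Hom \<B> Y U0. u \<cdot> y = x))"
proof -
  obtain V0 U0 v u \<delta> where U0: "V0 \<in> \<V>" "U0 \<in> \<U>" and r1: "realised \<B> \<delta> V0 v U0 u X"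
    using cotorsion_pairD(7)[OF UV X] by blast
  obtain T0 S0 t s \<delta>' where T0: "T0 \<in> \<T>" "S0 \<in> \<S>" and r2: "realised \<B> \<delta>' U0 t T0 s S0"
    using cotorsion_pairD(8)[OF ST realisedD(5)[OF r1]] by blast
  have TU: "T0 \<in> \<U>" using cotorsion_left_extension_closed[OF UV r2 U0(2)] T0(2) S_subset_U by blast
  from ET4[OF r1 r2] obtain X' \<theta> n r e where E: "realised \<B> \<theta> V0 (t \<cdot> v) T0 n X'"
    "r \<in> Hom \<B> X X'" "e \<in> Hom \<B> X' S0" "n \<cdot> t = r \<cdot> u" "e \<cdot> n = s"
    "realised \<B> (push \<B> S0 u \<delta>') X r X' e S0" "pull \<B> V0 r \<theta> = \<delta>" by blast
  note D1 = realisedD[OF r1] and D2 = realisedD[OF r2] and DE = realisedD[OF E(1)]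
  have X': "X' \<in> B_plus" using B_plusI[OF E(1)] U0 T0 TU by blast
  have ext: "\<exists>g' \<in> Hom \<B> X' C. g' \<cdot> r = g" if C: "C \<in> B_plus" and g: "g \<in> Hom \<B> X C" for C g
  proof -
    obtain \<delta>1 V1 a W1 b where c: "W1 \<in> \<T>" "W1 \<in> \<U>" "V1 \<in> \<V>" "realised \<B> \<delta>1 V1 a W1 b C"
      using B_plusE C by metis
    \<comment> \<open>\<open>g \<cdot> u\<close> lifts to \<open>W1\<close> because
      \<open>U0\<close> is in \<U>, and the lift extends to \<open>T0\<close> because
      \<open>W1\<close> is in \<T>. With \<open>g\<close> this is a cocone on the weak pushout
      square of \<open>t\<close> and \<open>u\<close>.\<close>
    obtain y where y: "y \<in> Hom \<B> U0 W1" "b \<cdot> y = g \<cdot> u"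
      using lift_from_U[OF c(4,3) U0(2) Comp_Hom[OF D1(3) g]] by blast
    obtain y' where y': "y' \<in> Hom \<B> T0 W1" "y' \<cdot> t = y" using extend_to_T[OF r2 T0(2) c(1) y(1)] by blast
    have b: "b \<in> Hom \<B> W1 C" using realisedD(3)[OF c(4)] .
    have "g \<cdot> u = b \<cdot> y' \<cdot> t" using Comp_assoc[OF D2(2) y'(1) b] y(2) y'(2) by simp
    then show ?thesis
      using weak_pushout[OF r2 E(6) D1(3) DE(3) E(4,5) g Comp_Hom[OF y'(1) b]] by blast
  qed
  \<comment> \<open>The same square is a weak pullback, since pulling \<theta> back along
    \<open>r\<close> returns \<delta>. A null \<open>r \<cdot> x\<close> lifts through
    \<open>n\<close>, because its part starting in \<W> does, and the lift pairs with
    \<open>x\<close>.\<close>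
  have "\<exists>y \<in> Hom \<B> Y U0. u \<cdot> y = x" if x: "x \<in> Hom \<B> Y X" "r \<cdot> x \<in> null Y X'" for Y x
  proof -
    obtain W1 f g where f: "W1 \<in> W" "f \<in> Hom \<B> Y W1" "g \<in> Hom \<B> W1 X'" "r \<cdot> x = g \<cdot> f"
      using x(2) by (auto simp: factor_ideal_iff)
    obtain g' where g': "g' \<in> Hom \<B> W1 T0" "n \<cdot> g' = g"
      using lift_from_U[OF E(1) U0(1) _ f(3)] f(1) by blast
    have eq: "r \<cdot> x = n \<cdot> (g' \<cdot> f)" using Comp_assoc[OF f(2) g'(1) DE(3)] g'(2) f(4) by simp
    have r1': "realised \<B> (pull \<B> V0 r \<theta>) V0 v U0 u X" using r1 E(7) by simp
    show ?thesis
      using weak_pullback[OF E(1) r1' E(2) D2(2) E(4) refl x(1) Comp_Hom[OF f(2) g'(1)] eq] by blast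
  qed
  then show ?thesis using X' E(2,6) ext T0(2) U0(2) D1(3) by blast
qed

text \<open>The cone of the reflection map lies in \<S>. Therefore \<open>B_minus_cone\<close> keeps
  the reflection in \<open>B_minus\<close>, and \<open>null_cancel\<close> makes factorisations
  through it unique modulo \<W>.\<close>

lemma heart_reflection:
  assumes X: "X \<in> B_minus"
  shows "\<exists>X' r. X' \<in> heart_objects \<B> \<S> \<T> \<U> \<V> \<and> r \<in> Hom \<B> X X' \<and>
    (\<forall>C \<in> B_plus. \<forall>g \<in> Hom \<B> X C. \<exists>g' \<in> Hom \<B> X' C. g' \<cdot> r = g) \<and>
    (\<forall>C \<in> B_plus. \<forall>h \<in> Hom \<B> X' C. h \<cdot> r \<in> null X C \<longrightarrow> h \<in> null X' C) \<and>
    (\<exists>U0 \<in> \<U>. \<exists>u \<in> Hom \<B> U0 X. \<forall>Y. \<forall>x \<in> Hom \<B> Y X. r \<cdot> x \<in> null Y X' \<longrightarrow> (\<exists>y \<in> Hom \<B> Y U0. u \<cdot> y = x))"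
proof -
  have "X \<in> Obj \<B>" using X by (simp add: CoCone_def)
  from reflection[OF this] obtain X' r S0 \<delta> e where *: "X' \<in> B_plus" "r \<in> Hom \<B> X X'"
    "S0 \<in> \<S>" "realised \<B> \<delta> X r X' e S0"
    "\<forall>C \<in> B_plus. \<forall>g \<in> Hom \<B> X C. \<exists>g' \<in> Hom \<B> X' C. g' \<cdot> r = g"
    "\<exists>U0 \<in> \<U>. \<exists>u \<in> Hom \<B> U0 X. \<forall>Y. \<forall>x \<in> Hom \<B> Y X. r \<cdot> x \<in> null Y X' \<longrightarrow> (\<exists>y \<in> Hom \<B> Y U0. u \<cdot> y = x)"
    by blast
  have "X' \<in> heart_objects \<B> \<S> \<T> \<U> \<V>"
    using B_minus_cone[OF X *(4,3)] *(1) by (simp add: heart_objects_def)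
  moreover have "h \<in> null X' C" if "C \<in> B_plus" "h \<in> Hom \<B> X' C" "h \<cdot> r \<in> null X C" for C h
    using null_cancel[OF *(4,3) that] .
  ultimately show ?thesis using * by blast
qed

text \<open>
  Push the extension \<open>\<delta>\<close> of \<open>S\<close> by \<open>Y\<close> to \<open>U0\<close>. As \<open>\<bbbE>(S, T) = 0\<close>, it comes from an extension
  \<open>S0 \<rightarrow> F \<rightarrow> S\<close>, whose middle term lies in \<open>\<S>\<close>; the syzygy of \<open>F\<close> is the required cover of \<open>Y\<close>.
\<close>

lemma syzygy_cover:
  assumes Y: "Y \<in> B_minus" and y: "y \<in> Hom \<B> Y U0" and U0: "U0 \<in> Star \<B> \<S> \<T>"
    and P: "enough_projectives \<B>" "Proj \<B> \<subseteq> W"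
  shows "\<exists>X \<in> B_minus. \<exists>P \<in> Proj \<B>. \<exists>x \<in> Hom \<B> X P. \<exists>h \<in> Hom \<B> X Y. \<exists>l \<in> Hom \<B> P U0. y \<cdot> h = l \<cdot> x \<and>
    (\<forall>C \<in> B_plus. \<forall>u \<in> Hom \<B> Y C. u \<cdot> h \<in> null X C \<longrightarrow> u \<in> null Y C)"
proof -
  obtain \<delta> w WY b SY where WY: "WY \<in> \<T>" "WY \<in> \<U>" "SY \<in> \<S>" and r: "realised \<B> \<delta> Y w WY b SY"
    using B_minusE Y by metis
  obtain \<sigma> S0 s t T0 where S0: "S0 \<in> \<S>" "T0 \<in> \<T>" and rU: "realised \<B> \<sigma> S0 s U0 t T0"
    using U0 by (auto simp: Star_def conflation_def)
  note D = realisedD[OF r] and DU = realisedD[OF rU]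
  have yd: "push \<B> SY y \<delta> \<in> carrier (Ext \<B> SY U0)" using push_closed[OF D(6) y D(1)] .
  have "push \<B> SY t (push \<B> SY y \<delta>) = \<one>\<^bsub>Ext \<B> SY T0\<^esub>"
    using Ext_vanishD[OF cotorsion_pairD(3)[OF ST] WY(3) S0(2)] push_closed[OF D(6) DU(3) yd] by blast
  then obtain \<epsilon> where e: "\<epsilon> \<in> carrier (Ext \<B> SY S0)" "push \<B> SY s \<epsilon> = push \<B> SY y \<delta>"
    using Ext_exact_middle_op[OF rU D(6) yd] by blast
  obtain i F p where rF: "realised \<B> \<epsilon> S0 i F p SY" using Realn_class[OF D(6) DU(4) e(1)] by blast
  note DF = realisedD[OF rF]
  have F: "F \<in> \<S>" by (rule cotorsion_left_extension_closed[OF ST rF S0(1) WY(3)])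
  obtain X x P \<pi> \<omega> where PP: "P \<in> Proj \<B>" and rP: "realised \<B> \<omega> X x P \<pi> F"
    using P(1) DF(5) unfolding enough_projectives_def conflation_def by blast
  note DP = realisedD[OF rP]
  have PW: "P \<in> W" using PP P(2) by blast
  have X: "X \<in> B_minus" by (rule B_minusI[OF rP PW F])
  \<comment> \<open>Projectivity lifts \<open>p \<cdot> \<pi>\<close> through \<open>b\<close>, and
    \<open>ET3_op\<close> turns the resulting square into the covering map \<open>h\<close>, which
    carries \<omega> to \<delta> pulled back along \<open>p\<close>.\<close>
  obtain g where g: "g \<in> Hom \<B> P WY" "b \<cdot> g = p \<cdot> \<pi>"
    using PP Comp_Hom[OF DP(3) DF(3)] r unfolding Proj_def conflation_def by blast
  from ET3_op[OF rP r g(1) DF(3) g(2)[symmetric]]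
  obtain h where h: "h \<in> Hom \<B> X Y" "push \<B> F h \<omega> = pull \<B> Y p \<delta>" by blast
  have push_h: "push \<B> F (v \<cdot> h) \<omega> = pull \<B> Z p (push \<B> SY v \<delta>)" if v: "v \<in> Hom \<B> Y Z" for v Z
    using push_Comp[OF DP(6) h(1) v DP(1)] h(2) push_pull[OF DF(3) v D(1)] by simp
  \<comment> \<open>An extension pulled back along its own deflation is zero. Pushing \<omega> along
    \<open>y \<cdot> h\<close> gives this zero pushed along \<open>s\<close>, so
    \<open>y \<cdot> h\<close> extends to \<open>P\<close>.\<close>
  have "pull \<B> S0 p \<epsilon> = \<one>\<^bsub>Ext \<B> F S0\<^esub>"
    using pull_liftable[OF rF Id_Hom[OF DF(5)]] Comp_Id[OF DF(3)] by simp
  then have "push \<B> F (y \<cdot> h) \<omega> = \<one>\<^bsub>Ext \<B> F U0\<^esub>"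
    using push_h[OF y] e(2) push_pull[OF DF(3) DU(2) e(1)] push_one[OF DF(5) DU(2)] by simp
  then obtain l where l: "l \<in> Hom \<B> P U0" "l \<cdot> x = y \<cdot> h"
    using extend_along_inflation[OF rP Comp_Hom[OF h(1) y]] by blast
  \<comment> \<open>Nullity of \<open>u \<cdot> h\<close> lets it extend to \<open>P\<close>, as
    \<open>F\<close> is in \<S>. Hence \<delta> pushed along \<open>u\<close> becomes zero over
    \<open>F\<close>, and by exactness it is \<epsilon> pushed along some \<tau> from
    \<open>S0\<close> to \<open>C\<close>.\<close>
  have "u \<in> null Y C" if C: "C \<in> B_plus" and u: "u \<in> Hom \<B> Y C" "u \<cdot> h \<in> null X C" for C u
  proof -
    obtain W1 f k where f: "W1 \<in> W" "f \<in> Hom \<B> X W1" "k \<in> Hom \<B> W1 C" "u \<cdot> h = k \<cdot> f"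
      using u(2) by (auto simp: factor_ideal_iff)
    obtain f' where f': "f' \<in> Hom \<B> P W1" "f' \<cdot> x = f" using extend_to_T[OF rP F _ f(2)] f(1) by blast
    have "u \<cdot> h = k \<cdot> f' \<cdot> x" using Comp_assoc[OF DP(2) f'(1) f(3)] f(4) f'(2) by simp
    then have 1: "pull \<B> C p (push \<B> SY u \<delta>) = \<one>\<^bsub>Ext \<B> F C\<^esub>"
      using push_h[OF u(1)] push_extendable[OF rP Comp_Hom[OF f'(1) f(3)]] by simp
    have CO: "C \<in> Obj \<B>" using u Hom_Obj by blast
    obtain \<tau> where t: "\<tau> \<in> Hom \<B> S0 C" "push \<B> SY \<tau> \<epsilon> = push \<B> SY u \<delta>"
      using Ext_exact_left[OF rF CO push_closed[OF D(6) u(1) D(1)] 1] by blast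
    \<comment> \<open>\<tau> passes through an object of \<T>, which admits only zero extensions by
      \<open>SY\<close>. So \<delta> pushed along \<open>u\<close> is zero, and \<open>u\<close>
      extends to \<open>WY\<close> in \<W>.\<close>
    have "\<tau> \<in> null S0 C" using null_from_U[OF _ C t(1)] S0 S_subset_U by blast
    then obtain W2 t1 t2 where t12: "W2 \<in> W" "t1 \<in> Hom \<B> S0 W2" "t2 \<in> Hom \<B> W2 C" "\<tau> = t2 \<cdot> t1"
      by (auto simp: factor_ideal_iff)
    have "push \<B> SY t1 \<epsilon> = \<one>\<^bsub>Ext \<B> SY W2\<^esub>"
      using Ext_vanishD[OF cotorsion_pairD(3)[OF ST] WY(3)] t12(1) push_closed[OF D(6) t12(2) e(1)] by blast
    then have "push \<B> SY u \<delta> = \<one>\<^bsub>Ext \<B> SY C\<^esub>"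
      using push_Comp[OF D(6) t12(2,3) e(1)] push_one[OF D(6) t12(3)] t(2) t12(4) by simp
    then obtain u' where "u' \<in> Hom \<B> WY C" "u' \<cdot> w = u" using extend_along_inflation[OF r u(1)] by blast
    then show ?thesis using factor_idealI[of WY W w \<B> Y u' C] WY D(2) by auto
  qed
  then show ?thesis using X PP DP(2) h(1) l by metis
qed

text \<open>All universal properties are phrased in \<B> modulo null maps. The lifting clause
  concerns the same \<open>c\<close>; its extra hypotheses sit inside the clause so that cokernels
  exist in every heart, and by duality kernels too.\<close>

lemma heart_cokernel:
  assumes A: "A \<in> heart_objects \<B> \<S> \<T> \<U> \<V>" and B: "B \<in> heart_objects \<B> \<S> \<T> \<U> \<V>" and f: "f \<in> Hom \<B> A B"
  obtains K c where "K \<in> heart_objects \<B> \<S> \<T> \<U> \<V>" "c \<in> Hom \<B> B K" "c \<cdot> f \<in> null A K"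
    "\<And>C g. C \<in> heart_objects \<B> \<S> \<T> \<U> \<V> \<Longrightarrow> g \<in> Hom \<B> B C \<Longrightarrow> g \<cdot> f \<in> null A C \<Longrightarrow>
      \<exists>h \<in> Hom \<B> K C. h \<cdot> c = g"
    "\<And>C h. C \<in> heart_objects \<B> \<S> \<T> \<U> \<V> \<Longrightarrow> h \<in> Hom \<B> K C \<Longrightarrow> h \<cdot> c \<in> null B C \<Longrightarrow> h \<in> null K C"
    "\<And>Y z. enough_projectives \<B> \<Longrightarrow> \<U> \<subseteq> Star \<B> \<S> \<T> \<Longrightarrow> Proj \<B> \<subseteq> W \<Longrightarrow>
      Y \<in> heart_objects \<B> \<S> \<T> \<U> \<V> \<Longrightarrow> z \<in> Hom \<B> Y B \<Longrightarrow> c \<cdot> z \<in> null Y K \<Longrightarrow>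
      \<exists>X \<in> heart_objects \<B> \<S> \<T> \<U> \<V>. \<exists>e \<in> Hom \<B> X Y. \<exists>k \<in> Hom \<B> X A.
        Sub \<B> (f \<cdot> k) (z \<cdot> e) \<in> null X B \<and>
        (\<forall>C \<in> heart_objects \<B> \<S> \<T> \<U> \<V>. \<forall>u \<in> Hom \<B> Y C. u \<cdot> e \<in> null X C \<longrightarrow> u \<in> null Y C)"
proof -
  define \<H> where "\<H> = heart_objects \<B> \<S> \<T> \<U> \<V>"
  have HD: "X \<in> B_minus" "X \<in> B_plus" if "X \<in> \<H>" for X using that by (auto simp: \<H>_def heart_objects_def)
  note AH = A[folded \<H>_def] and BH = B[folded \<H>_def]
  obtain \<delta> w WA b SA where WA: "WA \<in> \<T>" "WA \<in> \<U>" "SA \<in> \<S>" and r: "realised \<B> \<delta> A w WA b SA"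
    using B_minusE HD(1)[OF AH] by metis
  note D = realisedD[OF r]
  from pushout_square[OF r f] obtain M m n q where rM: "realised \<B> (push \<B> SA f \<delta>) B m M q SA"
    and n: "n \<in> Hom \<B> WA M" "q \<cdot> n = b" "n \<cdot> w = m \<cdot> f"
    and pb: "\<And>Y x y. x \<in> Hom \<B> Y B \<Longrightarrow> y \<in> Hom \<B> Y WA \<Longrightarrow> m \<cdot> x = n \<cdot> y \<Longrightarrow>
      \<exists>k \<in> Hom \<B> Y A. f \<cdot> k = x \<and> w \<cdot> k = y" by blast
  note DM = realisedD[OF rM]
  have M: "M \<in> B_minus" by (rule B_minus_cone[OF HD(1)[OF BH] rM WA(3)])
  from heart_reflection[OF M, folded \<H>_def] obtain K \<rho> U0 u where K: "K \<in> \<H>" "\<rho> \<in> Hom \<B> M K"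
    and ext: "\<And>C g. C \<in> B_plus \<Longrightarrow> g \<in> Hom \<B> M C \<Longrightarrow> \<exists>g' \<in> Hom \<B> K C. g' \<cdot> \<rho> = g"
    and canc: "\<And>C h. C \<in> B_plus \<Longrightarrow> h \<in> Hom \<B> K C \<Longrightarrow> h \<cdot> \<rho> \<in> null M C \<Longrightarrow> h \<in> null K C"
    and U0: "U0 \<in> \<U>" "u \<in> Hom \<B> U0 M"
    and fac: "\<And>Y x. x \<in> Hom \<B> Y M \<Longrightarrow> \<rho> \<cdot> x \<in> null Y K \<Longrightarrow> \<exists>y \<in> Hom \<B> Y U0. u \<cdot> y = x" by blast
  define c where "c = \<rho> \<cdot> m"
  have c: "c \<in> Hom \<B> B K" unfolding c_def using DM(2) K(2) Comp_Hom by blast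
  have cf: "c \<cdot> f \<in> null A K"
  proof -
    have "c \<cdot> f = \<rho> \<cdot> n \<cdot> w"
      unfolding c_def using Comp_assoc[OF f DM(2) K(2)] Comp_assoc[OF D(2) n(1) K(2)] n(3) by simp
    then show ?thesis using factor_idealI[of WA W w \<B> A "\<rho> \<cdot> n" K] WA D(2) Comp_Hom[OF n(1) K(2)] by simp
  qed
  \<comment> \<open>The null map \<open>g \<cdot> f\<close> extends to \<open>WA\<close>, so
    \<open>g\<close> passes to the weak pushout \<open>M\<close> and from there to its reflection
    \<open>K\<close>.\<close>
  have ex: "\<exists>h \<in> Hom \<B> K C. h \<cdot> c = g" if C: "C \<in> \<H>" and g: "g \<in> Hom \<B> B C" "g \<cdot> f \<in> null A C" for C g
  proof -
    obtain W1 f1 g1 where f1: "W1 \<in> W" "f1 \<in> Hom \<B> A W1" "g1 \<in> Hom \<B> W1 C" "g \<cdot> f = g1 \<cdot> f1"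
      using g(2) by (auto simp: factor_ideal_iff)
    obtain f2 where f2: "f2 \<in> Hom \<B> WA W1" "f2 \<cdot> w = f1" using extend_to_T[OF r WA(3) _ f1(2)] f1(1) by blast
    have "g \<cdot> f = g1 \<cdot> f2 \<cdot> w" using Comp_assoc[OF D(2) f2(1) f1(3)] f1(4) f2(2) by simp
    from weak_pushout[OF r rM f n(1,3,2) g(1) Comp_Hom[OF f2(1) f1(3)] this]
    obtain z where z: "z \<in> Hom \<B> M C" "z \<cdot> m = g" by blast
    obtain h where h: "h \<in> Hom \<B> K C" "h \<cdot> \<rho> = z" using ext[OF HD(2)[OF C] z(1)] by blast
    have "h \<cdot> c = g" unfolding c_def using Comp_assoc[OF DM(2) K(2) h(1)] h(2) z(2) by simp
    then show ?thesis using h(1) by blast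
  qed
  \<comment> \<open>Cancellation takes two stages: first \<open>m\<close>, whose cone is in \<S>,
    then the reflection \<open>\<rho>\<close>.\<close>
  have un: "h \<in> null K C" if C: "C \<in> \<H>" and h: "h \<in> Hom \<B> K C" "h \<cdot> c \<in> null B C" for C h
  proof (rule canc[OF HD(2)[OF C] h(1)])
    have "h \<cdot> \<rho> \<cdot> m \<in> null B C" using h(2) Comp_assoc[OF DM(2) K(2) h(1)] c_def by simp
    then show "h \<cdot> \<rho> \<in> null M C" using null_cancel[OF rM WA(3) HD(2)[OF C] Comp_Hom[OF K(2) h(1)]] by blast
  qed
  have "\<exists>X \<in> \<H>. \<exists>e \<in> Hom \<B> X Y. \<exists>k \<in> Hom \<B> X A. Sub \<B> (f \<cdot> k) (z \<cdot> e) \<in> null X B \<and>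
      (\<forall>C \<in> \<H>. \<forall>u \<in> Hom \<B> Y C. u \<cdot> e \<in> null X C \<longrightarrow> u \<in> null Y C)"
    if P: "enough_projectives \<B>" "\<U> \<subseteq> Star \<B> \<S> \<T>" "Proj \<B> \<subseteq> W"
      and Y: "Y \<in> \<H>" and z: "z \<in> Hom \<B> Y B" "c \<cdot> z \<in> null Y K" for Y z
  proof -
    have "\<rho> \<cdot> (m \<cdot> z) \<in> null Y K" using z(2) Comp_assoc[OF z(1) DM(2) K(2)] c_def by simp
    then obtain y where y: "y \<in> Hom \<B> Y U0" "u \<cdot> y = m \<cdot> z" using fac[OF Comp_Hom[OF z(1) DM(2)]] by blast
    from syzygy_cover[OF HD(1)[OF Y] y(1) _ P(1,3)] P(2) U0(1)
    obtain X P0 x h l where X: "X \<in> B_minus" "P0 \<in> Proj \<B>" "x \<in> Hom \<B> X P0" "h \<in> Hom \<B> X Y" "l \<in> Hom \<B> P0 U0"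
      "y \<cdot> h = l \<cdot> x"
      and epi: "\<And>C u. C \<in> B_plus \<Longrightarrow> u \<in> Hom \<B> Y C \<Longrightarrow> u \<cdot> h \<in> null X C \<Longrightarrow> u \<in> null Y C" by blast
    have ul: "u \<cdot> l \<in> Hom \<B> P0 M" using Comp_Hom[OF X(5) U0(2)] .
    \<comment> \<open>Since \<open>b = q \<cdot> n\<close>, projectivity yields
      \<open>n \<cdot> p2\<close> with the same image under \<open>q\<close> as
      \<open>u \<cdot> l\<close>. The difference then comes from \<open>B\<close> by a map
      \<open>p1\<close>.\<close>
    obtain p2 where p2: "p2 \<in> Hom \<B> P0 WA" "b \<cdot> p2 = q \<cdot> (u \<cdot> l)"
      using X(2) Comp_Hom[OF ul DM(3)] r unfolding Proj_def conflation_def by blast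
    define v where "v = Sub \<B> (u \<cdot> l) (n \<cdot> p2)"
    have np: "n \<cdot> p2 \<in> Hom \<B> P0 M" using Comp_Hom[OF p2(1) n(1)] .
    have v: "v \<in> Hom \<B> P0 M" unfolding v_def by (rule Sub_Hom[OF ul np])
    have "q \<cdot> v = Sub \<B> (q \<cdot> (u \<cdot> l)) (q \<cdot> n \<cdot> p2)"
      unfolding v_def using ul p2(1) n(1) DM(3) U0(2) X(5) by (simp add: Hom_def)
    also have "\<dots> = Zero \<B> P0 SA" unfolding n(2) p2(2) using ul DM(3) U0(2) X(5) by (simp add: Hom_def)
    finally obtain p1 where p1: "p1 \<in> Hom \<B> P0 B" "m \<cdot> p1 = v" using factor_through_inflation[OF rM v] by blast
    have zh: "z \<cdot> h \<in> Hom \<B> X B" and px: "p1 \<cdot> x \<in> Hom \<B> X B" and px2: "p2 \<cdot> x \<in> Hom \<B> X WA"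
      using Comp_Hom z(1) X(3,4) p1(1) p2(1) by blast+
    have "m \<cdot> (z \<cdot> h) = m \<cdot> z \<cdot> h" by (rule Comp_assoc[OF X(4) z(1) DM(2)])
    also have "\<dots> = u \<cdot> (y \<cdot> h)" unfolding y(2)[symmetric] by (rule Comp_assoc[OF X(4) y(1) U0(2), symmetric])
    also have "\<dots> = u \<cdot> l \<cdot> x" unfolding X(6) by (rule Comp_assoc[OF X(3,5) U0(2)])
    finally have mzh: "m \<cdot> (z \<cdot> h) = u \<cdot> l \<cdot> x" .
    have "m \<cdot> (p1 \<cdot> x) = v \<cdot> x" unfolding p1(2)[symmetric] by (rule Comp_assoc[OF X(3) p1(1) DM(2)])
    also have "\<dots> = Sub \<B> (u \<cdot> l \<cdot> x) (n \<cdot> (p2 \<cdot> x))"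
      unfolding v_def using ul X(3,5) p2(1) n(1) U0(2) by (simp add: Hom_def)
    finally have mpx: "m \<cdot> (p1 \<cdot> x) = Sub \<B> (u \<cdot> l \<cdot> x) (n \<cdot> (p2 \<cdot> x))" .
    have ulx: "u \<cdot> l \<cdot> x \<in> Hom \<B> X M" and npx: "n \<cdot> (p2 \<cdot> x) \<in> Hom \<B> X M"
      using Comp_Hom ul X(3) n(1) px2 by blast+
    \<comment> \<open>Correcting \<open>z \<cdot> h\<close> by a map through \<open>P0\<close> makes
      its image in \<open>M\<close> equal to \<open>n \<cdot> (p2 \<cdot> x)\<close>. The weak
      pullback property then factors it strictly through \<open>f\<close>.\<close>
    define v' where "v' = Sub \<B> (z \<cdot> h) (p1 \<cdot> x)"
    have v': "v' \<in> Hom \<B> X B" unfolding v'_def by (rule Sub_Hom[OF zh px])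
    have "m \<cdot> v' = Sub \<B> (m \<cdot> (z \<cdot> h)) (m \<cdot> (p1 \<cdot> x))"
      unfolding v'_def using zh[unfolded Hom_def] px[unfolded Hom_def] DM(2) by (simp add: Hom_def del: Comp_assoc_Arr Comp_Arr)
    also have "\<dots> = Sub \<B> (u \<cdot> l \<cdot> x) (Sub \<B> (u \<cdot> l \<cdot> x) (n \<cdot> (p2 \<cdot> x)))" unfolding mzh mpx ..
    also have "\<dots> = n \<cdot> (p2 \<cdot> x)"
      using ulx npx by (simp add: Hom_def del: Comp_assoc_Arr Comp_Arr)
    finally obtain k' where k': "k' \<in> Hom \<B> X A" "f \<cdot> k' = v'" using pb[OF v' px2] by blast
    \<comment> \<open>The syzygy \<open>X\<close> is known only to lie in \<open>B_minus\<close>.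
      Its reflection lies in the heart, and the maps to \<open>Y\<close> and \<open>A\<close> extend
      to it.\<close>
    from heart_reflection[OF X(1), folded \<H>_def] obtain X' \<rho>' where X': "X' \<in> \<H>" "\<rho>' \<in> Hom \<B> X X'"
      and ext': "\<And>C g. C \<in> B_plus \<Longrightarrow> g \<in> Hom \<B> X C \<Longrightarrow> \<exists>g' \<in> Hom \<B> X' C. g' \<cdot> \<rho>' = g"
      and canc': "\<And>C h. C \<in> B_plus \<Longrightarrow> h \<in> Hom \<B> X' C \<Longrightarrow> h \<cdot> \<rho>' \<in> null X C \<Longrightarrow> h \<in> null X' C" by blast
    obtain e where e: "e \<in> Hom \<B> X' Y" "e \<cdot> \<rho>' = h" using ext'[OF HD(2)[OF Y] X(4)] by blast
    obtain k where k: "k \<in> Hom \<B> X' A" "k \<cdot> \<rho>' = k'" using ext'[OF HD(2)[OF AH] k'(1)] by blast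
    have fk: "f \<cdot> k \<in> Hom \<B> X' B" and ze: "z \<cdot> e \<in> Hom \<B> X' B" using Comp_Hom f k z e by blast+
    \<comment> \<open>Before the reflection is cancelled, the difference is the negative of
      \<open>p1 \<cdot> x\<close>, which factors through the projective \<open>P0\<close> and so is
      null.\<close>
    have "Sub \<B> (f \<cdot> k) (z \<cdot> e) \<cdot> \<rho>' = Sub \<B> (f \<cdot> (k \<cdot> \<rho>')) (z \<cdot> (e \<cdot> \<rho>'))"
      using f k(1) z(1) e(1) X'(2) by (simp add: Hom_def)
    also have "\<dots> = Sub \<B> (Sub \<B> (z \<cdot> h) (p1 \<cdot> x)) (z \<cdot> h)" unfolding k(2) e(2) k'(2) v'_def ..
    also have "\<dots> = Neg \<B> (p1 \<cdot> x)"
      using zh px Add_commute[of "Neg \<B> (p1 \<cdot> x)" "Neg \<B> (z \<cdot> h)"] by (simp add: Hom_def del: Comp_assoc_Arr Comp_Arr)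
    also have "\<dots> \<in> null X B"
      using factor_ideal_Neg[OF factor_idealI[OF _ X(3) p1(1)]] X(2) P(3) by blast
    finally have "Sub \<B> (f \<cdot> k) (z \<cdot> e) \<in> null X' B" using canc'[OF HD(2)[OF BH] Sub_Hom[OF fk ze]] by blast
    moreover have "u \<in> null Y C" if C: "C \<in> \<H>" and u: "u \<in> Hom \<B> Y C" "u \<cdot> e \<in> null X' C" for C u
    proof (rule epi[OF HD(2)[OF C] u(1)])
      have "u \<cdot> h = u \<cdot> e \<cdot> \<rho>'" using Comp_assoc[OF X'(2) e(1) u(1)] e(2) by simp
      then show "u \<cdot> h \<in> null X C" using factor_ideal_Comp_right[OF u(2) X'(2)] by simp
    qed
    ultimately show ?thesis using X'(1) e(1) k(1) by blast
  qed
  note lift = this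
  show thesis by (rule that[unfolded \<H>_def[symmetric], OF K(1) c cf ex un lift])
qed

end

section \<open>Quotients by an ideal\<close>

text \<open>A two-sided ideal, together with a class of objects closed under finite sums, makes
  \<open>quotient_category\<close> additive.\<close>

locale ideal_quotient = additive_category K for K :: "('o, 'm, 'z) category_scheme" (structure) +
  fixes \<X> :: "'o set" and I :: "'o \<Rightarrow> 'o \<Rightarrow> 'm set"
  assumes objects: "\<X> \<subseteq> Obj K"
    and ideal_Hom: "f \<in> I X Y \<Longrightarrow> f \<in> Hom K X Y"
    and ideal_Zero: "X \<in> Obj K \<Longrightarrow> Y \<in> Obj K \<Longrightarrow> Zero K X Y \<in> I X Y"
    and ideal_Add: "f \<in> I X Y \<Longrightarrow> g \<in> I X Y \<Longrightarrow> Add K f g \<in> I X Y"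
    and ideal_Neg: "f \<in> I X Y \<Longrightarrow> Neg K f \<in> I X Y"
    and ideal_left: "f \<in> I X Y \<Longrightarrow> g \<in> Hom K Y Z \<Longrightarrow> g \<cdot> f \<in> I X Z"
    and ideal_right: "f \<in> I X Y \<Longrightarrow> g \<in> Hom K Z X \<Longrightarrow> f \<cdot> g \<in> I Z Y"
    and zero_closed: "\<exists>Z \<in> \<X>. zero_object K Z"
    and sum_closed: "A \<in> \<X> \<Longrightarrow> B \<in> \<X> \<Longrightarrow> biproduct K A B S i j p q \<Longrightarrow> S \<in> \<X>"
begin

abbreviation Q where "Q \<equiv> quotient_category K \<X> I"
abbreviation rc where "rc \<equiv> residue_class K I"

lemma rc_iff:
  assumes f: "f \<in> Hom K X Y"
  shows "g \<in> rc f \<longleftrightarrow> g \<in> Hom K X Y \<and> Sub K g f \<in> I X Y"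
proof
  assume "g \<in> rc f"
  then obtain i where i: "i \<in> I X Y" "g = Add K i f"
    using f by (auto simp: residue_class_def r_coset_def HomGrp_def Hom_def)
  have iH: "i \<in> Hom K X Y" by (rule ideal_Hom[OF i(1)])
  have "Sub K g f = i" unfolding i(2) using f iH by (simp add: Hom_def)
  then show "g \<in> Hom K X Y \<and> Sub K g f \<in> I X Y" using i Add_Hom[OF iH f] by simp
next
  assume g: "g \<in> Hom K X Y \<and> Sub K g f \<in> I X Y"
  have "g = Add K (Sub K g f) f" using f g by (simp add: Hom_def)
  then have "\<exists>i \<in> I X Y. g = Add K i f" using g by blast
  then show "g \<in> rc f" using f by (auto simp: residue_class_def r_coset_def HomGrp_def Hom_def)
qed

lemma rc_eq:
  assumes f: "f \<in> Hom K X Y" and g: "g \<in> Hom K X Y"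
  shows "rc f = rc g \<longleftrightarrow> Sub K f g \<in> I X Y"
proof
  have "Sub K f f = Zero K X Y" using f by (simp add: Hom_def)
  then have "f \<in> rc f" using rc_iff[OF f] f ideal_Zero Hom_Obj[OF f] by simp
  then show "rc f = rc g \<Longrightarrow> Sub K f g \<in> I X Y" using rc_iff[OF g] by simp
next
  assume fg: "Sub K f g \<in> I X Y"
  have "h \<in> rc f \<longleftrightarrow> h \<in> rc g" for h
  proof (cases "h \<in> Hom K X Y")
    case h: True
    have "Add K (Sub K h f) (Sub K f g) = Sub K h g" using f g h by (simp add: Hom_def)
    moreover have "Add K (Sub K h g) (Neg K (Sub K f g)) = Sub K h f"
      using f g h Add_commute[of "Neg K f" g] by (simp add: Hom_def)
    ultimately show ?thesis
      unfolding rc_iff[OF f] rc_iff[OF g] using ideal_Add ideal_Neg[OF fg] fg by metis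
  qed (simp add: rc_iff[OF f] rc_iff[OF g])
  then show "rc f = rc g" by blast
qed

text \<open>Whatever representative is chosen, it differs from \<open>f\<close> by an element of the
  ideal; this makes the operations on cosets computable.\<close>

lemma some_rc:
  assumes f: "f \<in> Hom K X Y"
  shows "(SOME g. g \<in> rc f) \<in> Hom K X Y" "Sub K (SOME g. g \<in> rc f) f \<in> I X Y"
proof -
  have "f \<in> rc f" using rc_iff[OF f] rc_eq[OF f f] f by blast
  then have "(SOME g. g \<in> rc f) \<in> rc f" by (rule someI)
  then show "(SOME g. g \<in> rc f) \<in> Hom K X Y" "Sub K (SOME g. g \<in> rc f) f \<in> I X Y"
    using rc_iff[OF f] by auto
qed

lemma rc_Zero_iff: "f \<in> Hom K X Y \<Longrightarrow> rc f = rc (Zero K X Y) \<longleftrightarrow> f \<in> I X Y"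
  using rc_eq[of f X Y "Zero K X Y"] Zero_Hom[of X Y] Hom_Obj[of f X Y] by (simp add: Hom_def)

lemma Obj_Q [simp]: "Obj Q = \<X>"
  by (simp add: quotient_category_def)

lemma Zero_Q: "Zero Q X Y = rc (Zero K X Y)"
  by (simp add: quotient_category_def)

lemma Id_Q: "Id Q X = rc (Id K X)"
  by (simp add: quotient_category_def)

text \<open>Independence of representatives comes from splitting the difference of composites as
  \<open>(g' - g) f' + g (f' - f)\<close>, one term for each side of the ideal.\<close>

lemma Comp_Q:
  assumes f: "f \<in> Hom K X Y" and g: "g \<in> Hom K Y Z"
  shows "rc g \<cdot>\<^bsub>Q\<^esub> rc f = rc (g \<cdot> f)"
proof -
  define f' where "f' = (SOME f'. f' \<in> rc f)"
  define g' where "g' = (SOME g'. g' \<in> rc g)"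
  have f': "f' \<in> Hom K X Y" "Sub K f' f \<in> I X Y" unfolding f'_def by (rule some_rc[OF f])+
  have g': "g' \<in> Hom K Y Z" "Sub K g' g \<in> I Y Z" unfolding g'_def by (rule some_rc[OF g])+
  have "Add K (Sub K g' g \<cdot> f') (g \<cdot> Sub K f' f) \<in> I X Z"
    using ideal_Add ideal_right[OF g'(2) f'(1)] ideal_left[OF f'(2) g] by blast
  moreover have "Add K (Sub K g' g \<cdot> f') (g \<cdot> Sub K f' f) = Sub K (g' \<cdot> f') (g \<cdot> f)"
    using f g f'(1) g'(1) by (simp add: Hom_def)
  ultimately have "rc (g' \<cdot> f') = rc (g \<cdot> f)"
    using rc_eq[OF Comp_Hom[OF f'(1) g'(1)] Comp_Hom[OF f g]] by simp
  moreover have "rc g \<cdot>\<^bsub>Q\<^esub> rc f = rc (g' \<cdot> f')" by (simp add: quotient_category_def f'_def g'_def)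
  ultimately show ?thesis by simp
qed

lemma Add_Q:
  assumes f: "f \<in> Hom K X Y" and g: "g \<in> Hom K X Y"
  shows "Add Q (rc f) (rc g) = rc (Add K f g)"
proof -
  define f' where "f' = (SOME f'. f' \<in> rc f)"
  define g' where "g' = (SOME g'. g' \<in> rc g)"
  have f': "f' \<in> Hom K X Y" "Sub K f' f \<in> I X Y" unfolding f'_def by (rule some_rc[OF f])+
  have g': "g' \<in> Hom K X Y" "Sub K g' g \<in> I X Y" unfolding g'_def by (rule some_rc[OF g])+
  have "Add K (Sub K f' f) (Sub K g' g) \<in> I X Y" using ideal_Add f' g' by blast
  moreover have "Add K (Sub K f' f) (Sub K g' g) = Sub K (Add K f' g') (Add K f g)"
    using f g f'(1) g'(1) by (simp add: Hom_def Add_left_commute)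
  ultimately have "rc (Add K f' g') = rc (Add K f g)"
    using rc_eq[OF Add_Hom[OF f'(1) g'(1)] Add_Hom[OF f g]] by simp
  moreover have "Add Q (rc f) (rc g) = rc (Add K f' g')" by (simp add: quotient_category_def f'_def g'_def)
  ultimately show ?thesis by simp
qed

lemma Arr_Q: "F \<in> Arr Q \<longleftrightarrow> (\<exists>X \<in> \<X>. \<exists>Y \<in> \<X>. \<exists>f \<in> Hom K X Y. F = rc f)"
proof -
  have "carrier (HomGrp K X Y Mod I X Y) = rc ` Hom K X Y" for X Y
    unfolding carrier_FactGroup by (auto simp: HomGrp_def residue_class_def Hom_def)
  then show ?thesis by (auto simp: quotient_category_def)
qed

lemma Dom_Q: "f \<in> Hom K X Y \<Longrightarrow> Dom Q (rc f) = X"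
  and Cod_Q: "f \<in> Hom K X Y \<Longrightarrow> Cod Q (rc f) = Y"
  using some_rc(1)[of f X Y] by (auto simp: quotient_category_def Hom_def)

lemma Hom_Q: "F \<in> Hom Q X Y \<longleftrightarrow> X \<in> \<X> \<and> Y \<in> \<X> \<and> (\<exists>f \<in> Hom K X Y. F = rc f)"
proof
  assume F: "F \<in> Hom Q X Y"
  then obtain X' Y' f where "X' \<in> \<X>" "Y' \<in> \<X>" "f \<in> Hom K X' Y'" "F = rc f" using Arr_Q by (auto simp: Hom_def)
  then show "X \<in> \<X> \<and> Y \<in> \<X> \<and> (\<exists>f \<in> Hom K X Y. F = rc f)" using F Dom_Q Cod_Q by (auto simp: Hom_def[of Q])
next
  assume "X \<in> \<X> \<and> Y \<in> \<X> \<and> (\<exists>f \<in> Hom K X Y. F = rc f)"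
  then show "F \<in> Hom Q X Y" using Arr_Q Dom_Q Cod_Q by (auto simp: Hom_def[of Q])
qed

lemma rc_Hom: "X \<in> \<X> \<Longrightarrow> Y \<in> \<X> \<Longrightarrow> f \<in> Hom K X Y \<Longrightarrow> rc f \<in> Hom Q X Y"
  using Hom_Q by blast

lemma Hom_QE:
  assumes "F \<in> Hom Q X Y"
  obtains f where "f \<in> Hom K X Y" "F = rc f" "X \<in> \<X>" "Y \<in> \<X>"
  using assms Hom_Q by blast

lemma category_Q: "category Q"
proof
  show "Dom Q F \<in> Obj Q" "Cod Q F \<in> Obj Q" if F: "F \<in> Arr Q" for F
  proof -
    obtain X Y f where "X \<in> \<X>" "Y \<in> \<X>" "f \<in> Hom K X Y" "F = rc f" using Arr_Q F by blast
    then show "Dom Q F \<in> Obj Q" "Cod Q F \<in> Obj Q" using Dom_Q Cod_Q by simp_all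
  qed
  show "Id Q X \<in> Hom Q X X" if "X \<in> Obj Q" for X
    using that rc_Hom Id_Hom objects by (simp add: Id_Q subset_iff)
next
  fix F G X Y Z assume F: "F \<in> Hom Q X Y" and G: "G \<in> Hom Q Y Z"
  obtain f where f: "f \<in> Hom K X Y" "F = rc f" "X \<in> \<X>" "Y \<in> \<X>" using F by (rule Hom_QE)
  obtain g where g: "g \<in> Hom K Y Z" "G = rc g" "Y \<in> \<X>" "Z \<in> \<X>" using G by (rule Hom_QE)
  show "G \<cdot>\<^bsub>Q\<^esub> F \<in> Hom Q X Z"
    unfolding f(2) g(2) Comp_Q[OF f(1) g(1)] by (rule rc_Hom[OF f(3) g(4) Comp_Hom[OF f(1) g(1)]])
next
  fix F G H X Y Z W assume F: "F \<in> Hom Q W X" and G: "G \<in> Hom Q X Y" and H: "H \<in> Hom Q Y Z"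
  obtain f where f: "f \<in> Hom K W X" "F = rc f" using F by (rule Hom_QE)
  obtain g where g: "g \<in> Hom K X Y" "G = rc g" using G by (rule Hom_QE)
  obtain h where h: "h \<in> Hom K Y Z" "H = rc h" using H by (rule Hom_QE)
  show "H \<cdot>\<^bsub>Q\<^esub> (G \<cdot>\<^bsub>Q\<^esub> F) = (H \<cdot>\<^bsub>Q\<^esub> G) \<cdot>\<^bsub>Q\<^esub> F"
    unfolding f(2) g(2) h(2) Comp_Q[OF f(1) g(1)] Comp_Q[OF g(1) h(1)]
      Comp_Q[OF Comp_Hom[OF f(1) g(1)] h(1)] Comp_Q[OF f(1) Comp_Hom[OF g(1) h(1)]]
      Comp_assoc[OF f(1) g(1) h(1)] ..
next
  fix F X Y assume F: "F \<in> Hom Q X Y"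
  obtain f where f: "f \<in> Hom K X Y" "F = rc f" "X \<in> \<X>" "Y \<in> \<X>" using F by (rule Hom_QE)
  show "F \<cdot>\<^bsub>Q\<^esub> Id Q X = F" "Id Q Y \<cdot>\<^bsub>Q\<^esub> F = F"
    using f Comp_Q[OF Id_Hom f(1)] Comp_Q[OF f(1) Id_Hom] objects Comp_Id[OF f(1)] Id_Comp[OF f(1)] by (auto simp: Id_Q)
qed

lemma preadditive_Q: "preadditive_category Q"
proof (intro preadditive_category.intro preadditive_category_axioms.intro category_Q)
  fix X Y assume "X \<in> Obj Q" "Y \<in> Obj Q"
  then have X: "X \<in> \<X>" "Y \<in> \<X>" "X \<in> Obj K" "Y \<in> Obj K" using objects by auto
  have Z: "Zero Q X Y \<in> Hom Q X Y" unfolding Zero_Q using X by (intro rc_Hom Zero_Hom)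
  show "comm_group (HomGrp Q X Y)"
  proof (rule comm_groupI, simp_all add: HomGrp_def Z)
    fix F G assume F: "F \<in> Hom Q X Y" and G: "G \<in> Hom Q X Y"
    obtain f where f: "f \<in> Hom K X Y" "F = rc f" using F by (rule Hom_QE)
    obtain g where g: "g \<in> Hom K X Y" "G = rc g" using G by (rule Hom_QE)
    show "Add Q F G \<in> Hom Q X Y" unfolding f(2) g(2) Add_Q[OF f(1) g(1)] using rc_Hom Add_Hom f g X by blast
    have "Add K f g = Add K g f" by (rule Add_commute) (use f g in \<open>simp_all add: Hom_def\<close>)
    then show "Add Q F G = Add Q G F" unfolding f(2) g(2) Add_Q[OF f(1) g(1)] Add_Q[OF g(1) f(1)] by simp
    fix H assume H: "H \<in> Hom Q X Y"
    obtain h where h: "h \<in> Hom K X Y" "H = rc h" using H by (rule Hom_QE)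
    have "Add K (Add K f g) h = Add K f (Add K g h)"
      by (rule Add_assoc) (use f g h in \<open>simp_all add: Hom_def\<close>)
    then show "Add Q (Add Q F G) H = Add Q F (Add Q G H)"
      unfolding f(2) g(2) h(2) Add_Q[OF f(1) g(1)] Add_Q[OF g(1) h(1)]
        Add_Q[OF Add_Hom[OF f(1) g(1)] h(1)] Add_Q[OF f(1) Add_Hom[OF g(1) h(1)]] by simp
  next
    fix F assume F: "F \<in> Hom Q X Y"
    obtain f where f: "f \<in> Hom K X Y" "F = rc f" using F by (rule Hom_QE)
    have "Add K (Zero K X Y) f = f" "Add K (Neg K f) f = Zero K X Y" using f by (simp_all add: Hom_def)
    then show "Add Q (Zero Q X Y) F = F" "\<exists>G \<in> Hom Q X Y. Add Q G F = Zero Q X Y"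
      using f(2) Add_Q[OF Zero_Hom[OF X(3,4)] f(1)] Add_Q[OF Neg_Hom[OF f(1)] f(1)] rc_Hom[OF X(1,2) Neg_Hom[OF f(1)]]
      by (auto simp: Zero_Q)
  qed
next
  fix F F' G X Y Z assume F: "F \<in> Hom Q X Y" and F': "F' \<in> Hom Q X Y" and G: "G \<in> Hom Q Y Z"
  obtain f where f: "f \<in> Hom K X Y" "F = rc f" using F by (rule Hom_QE)
  obtain f' where f': "f' \<in> Hom K X Y" "F' = rc f'" using F' by (rule Hom_QE)
  obtain g where g: "g \<in> Hom K Y Z" "G = rc g" using G by (rule Hom_QE)
  show "G \<cdot>\<^bsub>Q\<^esub> Add Q F F' = Add Q (G \<cdot>\<^bsub>Q\<^esub> F) (G \<cdot>\<^bsub>Q\<^esub> F')"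
    unfolding f(2) f'(2) g(2) Add_Q[OF f(1) f'(1)] Comp_Q[OF f(1) g(1)] Comp_Q[OF f'(1) g(1)]
      Comp_Q[OF Add_Hom[OF f(1) f'(1)] g(1)] Add_Q[OF Comp_Hom[OF f(1) g(1)] Comp_Hom[OF f'(1) g(1)]]
      Comp_Add[OF f(1) f'(1) g(1)] ..
next
  fix F G G' X Y Z assume F: "F \<in> Hom Q X Y" and G: "G \<in> Hom Q Y Z" and G': "G' \<in> Hom Q Y Z"
  obtain f where f: "f \<in> Hom K X Y" "F = rc f" using F by (rule Hom_QE)
  obtain g where g: "g \<in> Hom K Y Z" "G = rc g" using G by (rule Hom_QE)
  obtain g' where g': "g' \<in> Hom K Y Z" "G' = rc g'" using G' by (rule Hom_QE)
  show "Add Q G G' \<cdot>\<^bsub>Q\<^esub> F = Add Q (G \<cdot>\<^bsub>Q\<^esub> F) (G' \<cdot>\<^bsub>Q\<^esub> F)"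
    unfolding f(2) g(2) g'(2) Add_Q[OF g(1) g'(1)] Comp_Q[OF f(1) g(1)] Comp_Q[OF f(1) g'(1)]
      Comp_Q[OF f(1) Add_Hom[OF g(1) g'(1)]] Add_Q[OF Comp_Hom[OF f(1) g(1)] Comp_Hom[OF f(1) g'(1)]]
      Add_Comp[OF f(1) g(1) g'(1)] ..
qed

lemma additive_Q: "additive_category Q"
proof (intro additive_category.intro additive_category_axioms.intro preadditive_Q)
  interpret Q: preadditive_category Q by (rule preadditive_Q)
  obtain Z where Z: "Z \<in> \<X>" "zero_object K Z" using zero_closed by blast
  then have "Id K Z = Zero K Z Z" using zero_object_Hom(1)[of Z Z] Id_Hom by (auto simp: zero_object_def)
  then have "zero_object Q Z" by (intro Q.zero_objectI) (simp_all add: Z Id_Q Zero_Q)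
  then show "\<exists>Z. zero_object Q Z" ..
  fix A B assume "A \<in> Obj Q" "B \<in> Obj Q"
  then have A: "A \<in> \<X>" "B \<in> \<X>" by simp_all
  then obtain S i j p q where bp: "biproduct K A B S i j p q" using ex_biproduct objects by blast
  have S: "S \<in> \<X>" using sum_closed[OF A bp] .
  have H: "i \<in> Hom K A S" "j \<in> Hom K B S" "p \<in> Hom K S A" "q \<in> Hom K S B"
    and e: "p \<cdot> i = Id K A" "q \<cdot> j = Id K B" "q \<cdot> i = Zero K A B" "p \<cdot> j = Zero K B A"
      "Add K (i \<cdot> p) (j \<cdot> q) = Id K S"
    using bp by (auto simp: biproduct_def)
  have "biproduct Q A B S (rc i) (rc j) (rc p) (rc q)"
    unfolding biproduct_def Comp_Q[OF H(1,3)] Comp_Q[OF H(1,4)] Comp_Q[OF H(2,3)] Comp_Q[OF H(2,4)]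
      Comp_Q[OF H(3,1)] Comp_Q[OF H(4,2)] Add_Q[OF Comp_Hom[OF H(3,1)] Comp_Hom[OF H(4,2)]] e Id_Q Zero_Q
    using rc_Hom A S H by simp
  then show "\<exists>S i j p q. biproduct Q A B S i j p q" by blast
qed

text \<open>Existence is asked as an equality of arrows in \<open>K\<close>, while uniqueness holds
  only modulo the ideal. This matches what the construction in the heart provides.\<close>

lemma cokernel_Q:
  assumes X: "A \<in> \<X>" "B \<in> \<X>" "C \<in> \<X>" and f: "f \<in> Hom K A B" and c: "c \<in> Hom K B C" and cf: "c \<cdot> f \<in> I A C"
    and ex: "\<And>Y g. Y \<in> \<X> \<Longrightarrow> g \<in> Hom K B Y \<Longrightarrow> g \<cdot> f \<in> I A Y \<Longrightarrow> \<exists>h \<in> Hom K C Y. h \<cdot> c = g"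
    and un: "\<And>Y h. Y \<in> \<X> \<Longrightarrow> h \<in> Hom K C Y \<Longrightarrow> h \<cdot> c \<in> I B Y \<Longrightarrow> h \<in> I C Y"
  shows "is_cokernel Q (rc c) (rc f)"
proof -
  have d: "Dom Q (rc f) = A" "Cod Q (rc f) = B" "Dom Q (rc c) = B" "Cod Q (rc c) = C"
    using Dom_Q Cod_Q f c by blast+
  show ?thesis
    unfolding is_cokernel_def d Obj_Q
  proof (intro conjI ballI impI)
    show "rc c \<in> Arr Q" "rc f \<in> Arr Q" using Arr_Q X f c by blast+
    show "rc c \<cdot>\<^bsub>Q\<^esub> rc f = Zero Q A C"
      unfolding Comp_Q[OF f c] Zero_Q using rc_Zero_iff[OF Comp_Hom[OF f c]] cf by blast
    fix Y U assume Y: "Y \<in> \<X>" and U: "U \<in> Hom Q B Y" "U \<cdot>\<^bsub>Q\<^esub> rc f = Zero Q A Y"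
    obtain g where g: "g \<in> Hom K B Y" "U = rc g" using U(1) by (rule Hom_QE)
    have "g \<cdot> f \<in> I A Y" using U(2) rc_Zero_iff[OF Comp_Hom[OF f g(1)]] Comp_Q[OF f g(1)] g(2) by (simp add: Zero_Q)
    then obtain h where h: "h \<in> Hom K C Y" "h \<cdot> c = g" using ex[OF Y g(1)] by blast
    show "\<exists>!V. V \<in> Hom Q C Y \<and> V \<cdot>\<^bsub>Q\<^esub> rc c = U"
    proof (rule ex1I[of _ "rc h"])
      show "rc h \<in> Hom Q C Y \<and> rc h \<cdot>\<^bsub>Q\<^esub> rc c = U"
        using rc_Hom[OF X(3) Y h(1)] Comp_Q[OF c h(1)] h(2) g(2) by simp
      fix V assume V: "V \<in> Hom Q C Y \<and> V \<cdot>\<^bsub>Q\<^esub> rc c = U"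
      then obtain v where v: "v \<in> Hom K C Y" "V = rc v" using Hom_QE by metis
      have "rc (v \<cdot> c) = rc (h \<cdot> c)" using V v(2) Comp_Q[OF c v(1)] h(2) g(2) by simp
      then have "Sub K (v \<cdot> c) (h \<cdot> c) \<in> I B Y" using rc_eq[OF Comp_Hom[OF c v(1)] Comp_Hom[OF c h(1)]] by simp
      moreover have "Sub K (v \<cdot> c) (h \<cdot> c) = Sub K v h \<cdot> c" using v(1) h(1) c by (simp add: Hom_def)
      ultimately have "Sub K v h \<in> I C Y" using un[OF Y Sub_Hom[OF v(1) h(1)]] by simp
      then show "V = rc h" using rc_eq[OF v(1) h(1)] v(2) by simp
    qed
  qed (simp add: d)
qed

lemma epic_Q:
  assumes X: "A \<in> \<X>" "B \<in> \<X>" and f: "f \<in> Hom K A B"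
    and un: "\<And>Y h. Y \<in> \<X> \<Longrightarrow> h \<in> Hom K B Y \<Longrightarrow> h \<cdot> f \<in> I A Y \<Longrightarrow> h \<in> I B Y"
  shows "epic Q (rc f)"
proof (rule preadditive_category.epicI[OF preadditive_Q rc_Hom[OF X f]])
  fix Y U assume U: "U \<in> Hom Q B Y" "U \<cdot>\<^bsub>Q\<^esub> rc f = Zero Q A Y"
  obtain g where g: "g \<in> Hom K B Y" "U = rc g" "Y \<in> \<X>" using U(1) by (metis Hom_QE)
  have "g \<cdot> f \<in> I A Y" using U(2) rc_Zero_iff[OF Comp_Hom[OF f g(1)]] Comp_Q[OF f g(1)] g(2) by (simp add: Zero_Q)
  then show "U = Zero Q B Y" using un[OF g(3,1)] rc_Zero_iff[OF g(1)] g(2) by (simp add: Zero_Q)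
qed

end

section \<open>The heart\<close>

context twin_cotorsion
begin

abbreviation \<H> where "\<H> \<equiv> heart_objects \<B> \<S> \<T> \<U> \<V>"

lemma B_minus_biproduct:
  assumes A: "A \<in> B_minus" and A': "A' \<in> B_minus" and bp: "biproduct \<B> A A' S i j p q"
  shows "S \<in> B_minus"
proof -
  obtain \<delta> a W0 b S0 where r: "W0 \<in> \<T>" "W0 \<in> \<U>" "S0 \<in> \<S>" "realised \<B> \<delta> A a W0 b S0"
    using B_minusE A by metis
  obtain \<delta>' a' W0' b' S0' where r': "W0' \<in> \<T>" "W0' \<in> \<U>" "S0' \<in> \<S>" "realised \<B> \<delta>' A' a' W0' b' S0'"
    using B_minusE A' by metis
  obtain WS i1 j1 p1 q1 where bW: "biproduct \<B> W0 W0' WS i1 j1 p1 q1"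
    using ex_biproduct realisedD(5) r(4) r'(4) by blast
  obtain SS i2 j2 p2 q2 where bS: "biproduct \<B> S0 S0' SS i2 j2 p2 q2"
    using ex_biproduct realisedD(6) r(4) r'(4) by blast
  have "WS \<in> W" using bW W_additive r(1,2) r'(1,2) unfolding additive_subcategory_def by blast
  moreover have "SS \<in> \<S>" using bS cotorsion_pairD(1)[OF ST] r(3) r'(3) unfolding additive_subcategory_def by blast
  ultimately show ?thesis by (rule B_minusI[OF Realn_sum[OF r(4) r'(4) bp bW bS]])
qed

lemma W_zero_B_minus:
  assumes "Z \<in> W" "zero_object \<B> Z"
  shows "Z \<in> B_minus"
proof -
  obtain Z' where Z': "Z' \<in> \<S>" "zero_object \<B> Z'"
    using cotorsion_pairD(1)[OF ST] unfolding additive_subcategory_def by blast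
  have "Z \<in> Obj \<B>" using assms(2) by (simp add: zero_object_def)
  then show ?thesis using B_minusI[OF realised_zero_right[OF Z'(2)] assms(1) Z'(1)] by blast
qed

lemma op_B_minus: "CoCone (op_ext \<B>) (\<U> \<inter> \<T>) \<V> = B_plus"
  unfolding op_ext_subcategory[OF category_axioms] by (simp add: Int_commute)

lemma heart_ideal_quotient: "ideal_quotient \<B> \<H> null"
proof (intro ideal_quotient.intro ideal_quotient_axioms.intro additive_category_axioms)
  \<comment> \<open>The closure properties of \<open>B_plus\<close> are those of
    \<open>B_minus\<close> in the opposite category.\<close>
  interpret op: twin_cotorsion "op_ext \<B>" \<V> \<U> \<T> \<S> by (rule twin_cotorsion_op)
  show "\<H> \<subseteq> Obj \<B>" by (auto simp: heart_objects_def CoCone_def)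
  obtain Z where Z: "Z \<in> W" "zero_object \<B> Z" using W_additive unfolding additive_subcategory_def by blast
  have "Z \<in> B_plus" using op.W_zero_B_minus[of Z] Z unfolding op_B_minus by (simp add: Int_commute)
  then show "\<exists>Z \<in> \<H>. zero_object \<B> Z" using W_zero_B_minus[OF Z] Z(2) by (auto simp: heart_objects_def)
  fix A B S i j p q assume *: "A \<in> \<H>" "B \<in> \<H>" "biproduct \<B> A B S i j p q"
  have "S \<in> B_plus" using op.B_minus_biproduct[of A B S p q i j] * unfolding op_B_minus by (simp add: heart_objects_def)
  moreover have "S \<in> B_minus" using B_minus_biproduct[of A B] * by (simp add: heart_objects_def)
  ultimately show "S \<in> \<H>" by (simp add: heart_objects_def)
qed (fact factor_ideal_Hom factor_ideal_Zero[OF W_additive] factor_ideal_Add[OF W_additive] factor_ideal_Neg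
    factor_ideal_Comp_left factor_ideal_Comp_right)+

lemma heart_eq: "heart \<B> \<S> \<T> \<U> \<V> = quotient_category \<B> \<H> null"
  by (simp add: heart_def)

sublocale heart: ideal_quotient \<B> \<H> null
  by (rule heart_ideal_quotient)

lemma heart_ex_cokernel:
  assumes "F \<in> Arr heart.Q"
  shows "\<exists>c. is_cokernel heart.Q c F"
proof -
  obtain A B f where A: "A \<in> \<H>" "B \<in> \<H>" "f \<in> Hom \<B> A B" "F = heart.rc f" using heart.Arr_Q assms by blast
  show ?thesis
  proof (rule heart_cokernel[OF A(1-3)])
    fix C c
    assume c: "C \<in> \<H>" "c \<in> Hom \<B> B C" "c \<cdot> f \<in> null A C"
      and ex: "\<And>Y g. Y \<in> \<H> \<Longrightarrow> g \<in> Hom \<B> B Y \<Longrightarrow> g \<cdot> f \<in> null A Y \<Longrightarrow> \<exists>h \<in> Hom \<B> C Y. h \<cdot> c = g"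
      and un: "\<And>Y h. Y \<in> \<H> \<Longrightarrow> h \<in> Hom \<B> C Y \<Longrightarrow> h \<cdot> c \<in> null B Y \<Longrightarrow> h \<in> null C Y"
    show ?thesis unfolding A(4) using heart.cokernel_Q[OF A(1,2) c(1) A(3) c(2,3) ex un] by blast
  qed
qed

lemma residue_class_op [simp]: "residue_class (op_ext \<B>) (factor_ideal (op_ext \<B>) \<W>) f = residue_class \<B> (factor_ideal \<B> \<W>) f"
  by (simp add: residue_class_def)

text \<open>This is an equality of records: reversal preserves the cosets as sets, so both sides
  choose the same representatives.\<close>

lemma heart_op: "heart (op_ext \<B>) \<V> \<U> \<T> \<S> = op_cat (heart \<B> \<S> \<T> \<U> \<V>)"
proof -
  have "heart_objects (op_ext \<B>) \<V> \<U> \<T> \<S> = \<H>"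
    unfolding heart_objects_def op_ext_subcategory[OF category_axioms] by (auto simp: Int_commute)
  then show ?thesis
    unfolding heart_def quotient_category_def op_cat_def by (auto simp: Int_commute)
qed

text \<open>Kernels are the cokernels of the opposite heart, which is itself the heart of a twin
  cotorsion pair.\<close>

lemma heart_preabelian: "preabelian_category (heart \<B> \<S> \<T> \<U> \<V>)"
  unfolding heart_eq
proof (intro preabelian_category.intro preabelian_category_axioms.intro heart.additive_Q heart_ex_cokernel)
  interpret op: twin_cotorsion "op_ext \<B>" \<V> \<U> \<T> \<S> by (rule twin_cotorsion_op)
  fix F assume "F \<in> Arr heart.Q"
  then have "F \<in> Arr op.heart.Q" unfolding op.heart_eq[symmetric] heart_op heart_eq by simp
  from op.heart_ex_cokernel[OF this]
  show "\<exists>k. is_kernel heart.Q k F" unfolding op.heart_eq[symmetric] heart_op heart_eq op_cat_dual .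
qed

lemma heart_coker_lifting:
  assumes P: "enough_projectives \<B>" "\<U> \<subseteq> Star \<B> \<S> \<T>" "Proj \<B> \<subseteq> W"
  shows "coker_lifting (heart \<B> \<S> \<T> \<U> \<V>)"
  unfolding heart_eq
proof (intro coker_lifting.intro coker_lifting_axioms.intro)
  show pre: "preabelian_category heart.Q" using heart_preabelian heart_eq by simp
  interpret Q: preabelian_category heart.Q by (rule pre)
  fix F A B Z Y D
  assume F: "F \<in> Hom heart.Q A B" and Z: "Z \<in> Hom heart.Q Y B"
    and D: "is_cokernel heart.Q D F" "D \<cdot>\<^bsub>heart.Q\<^esub> Z = Zero heart.Q Y (Cod heart.Q D)"
  obtain f where f: "f \<in> Hom \<B> A B" "F = heart.rc f" "A \<in> \<H>" "B \<in> \<H>" using F by (rule heart.Hom_QE)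
  obtain z where z: "z \<in> Hom \<B> Y B" "Z = heart.rc z" "Y \<in> \<H>" "B \<in> \<H>" using Z by (rule heart.Hom_QE)
  obtain C c where c: "C \<in> \<H>" "c \<in> Hom \<B> B C" "c \<cdot> f \<in> null A C"
    and lift: "\<And>Y z. Y \<in> \<H> \<Longrightarrow> z \<in> Hom \<B> Y B \<Longrightarrow> c \<cdot> z \<in> null Y C \<Longrightarrow>
      \<exists>X \<in> \<H>. \<exists>e \<in> Hom \<B> X Y. \<exists>k \<in> Hom \<B> X A. Sub \<B> (f \<cdot> k) (z \<cdot> e) \<in> null X B \<and>
        (\<forall>C \<in> \<H>. \<forall>u \<in> Hom \<B> Y C. u \<cdot> e \<in> null X C \<longrightarrow> u \<in> null Y C)"
  proof (rule heart_cokernel[OF f(3,4,1)], goal_cases)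
    case (1 C c)
    show thesis by (rule 1(1)[OF 1(2-4) 1(7)[OF P]])
  qed
  have cF: "heart.rc c \<cdot>\<^bsub>heart.Q\<^esub> F = Zero heart.Q A C"
    unfolding f(2) heart.Comp_Q[OF f(1) c(2)] heart.Zero_Q
    using heart.rc_Zero_iff[OF Comp_Hom[OF f(1) c(2)]] c(3) by blast
  have dF: "Dom heart.Q F = A" "Cod heart.Q F = B" using F by (auto simp: Hom_def)
  have DH: "D \<in> Hom heart.Q B (Cod heart.Q D)" using D(1) dF by (auto simp: is_cokernel_def Hom_def)
  \<comment> \<open>\<open>D\<close> is an arbitrary cokernel, whereas the lifting clause concerns
    the constructed \<open>c\<close>. As \<open>c\<close> factors through \<open>D\<close>, it kills
    everything that \<open>D\<close> kills.\<close>
  have "\<exists>!V. V \<in> Hom heart.Q (Cod heart.Q D) C \<and> V \<cdot>\<^bsub>heart.Q\<^esub> D = heart.rc c"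
    using D(1) heart.rc_Hom[OF f(4) c(1,2)] cF c(1) unfolding is_cokernel_def dF heart.Obj_Q by blast
  then obtain V where V: "V \<in> Hom heart.Q (Cod heart.Q D) C" "V \<cdot>\<^bsub>heart.Q\<^esub> D = heart.rc c" by blast
  have "heart.rc c \<cdot>\<^bsub>heart.Q\<^esub> Z = V \<cdot>\<^bsub>heart.Q\<^esub> (D \<cdot>\<^bsub>heart.Q\<^esub> Z)"
    unfolding V(2)[symmetric] by (rule Q.Comp_assoc[OF Z DH V(1), symmetric])
  also have "\<dots> = Zero heart.Q Y C" unfolding D(2) using Q.Comp_Zero_Hom[OF V(1)] z(3) by simp
  finally have "heart.rc (c \<cdot> z) = Zero heart.Q Y C" unfolding z(2) heart.Comp_Q[OF z(1) c(2)] .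
  then have "c \<cdot> z \<in> null Y C" using heart.rc_Zero_iff[OF Comp_Hom[OF z(1) c(2)]] by (simp add: heart.Zero_Q)
  from lift[OF z(3,1) this] obtain X e k where X: "X \<in> \<H>" "e \<in> Hom \<B> X Y" "k \<in> Hom \<B> X A"
    "Sub \<B> (f \<cdot> k) (z \<cdot> e) \<in> null X B"
    "\<And>C u. C \<in> \<H> \<Longrightarrow> u \<in> Hom \<B> Y C \<Longrightarrow> u \<cdot> e \<in> null X C \<Longrightarrow> u \<in> null Y C" by blast
  have "epic heart.Q (heart.rc e)" using heart.epic_Q[OF X(1) z(3) X(2,5)] .
  moreover have "F \<cdot>\<^bsub>heart.Q\<^esub> heart.rc k = Z \<cdot>\<^bsub>heart.Q\<^esub> heart.rc e"
    unfolding f(2) z(2) heart.Comp_Q[OF X(3) f(1)] heart.Comp_Q[OF X(2) z(1)]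
    using heart.rc_eq[OF Comp_Hom[OF X(3) f(1)] Comp_Hom[OF X(2) z(1)]] X(4) by blast
  ultimately show "\<exists>X. \<exists>e \<in> Hom heart.Q X Y. \<exists>k \<in> Hom heart.Q X A. epic heart.Q e \<and> F \<cdot>\<^bsub>heart.Q\<^esub> k = Z \<cdot>\<^bsub>heart.Q\<^esub> e"
    using heart.rc_Hom[OF X(1) z(3) X(2)] heart.rc_Hom[OF X(1) f(3) X(3)] by blast
qed

end

theorem theorem3p5:
  fixes \<B> :: "('o, 'm, 'e) ext_category"
    and \<S> \<T> \<U> \<V> :: "'o set"
  assumes "extriangulated_category \<B>"
    and "enough_projectives \<B>"
    and "enough_injectives \<B>"
    and "twin_cotorsion_pair \<B> \<S> \<T> \<U> \<V>"
  shows "(\<U> \<subseteq> Star \<B> \<S> \<T> \<and> Proj \<B> \<subseteq> \<T> \<inter> \<U> \<longrightarrow>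
           left_integral (heart \<B> \<S> \<T> \<U> \<V>) \<and> integral_category (heart \<B> \<S> \<T> \<U> \<V>)) \<and>
         (\<T> \<subseteq> Star \<B> \<U> \<V> \<and> Inj \<B> \<subseteq> \<T> \<inter> \<U> \<longrightarrow>
           right_integral (heart \<B> \<S> \<T> \<U> \<V>) \<and> integral_category (heart \<B> \<S> \<T> \<U> \<V>))"
proof (intro conjI impI)
  interpret twin_cotorsion \<B> \<S> \<T> \<U> \<V>
    using assms(1,4) by (simp add: twin_cotorsion_def twin_cotorsion_axioms_def)
  let ?H = "heart \<B> \<S> \<T> \<U> \<V>"
  {
    assume "\<U> \<subseteq> Star \<B> \<S> \<T> \<and> Proj \<B> \<subseteq> \<T> \<inter> \<U>"
    then interpret Q: coker_lifting ?H using heart_coker_lifting assms(2) by blast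
    show "left_integral ?H" by (rule Q.left_integral)
    then show "integral_category ?H" using Q.right_integral by (simp add: integral_category_def)
  }
  {
    \<comment> \<open>In the opposite category the second set of hypotheses becomes the first,
      injectives become projectives, and left and right integrality are exchanged.\<close>
    interpret op: twin_cotorsion "op_ext \<B>" \<V> \<U> \<T> \<S> by (rule twin_cotorsion_op)
    assume "\<T> \<subseteq> Star \<B> \<U> \<V> \<and> Inj \<B> \<subseteq> \<T> \<inter> \<U>"
    then interpret Q: coker_lifting "op_cat ?H"
      using op.heart_coker_lifting assms(3)
      unfolding heart_op op_ext_subcategory[OF category_axioms] by blast
    show "right_integral ?H" by (rule right_integral_dual[OF heart_preabelian Q.left_integral])
    then show "integral_category ?H"
      using left_integral_dual[OF heart_preabelian Q.right_integral] by (simp add: integral_category_def)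
  }
qed

end
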